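(* Let $M$ be a compact, connected Lie group of dimension $n$ and let $\omega_1, \dots, \omega_m$ be closed, left-invariant, real-valued $1$-forms on $M$. Then for every $q \in \{0, \dots, n\}$, $$H^q_\xi(C^\infty(M)) = \{0\}, \quad \forall \xi \in \mathbb{Z}^m \setminus \Gamma_{\boldsymbol{\omega}}.$$
   Context: $C^\infty(M; \Lambda^q)$ denotes the space of smooth complex-valued $q$-forms on $M$ (zero for $q = -1$ and $q = n+1$). For $\xi \in \mathbb{Z}^m$ the differential operator $\mathrm{d}'_\xi : C^\infty(M; \Lambda^q) \to C^\infty(M; \Lambda^{q+1})$ is $$\mathrm{d}'_\xi f = \mathrm{d}f + i \sum_{k=1}^m \xi_k\, \omega_k \wedge f;$$ it satisfies $\mathrm{d}'_\xi \circ \mathrm{d}'_\xi = 0$, and $$H^q_\xi(C^\infty(M)) = \frac{\ker\{\mathrm{d}'_\xi : C^\infty(M; \Lambda^q) \to C^\infty(M; \Lambda^{q+1})\}}{\operatorname{ran}\{\mathrm{d}'_\xi : C^\infty(M; \Lambda^{q-1}) \to C^\infty(M; \Lambda^{q})\}}.$$ $\mathscr{S}_\xi$ is the sheaf of germs of smooth functions on $M$ annihilated by $\mathrm{d}'_\xi$, and $$\Gamma_{\boldsymbol{\omega}} = \{\xi \in \mathbb{Z}^m : \mathscr{S}_\xi \text{ has a non-vanishing global section}\},$$ i.e. the set of $\xi$ for which there is a nowhere zero $f \in C^\infty(M)$ with $\mathrm{d}'_\xi f = 0$; it is a subgroup of $\mathbb{Z}^m$. *)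

theory Defs
  imports "HOL-Analysis.Analysis" "HOL-Library.Function_Algebras" "HOL-Library.FuncSet"
begin

text \<open>
  Smooth manifolds are given by an atlas on a Hausdorff, second countable space (the type of
  points).  The model space \<open>'e\<close> stands for the Euclidean space of dimension \<open>n\<close>; the class
  \<open>euclidean_space\<close> is not used because it excludes dimension 0.
\<close>

subsection \<open>Smooth manifolds and Lie groups\<close>

text \<open>
  \<open>Ck_on k S f\<close>: \<open>f\<close> is \<open>k\<close> times continuously differentiable on the open set \<open>S\<close>.
  The domain type is meant to be finite dimensional: only then does continuity of every
  directional derivative amount to continuity of the derivative.
\<close>

primrec Ck_on :: "nat \<Rightarrow> 'e::real_normed_vector set \<Rightarrow> ('e \<Rightarrow> 'b::real_normed_vector) \<Rightarrow> bool" where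
  "Ck_on 0 S f \<longleftrightarrow> continuous_on S f"
| "Ck_on (Suc k) S f \<longleftrightarrow>
     (\<forall>x\<in>S. f differentiable (at x)) \<and> (\<forall>v. Ck_on k S (\<lambda>x. frechet_derivative f (at x) v))"

definition smooth_on :: "'e::real_normed_vector set \<Rightarrow> ('e \<Rightarrow> 'b::real_normed_vector) \<Rightarrow> bool" where
  "smooth_on S f \<longleftrightarrow> (\<forall>k. Ck_on k S f)"

text \<open>A chart \<open>(U, \<phi>)\<close> consists of its domain and its coordinate map (relevant on \<open>U\<close> only).\<close>

type_synonym ('a, 'e) chart = "'a set \<times> ('a \<Rightarrow> 'e)"

definition smooth_atlas :: "('a::topological_space, 'e::real_normed_vector) chart set \<Rightarrow> bool" where
  "smooth_atlas A \<longleftrightarrow>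
     (\<Union>(U, \<phi>)\<in>A. U) = UNIV \<and>
     (\<forall>(U, \<phi>)\<in>A. open U \<and> open (\<phi> ` U) \<and> homeomorphism U (\<phi> ` U) \<phi> (inv_into U \<phi>)) \<and>
     (\<forall>(U, \<phi>)\<in>A. \<forall>(V, \<psi>)\<in>A. smooth_on (\<phi> ` (U \<inter> V)) (\<psi> \<circ> inv_into U \<phi>))"

definition prod_atlas ::
  "('a, 'e) chart set \<Rightarrow> ('b, 'f) chart set \<Rightarrow> ('a \<times> 'b, 'e \<times> 'f) chart set" where
  "prod_atlas A B = {(U \<times> V, map_prod \<phi> \<psi>) |U \<phi> V \<psi>. (U, \<phi>) \<in> A \<and> (V, \<psi>) \<in> B}"

definition smooth_map ::
  "('a::topological_space, 'e::real_normed_vector) chart set \<Rightarrow>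
   ('b::topological_space, 'f::real_normed_vector) chart set \<Rightarrow> ('a \<Rightarrow> 'b) \<Rightarrow> bool" where
  "smooth_map A B F \<longleftrightarrow>
     continuous_on UNIV F \<and>
     (\<forall>(U, \<phi>)\<in>A. \<forall>(V, \<psi>)\<in>B. smooth_on (\<phi> ` (U \<inter> F -` V)) (\<psi> \<circ> F \<circ> inv_into U \<phi>))"

locale lie_group = group gmul one iv
  for gmul :: "'a::{t2_space, second_countable_topology} \<Rightarrow> 'a \<Rightarrow> 'a" and one :: 'a and iv :: "'a \<Rightarrow> 'a" +
  fixes A :: "('a, 'e::{real_inner, banach, heine_borel}) chart set" and n :: nat
  assumes model_dim: "\<exists>B::'e set. finite B \<and> card B = n \<and> independent B \<and> span B = UNIV"
    and atlas: "smooth_atlas A"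
    and smooth_mult: "smooth_map (prod_atlas A A) A (\<lambda>(x, y). gmul x y)"
    and smooth_inverse: "smooth_map A A iv"

subsection \<open>Differential forms\<close>

text \<open>
  A tangent vector at \<open>p\<close> is represented by its coordinate vector in each chart around \<open>p\<close>.
  Accordingly a \<open>q\<close>-form \<open>\<omega>\<close> is a family of coordinate expressions: \<open>\<omega> c p v\<close> is the value at
  the point \<open>p\<close> on the tangent vectors with coordinates \<open>v 0, \<dots>, v (q - 1)\<close> in the chart \<open>c\<close>.
\<close>

type_synonym ('a, 'e, 'b) form = "('a, 'e) chart \<Rightarrow> 'a \<Rightarrow> (nat \<Rightarrow> 'e) \<Rightarrow> 'b"

text \<open>
  \<open>is_pullback A F \<eta> \<omega>\<close> says \<open>F\<^sup>* \<eta> = \<omega>\<close>.  For \<open>F = id\<close> and \<open>\<eta> = \<omega>\<close> this is the transformation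
  law under change of coordinates, i.e. \<open>\<omega>\<close> is well defined on tangent vectors.
\<close>

definition is_pullback ::
  "('a, 'e::real_normed_vector) chart set \<Rightarrow> ('a \<Rightarrow> 'a) \<Rightarrow>
   ('a, 'e, 'b) form \<Rightarrow> ('a, 'e, 'b) form \<Rightarrow> bool" where
  "is_pullback A F \<eta> \<omega> \<longleftrightarrow>
     (\<forall>(U, \<phi>)\<in>A. \<forall>(V, \<psi>)\<in>A. \<forall>p\<in>U. F p \<in> V \<longrightarrow>
        (\<forall>v. \<omega> (U, \<phi>) p v =
             \<eta> (V, \<psi>) (F p) (\<lambda>i. frechet_derivative (\<psi> \<circ> F \<circ> inv_into U \<phi>) (at (\<phi> p)) (v i))))"

text \<open>
  Smooth \<open>q\<close>-forms.  The first condition only normalises the values of the HOL function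
  \<open>\<omega>\<close> at meaningless arguments, so that equality of forms is equality of functions.
\<close>

definition smooth_forms ::
  "('a, 'e::real_normed_vector) chart set \<Rightarrow> nat \<Rightarrow> ('a, 'e, 'b::real_normed_vector) form set" where
  "smooth_forms A q = {\<omega>.
     (\<forall>c p v. \<not> (c \<in> A \<and> p \<in> fst c) \<longrightarrow> \<omega> c p v = 0) \<and>
     (\<forall>c p v w. (\<forall>i<q. v i = w i) \<longrightarrow> \<omega> c p v = \<omega> c p w) \<and>
     (\<forall>c p v. \<forall>i<q. linear (\<lambda>a. \<omega> c p (v(i := a)))) \<and>
     (\<forall>c p v. \<forall>i<q. \<forall>j<q. i \<noteq> j \<and> v i = v j \<longrightarrow> \<omega> c p v = 0) \<and>
     is_pullback A id \<omega> \<omega> \<and>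
     (\<forall>(U, \<phi>)\<in>A. \<forall>v. smooth_on (\<phi> ` U) (\<lambda>x. \<omega> (U, \<phi>) (inv_into U \<phi> x) v))}"

definition omit :: "nat \<Rightarrow> (nat \<Rightarrow> 'e) \<Rightarrow> nat \<Rightarrow> 'e" where
  "omit i v = (\<lambda>j. v (if j < i then j else Suc j))"

text \<open>
  In coordinates \<open>d\<omega>(v\<^sub>0, \<dots>, v\<^sub>q)\<close> is the alternating sum of the derivatives of
  \<open>x \<mapsto> \<omega>\<^sub>x(v\<^sub>0, \<dots>, v\<^sub>i omitted, \<dots>, v\<^sub>q)\<close> in direction \<open>v\<^sub>i\<close>, for constant \<open>v\<^sub>0, \<dots>, v\<^sub>q\<close>.
\<close>

definition ext_deriv ::
  "('a, 'e::real_normed_vector) chart set \<Rightarrow> nat \<Rightarrow>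
   ('a, 'e, 'b::real_normed_vector) form \<Rightarrow> ('a, 'e, 'b) form" where
  "ext_deriv A q \<omega> = (\<lambda>(U, \<phi>) p v.
     if (U, \<phi>) \<in> A \<and> p \<in> U then
       (\<Sum>i\<le>q. (-1) ^ i *\<^sub>R
          frechet_derivative (\<lambda>x. \<omega> (U, \<phi>) (inv_into U \<phi> x) (omit i v)) (at (\<phi> p)) (v i))
     else 0)"

text \<open>
  The wedge product of a real 1-form with a \<open>q\<close>-form, normalised as usual so that
  \<open>(\<alpha> \<and> \<beta>)(v, w) = \<alpha>(v) \<beta>(w) - \<alpha>(w) \<beta>(v)\<close> for 1-forms.
\<close>

definition wedge_one ::
  "nat \<Rightarrow> ('a, 'e, real) form \<Rightarrow> ('a, 'e, 'b::real_vector) form \<Rightarrow> ('a, 'e, 'b) form" where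
  "wedge_one q \<alpha> f = (\<lambda>c p v. \<Sum>i\<le>q. ((-1) ^ i * \<alpha> c p (\<lambda>_. v i)) *\<^sub>R f c p (omit i v))"

definition closed_form ::
  "('a, 'e::real_normed_vector) chart set \<Rightarrow> nat \<Rightarrow>
   ('a, 'e, 'b::real_normed_vector) form \<Rightarrow> bool" where
  "closed_form A q \<omega> \<longleftrightarrow> ext_deriv A q \<omega> = 0"

definition left_invariant ::
  "('a \<Rightarrow> 'a \<Rightarrow> 'a) \<Rightarrow> ('a, 'e::real_normed_vector) chart set \<Rightarrow> ('a, 'e, 'b) form \<Rightarrow> bool" where
  "left_invariant gmul A \<omega> \<longleftrightarrow> (\<forall>g. is_pullback A (gmul g) \<omega> \<omega>)"

text \<open>A function on the manifold, regarded as a 0-form.\<close>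

definition zero_form :: "('a, 'e) chart set \<Rightarrow> ('a \<Rightarrow> 'b::zero) \<Rightarrow> ('a, 'e, 'b) form" where
  "zero_form A f = (\<lambda>c p v. if c \<in> A \<and> p \<in> fst c then f p else 0)"

subsection \<open>The twisted complex\<close>

text \<open>
  Elements of \<open>\<int>\<^sup>m\<close> are represented by the extensional functions \<open>\<xi> \<in> {1..m} \<rightarrow>\<^sub>E UNIV\<close>.
\<close>

definition twisted_d ::
  "('a, 'e::real_normed_vector) chart set \<Rightarrow> nat \<Rightarrow> (nat \<Rightarrow> ('a, 'e, real) form) \<Rightarrow>
   (nat \<Rightarrow> int) \<Rightarrow> nat \<Rightarrow> ('a, 'e, complex) form \<Rightarrow> ('a, 'e, complex) form" where
  "twisted_d A m \<omega> \<xi> q f = (\<lambda>c p v.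
     ext_deriv A q f c p v + \<i> * (\<Sum>k=1..m. of_int (\<xi> k) * wedge_one q (\<omega> k) f c p v))"

definition twisted_cocycles ::
  "('a, 'e::real_normed_vector) chart set \<Rightarrow> nat \<Rightarrow> (nat \<Rightarrow> ('a, 'e, real) form) \<Rightarrow>
   (nat \<Rightarrow> int) \<Rightarrow> nat \<Rightarrow> ('a, 'e, complex) form set" where
  "twisted_cocycles A m \<omega> \<xi> q = {f \<in> smooth_forms A q. twisted_d A m \<omega> \<xi> q f = 0}"

definition twisted_coboundaries ::
  "('a, 'e::real_normed_vector) chart set \<Rightarrow> nat \<Rightarrow> (nat \<Rightarrow> ('a, 'e, real) form) \<Rightarrow>
   (nat \<Rightarrow> int) \<Rightarrow> nat \<Rightarrow> ('a, 'e, complex) form set" where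
  "twisted_coboundaries A m \<omega> \<xi> q =
     (if q = 0 then {0} else twisted_d A m \<omega> \<xi> (q - 1) ` smooth_forms A (q - 1))"

definition cohomologous ::
  "('a, 'e::real_normed_vector) chart set \<Rightarrow> nat \<Rightarrow> (nat \<Rightarrow> ('a, 'e, real) form) \<Rightarrow>
   (nat \<Rightarrow> int) \<Rightarrow> nat \<Rightarrow> ('a, 'e, complex) form rel" where
  "cohomologous A m \<omega> \<xi> q =
     {(f, g). f \<in> twisted_cocycles A m \<omega> \<xi> q \<and> g \<in> twisted_cocycles A m \<omega> \<xi> q \<and>
              f - g \<in> twisted_coboundaries A m \<omega> \<xi> q}"

definition twisted_cohomology ::
  "('a, 'e::real_normed_vector) chart set \<Rightarrow> nat \<Rightarrow> (nat \<Rightarrow> ('a, 'e, real) form) \<Rightarrow>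
   (nat \<Rightarrow> int) \<Rightarrow> nat \<Rightarrow> ('a, 'e, complex) form set set" where
  "twisted_cohomology A m \<omega> \<xi> q = twisted_cocycles A m \<omega> \<xi> q // cohomologous A m \<omega> \<xi> q"

definition cohomology_class ::
  "('a, 'e::real_normed_vector) chart set \<Rightarrow> nat \<Rightarrow> (nat \<Rightarrow> ('a, 'e, real) form) \<Rightarrow>
   (nat \<Rightarrow> int) \<Rightarrow> nat \<Rightarrow> ('a, 'e, complex) form \<Rightarrow> ('a, 'e, complex) form set" where
  "cohomology_class A m \<omega> \<xi> q f = cohomologous A m \<omega> \<xi> q `` {f}"

text \<open>\<open>{(UNIV, id)}\<close> is the standard atlas of the complex plane.\<close>

definition Gamma_group ::
  "('a::topological_space, 'e::real_normed_vector) chart set \<Rightarrow> nat \<Rightarrow>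
   (nat \<Rightarrow> ('a, 'e, real) form) \<Rightarrow> (nat \<Rightarrow> int) set" where
  "Gamma_group A m \<omega> = {\<xi> \<in> {1..m} \<rightarrow>\<^sub>E UNIV.
     \<exists>f::'a \<Rightarrow> complex. smooth_map A {(UNIV, id)} f \<and> (\<forall>x. f x \<noteq> 0) \<and>
       twisted_d A m \<omega> \<xi> 0 (zero_form A f) = 0}"

end

theory Submission
  imports Defs
begin

text \<open>
  Let \<open>\<theta> = \<Sum>\<^sub>k \<xi>\<^sub>k \<omega>\<^sub>k\<close>, a closed left-invariant form, so that the twisted derivative is \<open>d + i \<theta> \<and>\<close>.
  Left translations preserve \<open>\<theta>\<close> and act on twisted cocycles.  Along a curve \<open>\<gamma>\<close> in the group,
  Cartan's formula shows that \<open>exp (i \<integral>\<^sub>\<gamma> \<theta>) L(\<gamma> 1)\<^sup>* f - L(\<gamma> 0)\<^sup>* f\<close> is a coboundary for every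
  cocycle \<open>f\<close>; here it matters that \<open>\<theta>\<close> has a constant value on the velocity field of the
  translations by \<open>\<gamma>(t)\<close>.  As the group is connected, every \<open>g\<close> thus has a phase \<open>c \<noteq> 0\<close> for which
  \<open>c L(g)\<^sup>*\<close> acts trivially on cohomology.  If some \<open>g\<close> has two phases \<open>c \<noteq> c'\<close>, then multiplication by
  \<open>c - c'\<close> is zero on cohomology, which therefore vanishes.  Otherwise \<open>c\<close> is a function of \<open>g\<close> with
  \<open>dc = i c \<theta>\<close>, and \<open>1 / c\<close> is a nowhere vanishing section showing that \<open>\<xi> \<in> \<Gamma>\<close>.
\<close>

text \<open>Along \<open>(t, p) \<mapsto> \<gamma>(t) p\<close> the form \<theta> pulls back to
  \<open>\<lambda>(t) dt + \<theta>\<close>: the second part by left invariance, and \<lambda>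
  depends on t alone because the pullback is closed and the group connected. Left invariance by
  itself would not give this, since the velocity field of these translations is right-invariant.
  Hence \<open>exp (i \<integral> \<lambda>)\<close> is constant in p, commutes with the derivative
  in p and absorbs the \<open>dt\<close> term; integrating the contraction with \<partial>t gives
  the primitive. The phase is picked pointwise by choice and has no regularity to begin with. Its
  uniqueness supplies it: on a short segment in a chart the phase must change by the exponential of
  a line integral, and the resulting differential equation bootstraps to smoothness. Forms are
  families of coordinate expressions. They are therefore evaluated along smooth maps from open sets
  of vector spaces (inverse charts, curves, the coordinates \<open>(t, x)\<close> above), where d is
  an explicit sum of directional derivatives. That this agrees with d on the group rests on the
  symmetry of second derivatives.\<close>

abbreviation fd :: "('a::real_normed_vector \<Rightarrow> 'b::real_normed_vector) \<Rightarrow> 'a \<Rightarrow> 'a \<Rightarrow> 'b" where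
  "fd f x \<equiv> frechet_derivative f (at x)"

lemma fd_eq: "(f has_derivative f') (at x) \<Longrightarrow> fd f x = f'"
  by (metis frechet_derivative_at)

lemma fd_works: "f differentiable (at x) \<Longrightarrow> (f has_derivative fd f x) (at x)"
  by (simp add: frechet_derivative_works)

lemma fd_cong:
  assumes "open S" "x \<in> S" "\<And>y. y \<in> S \<Longrightarrow> f y = g y"
  shows "fd f x = fd g x"
proof -
  have "(f has_derivative D) (at x) \<longleftrightarrow> (g has_derivative D) (at x)" for D
    using assms has_derivative_transform_within_open[of f D x UNIV S g]
      has_derivative_transform_within_open[of g D x UNIV S f] by auto
  then show ?thesis by (simp add: frechet_derivative_def)
qed

lemma differentiable_cong_open:
  assumes "open S" "x \<in> S" "\<And>y. y \<in> S \<Longrightarrow> f y = g y" "f differentiable (at x)"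
  shows "g differentiable (at x)"
  using assms has_derivative_transform_within_open[of f _ x UNIV S g]
  unfolding differentiable_def by blast

subsection \<open>Calculus of \<open>k\<close> times differentiable maps\<close>

lemma Ck_on_cong:
  assumes "open S" "\<And>x. x \<in> S \<Longrightarrow> f x = g x" "Ck_on k S f"
  shows "Ck_on k S g"
  using assms(2,3)
proof (induction k arbitrary: f g)
  case 0
  then show ?case using continuous_on_eq[of S f g] by simp
next
  case (Suc k)
  have "g differentiable (at x)" if "x \<in> S" for x
    using Suc.prems that differentiable_cong_open[OF assms(1) that, of f g] by simp
  moreover have "Ck_on k S (\<lambda>x. fd g x v)" for v
    by (rule Suc.IH[of "\<lambda>x. fd f x v"])
      (use Suc.prems fd_cong[OF assms(1), of _ f g] in auto)
  ultimately show ?case by simp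
qed

lemma Ck_on_subset: "Ck_on k S f \<Longrightarrow> T \<subseteq> S \<Longrightarrow> Ck_on k T f"
  by (induction k arbitrary: f) (auto intro: continuous_on_subset)

lemma Ck_on_local:
  assumes "\<And>x. x \<in> S \<Longrightarrow> \<exists>T. open T \<and> x \<in> T \<and> Ck_on k T f"
  shows "Ck_on k S f"
  using assms
proof (induction k arbitrary: f)
  case 0
  have "continuous (at x within S) f" if "x \<in> S" for x
  proof -
    obtain T where "open T" "x \<in> T" "continuous_on T f" using 0[OF \<open>x \<in> S\<close>] by auto
    then have "continuous (at x) f" using continuous_on_eq_continuous_at by blast
    then show ?thesis by (rule continuous_at_imp_continuous_at_within)
  qed
  then show ?case by (simp add: continuous_on_eq_continuous_within)
next
  case (Suc k)
  have "Ck_on k S (\<lambda>x. fd f x v)" for v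
  proof (rule Suc.IH)
    fix x assume "x \<in> S"
    then obtain T where "open T" "x \<in> T" "Ck_on (Suc k) T f" using Suc.prems by blast
    then show "\<exists>T. open T \<and> x \<in> T \<and> Ck_on k T (\<lambda>x. fd f x v)" by (intro exI[of _ T]) simp
  qed
  moreover have "f differentiable (at x)" if "x \<in> S" for x using Suc.prems[OF that] by auto
  ultimately show ?case by simp
qed

text \<open>The definition refers to \<open>frechet_derivative\<close>, a choice. On an open set any
  known derivative agrees with it, so inductions on the order can use explicit formulas.\<close>

lemma Ck_on_SucI:
  assumes "open S" "\<And>x. x \<in> S \<Longrightarrow> (f has_derivative f' x) (at x)" "\<And>v. Ck_on k S (\<lambda>x. f' x v)"
  shows "Ck_on (Suc k) S f"
proof -
  have "Ck_on k S (\<lambda>x. fd f x v)" for v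
    by (rule Ck_on_cong[OF assms(1) _ assms(3)[of v]]) (use assms(2) fd_eq in metis)
  then show ?thesis using assms(2) by (auto simp: differentiable_def)
qed

lemma Ck_on_SucD:
  assumes "Ck_on (Suc k) S f"
  shows "x \<in> S \<Longrightarrow> (f has_derivative fd f x) (at x)" "Ck_on k S (\<lambda>x. fd f x v)"
  using assms fd_works by auto

lemma Ck_on_Suc_imp: "Ck_on (Suc k) S f \<Longrightarrow> Ck_on k S f"
proof (induction k arbitrary: f)
  case 0
  then show ?case
    by (auto intro!: differentiable_imp_continuous_on differentiable_at_imp_differentiable_on)
next
  case (Suc k)
  then show ?case by simp
qed

lemma Ck_on_imp_continuous_on: "Ck_on k S f \<Longrightarrow> continuous_on S f"
  by (induction k) (simp, metis Ck_on_Suc_imp)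

lemma Ck_on_const: "Ck_on k S (\<lambda>x. c)"
  by (induction k arbitrary: c) auto

lemma Ck_on_linear:
  assumes "bounded_linear L" "open S" "Ck_on k S f"
  shows "Ck_on k S (\<lambda>x. L (f x))"
  using assms(3)
proof (induction k arbitrary: f)
  case 0
  then show ?case using assms(1) bounded_linear.continuous_on by auto
next
  case (Suc k)
  show ?case
    by (intro Ck_on_SucI[OF assms(2), where f' = "\<lambda>x v. L (fd f x v)"]
      bounded_linear.has_derivative[OF assms(1)] Ck_on_SucD[OF Suc.prems] Suc.IH)
qed

lemma Ck_on_ident: "open S \<Longrightarrow> Ck_on k S (\<lambda>x. x)"
  by (cases k) (auto intro: Ck_on_const)

lemma Ck_on_add:
  assumes "open S" "Ck_on k S f" "Ck_on k S g"
  shows "Ck_on k S (\<lambda>x. f x + g x)"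
  using assms(2,3)
proof (induction k arbitrary: f g)
  case 0
  then show ?case by (simp add: continuous_on_add)
next
  case (Suc k)
  show ?case
    by (intro Ck_on_SucI[OF assms(1), where f' = "\<lambda>x v. fd f x v + fd g x v"]
      has_derivative_add Ck_on_SucD[OF Suc.prems(1)] Ck_on_SucD[OF Suc.prems(2)] Suc.IH)
qed

lemma Ck_on_sum:
  assumes "open S" "\<And>i. i \<in> I \<Longrightarrow> Ck_on k S (f i)"
  shows "Ck_on k S (\<lambda>x. \<Sum>i\<in>I. f i x)"
  using assms(2)
  by (induction I rule: infinite_finite_induct) (auto intro: Ck_on_const Ck_on_add[OF assms(1)])

lemma Ck_on_bilinear:
  assumes "bounded_bilinear P" "open S" "Ck_on k S f" "Ck_on k S g"
  shows "Ck_on k S (\<lambda>x. P (f x) (g x))"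
  using assms(3,4)
proof (induction k arbitrary: f g)
  case 0
  then show ?case using bounded_bilinear.continuous_on[OF assms(1)] by auto
next
  case (Suc k)
  show ?case
  proof (rule Ck_on_SucI[OF assms(2), where f' = "\<lambda>x v. P (f x) (fd g x v) + P (fd f x v) (g x)"])
    show "((\<lambda>x. P (f x) (g x)) has_derivative (\<lambda>v. P (f x) (fd g x v) + P (fd f x v) (g x))) (at x)"
      if "x \<in> S" for x
      by (intro bounded_bilinear.FDERIV[OF assms(1)] Ck_on_SucD(1)[OF Suc.prems(1)]
          Ck_on_SucD(1)[OF Suc.prems(2)] that)
    show "Ck_on k S (\<lambda>x. P (f x) (fd g x v) + P (fd f x v) (g x))" for v
      by (intro Ck_on_add[OF assms(2)] Suc.IH Ck_on_SucD(2) Suc.prems Ck_on_Suc_imp)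
  qed
qed

lemma Ck_on_Pair:
  assumes "open S" "Ck_on k S f" "Ck_on k S g"
  shows "Ck_on k S (\<lambda>x. (f x, g x))"
  using assms(2,3)
proof (induction k arbitrary: f g)
  case 0
  then show ?case by (simp add: continuous_on_Pair)
next
  case (Suc k)
  show ?case
    by (intro Ck_on_SucI[OF assms(1), where f' = "\<lambda>x v. (fd f x v, fd g x v)"]
      has_derivative_Pair Ck_on_SucD[OF Suc.prems(1)] Ck_on_SucD[OF Suc.prems(2)] Suc.IH)
qed

text \<open>Finite dimension of an inner product space, possibly \<open>0\<close>, in the form of Parseval's identity.\<close>

definition frame :: "'e::real_inner set \<Rightarrow> bool" where
  "frame B \<longleftrightarrow> finite B \<and> (\<forall>x. x = (\<Sum>b\<in>B. (x \<bullet> b) *\<^sub>R b))"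

lemma frame_expand: "frame B \<Longrightarrow> x = (\<Sum>b\<in>B. (x \<bullet> b) *\<^sub>R b)"
  unfolding frame_def by blast

text \<open>The form in which finite dimension is used throughout: a value in a moving direction
  becomes a finite sum of values in fixed directions, weighted by inner products.\<close>

lemma linear_frame:
  fixes L :: "'e::real_inner \<Rightarrow> 'b::real_normed_vector"
  assumes "frame (B :: 'e set)" "linear L"
  shows "L x = (\<Sum>b\<in>B. (x \<bullet> b) *\<^sub>R L b)"
proof -
  have "L x = L (\<Sum>b\<in>B. (x \<bullet> b) *\<^sub>R b)" using frame_expand[OF assms(1), of x] by simp
  also have "\<dots> = (\<Sum>b\<in>B. (x \<bullet> b) *\<^sub>R L b)" by (simp add: linear_sum[OF assms(2)] linear_cmul[OF assms(2)])
  finally show ?thesis .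
qed

lemma bounded_linear_frame:
  fixes L :: "'e::real_inner \<Rightarrow> 'b::real_normed_vector"
  assumes B: "frame (B :: 'e set)" and L: "linear L"
  shows "bounded_linear L"
proof -
  have "bounded_linear (\<lambda>x. \<Sum>b\<in>B. (x \<bullet> b) *\<^sub>R L b)"
    by (intro bounded_linear_sum bounded_linear_scaleR_const bounded_linear_inner_left)
  moreover have "L = (\<lambda>x. \<Sum>b\<in>B. (x \<bullet> b) *\<^sub>R L b)" using linear_frame[OF B L] by blast
  ultimately show ?thesis by metis
qed

lemma frame_real: "frame {1::real}"
  by (simp add: frame_def)

text \<open>A frame may contain 0, and then \<open>(0, 0)\<close> could occur in both images;
  removing 0 from C makes the union disjoint.\<close>

lemma frame_Pair:
  assumes "frame B" "frame C"
  shows "frame ((\<lambda>b. (b, 0)) ` B \<union> (\<lambda>c. (0, c)) ` (C - {0}))"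
proof -
  have f: "finite B" "finite C" using assms by (auto simp: frame_def)
  have "x = (\<Sum>b\<in>(\<lambda>b. (b, 0)) ` B \<union> (\<lambda>c. (0, c)) ` (C - {0}). (x \<bullet> b) *\<^sub>R b)" for x
  proof -
    have "(\<Sum>b\<in>(\<lambda>b. (b, 0)) ` B \<union> (\<lambda>c. (0, c)) ` (C - {0}). (x \<bullet> b) *\<^sub>R b)
      = (\<Sum>b\<in>(\<lambda>b. (b, 0)) ` B. (x \<bullet> b) *\<^sub>R b) + (\<Sum>b\<in>(\<lambda>c. (0, c)) ` (C - {0}). (x \<bullet> b) *\<^sub>R b)"
      by (rule sum.union_disjoint) (use f in auto)
    also have "\<dots> = (\<Sum>b\<in>B. ((fst x \<bullet> b) *\<^sub>R b, 0)) + (\<Sum>b\<in>C - {0}. (0, (snd x \<bullet> b) *\<^sub>R b))"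
      by (subst (1 2) sum.reindex) (auto simp: inj_on_def inner_prod_def)
    also have "(\<Sum>b\<in>C - {0}. (0::'a, (snd x \<bullet> b) *\<^sub>R b)) = (\<Sum>b\<in>C. (0, (snd x \<bullet> b) *\<^sub>R b))"
      by (rule sum.mono_neutral_left) (use f in \<open>auto simp: zero_prod_def\<close>)
    also have "(\<Sum>b\<in>B. ((fst x \<bullet> b) *\<^sub>R b, 0::'b)) + (\<Sum>b\<in>C. (0, (snd x \<bullet> b) *\<^sub>R b))
        = ((\<Sum>b\<in>B. (fst x \<bullet> b) *\<^sub>R b), (\<Sum>b\<in>C. (snd x \<bullet> b) *\<^sub>R b))"
      by (simp add: prod_eq_iff fst_sum snd_sum)
    also have "\<dots> = x" using frame_expand[OF assms(1), of "fst x"] frame_expand[OF assms(2), of "snd x"] by simp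
    finally show ?thesis by simp
  qed
  then show ?thesis using f unfolding frame_def by blast
qed

text \<open>Orthogonalisation followed by normalisation of the nonzero vectors.\<close>

lemma frame_exists:
  assumes "finite (B::'e::real_inner set)" "span B = UNIV"
  shows "\<exists>C::'e set. frame C"
proof -
  obtain C :: "'e set" where C: "finite C" "span C = UNIV" "pairwise orthogonal C"
    using basis_orthogonal[OF assms(1)] unfolding assms(2) by blast
  define N where "N = (\<lambda>b::'e. b /\<^sub>R norm b) ` (C - {0})"
  have inj: "inj_on (\<lambda>b::'e. b /\<^sub>R norm b) (C - {0})"
  proof (rule inj_onI, rule ccontr)
    fix x y assume h: "x \<in> C - {0}" "y \<in> C - {0}" "x /\<^sub>R norm x = y /\<^sub>R norm y" "x \<noteq> y"
    then have "x \<bullet> y = 0" using C(3) by (auto simp: pairwise_def orthogonal_def)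
    then have "(x /\<^sub>R norm x) \<bullet> (y /\<^sub>R norm y) = 0" by simp
    then show False using h by auto
  qed
  \<comment> \<open>Orthogonal projection onto the span of C. It fixes each member of C, hence every
    vector, and after rescaling it is the expansion in N.\<close>
  let ?P = "\<lambda>x. \<Sum>b\<in>C - {0}. ((x \<bullet> b) / (b \<bullet> b)) *\<^sub>R b"
  have lin: "linear ?P"
    by (rule linearI) (simp_all add: inner_add_left add_divide_distrib scaleR_add_left sum.distrib scaleR_sum_right)
  have C0: "?P c = c" if "c \<in> C" for c
  proof (cases "c = 0")
    case False
    have "?P c = (\<Sum>b\<in>{c}. ((c \<bullet> b) / (b \<bullet> b)) *\<^sub>R b)"
      by (rule sum.mono_neutral_right) (use C that False in \<open>auto simp: pairwise_def orthogonal_def\<close>)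
    then show ?thesis using False by simp
  qed simp
  have "?P x = x" for x
    using linear_eq_on_span[OF lin linear_id, of C x] C0 C(2) by simp
  moreover have "?P x = (\<Sum>b\<in>N. (x \<bullet> b) *\<^sub>R b)" for x
    unfolding N_def by (subst sum.reindex[OF inj])
      (auto intro!: sum.cong simp: power2_norm_eq_inner[symmetric] power2_eq_square divide_simps)
  ultimately have "frame N" unfolding frame_def using C(1) by (simp add: N_def)
  then show ?thesis by blast
qed

text \<open>The chain rule differentiates g in the direction \<open>fd f x v\<close>, which moves
  with x. Expanded in the frame, it is a sum of smooth scalars times \<open>fd g (f x) b\<close>
  with b fixed, and the induction hypothesis applies to those.\<close>

lemma Ck_on_compose:
  fixes f :: "'x::real_normed_vector \<Rightarrow> 'e::real_inner"
  assumes B: "frame (B :: 'e set)" and S: "open S"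
  assumes "Ck_on k T g" "Ck_on k S f" "f ` S \<subseteq> T"
  shows "Ck_on k S (\<lambda>x. g (f x))"
  using assms(3-)
proof (induction k arbitrary: g)
  case 0
  then show ?case using continuous_on_compose2 by fastforce
next
  case (Suc k)
  show ?case
  proof (rule Ck_on_SucI[OF S, where f' = "\<lambda>x v. fd g (f x) (fd f x v)"])
    show "((\<lambda>x. g (f x)) has_derivative (\<lambda>v. fd g (f x) (fd f x v))) (at x)" if "x \<in> S" for x
      using has_derivative_compose[OF Ck_on_SucD(1)[OF Suc.prems(2) that]
          Ck_on_SucD(1)[OF Suc.prems(1)]] that Suc.prems(3) by blast
    fix v
    have "Ck_on k S (\<lambda>x. \<Sum>b\<in>B. (fd f x v \<bullet> b) *\<^sub>R fd g (f x) b)"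
      by (intro Ck_on_sum[OF S] Ck_on_bilinear[OF bounded_bilinear_scaleR S] 
          Ck_on_linear[OF bounded_linear_inner_left S] Suc.IH Ck_on_SucD(2) Suc.prems Ck_on_Suc_imp)
    then show "Ck_on k S (\<lambda>x. fd g (f x) (fd f x v))"
    proof (rule Ck_on_cong[OF S, rotated])
      fix x assume "x \<in> S"
      then have "linear (fd g (f x))"
        using Ck_on_SucD(1)[OF Suc.prems(1)] Suc.prems(3) has_derivative_linear by blast
      then show "(\<Sum>b\<in>B. (fd f x v \<bullet> b) *\<^sub>R fd g (f x) b) = fd g (f x) (fd f x v)"
        using linear_frame[OF B] by metis
    qed
  qed
qed

lemma smooth_onD:
  assumes "smooth_on S f"
  shows "x \<in> S \<Longrightarrow> (f has_derivative fd f x) (at x)" "smooth_on S (\<lambda>x. fd f x v)"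
    "continuous_on S f"
  using assms Ck_on_SucD Ck_on_imp_continuous_on unfolding smooth_on_def by blast+

lemma smooth_on_cong: "open S \<Longrightarrow> (\<And>x. x \<in> S \<Longrightarrow> f x = g x) \<Longrightarrow> smooth_on S f \<Longrightarrow> smooth_on S g"
  unfolding smooth_on_def using Ck_on_cong by blast

lemma smooth_on_subset: "smooth_on S f \<Longrightarrow> T \<subseteq> S \<Longrightarrow> smooth_on T f"
  unfolding smooth_on_def using Ck_on_subset by blast

lemma smooth_on_local:
  assumes "\<And>x. x \<in> S \<Longrightarrow> \<exists>T. open T \<and> x \<in> T \<and> smooth_on T f"
  shows "smooth_on S f"
  using Ck_on_local[of S _ f] assms unfolding smooth_on_def by meson

lemma smooth_on_const: "smooth_on S (\<lambda>x. c)"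
  unfolding smooth_on_def using Ck_on_const by blast

lemma smooth_on_ident: "open S \<Longrightarrow> smooth_on S (\<lambda>x. x)"
  unfolding smooth_on_def using Ck_on_ident by blast

lemma smooth_on_linear: "bounded_linear L \<Longrightarrow> open S \<Longrightarrow> smooth_on S f \<Longrightarrow> smooth_on S (\<lambda>x. L (f x))"
  unfolding smooth_on_def using Ck_on_linear by metis

lemma smooth_on_add: "open S \<Longrightarrow> smooth_on S f \<Longrightarrow> smooth_on S g \<Longrightarrow> smooth_on S (\<lambda>x. f x + g x)"
  unfolding smooth_on_def using Ck_on_add by metis

lemma smooth_on_sum: "open S \<Longrightarrow> (\<And>i. i \<in> I \<Longrightarrow> smooth_on S (f i)) \<Longrightarrow> smooth_on S (\<lambda>x. \<Sum>i\<in>I. f i x)"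
  unfolding smooth_on_def by (intro allI Ck_on_sum) auto

lemma smooth_on_bilinear:
  "bounded_bilinear P \<Longrightarrow> open S \<Longrightarrow> smooth_on S f \<Longrightarrow> smooth_on S g \<Longrightarrow> smooth_on S (\<lambda>x. P (f x) (g x))"
  unfolding smooth_on_def using Ck_on_bilinear by metis

lemma smooth_on_Pair: "open S \<Longrightarrow> smooth_on S f \<Longrightarrow> smooth_on S g \<Longrightarrow> smooth_on S (\<lambda>x. (f x, g x))"
  unfolding smooth_on_def using Ck_on_Pair by metis

lemma smooth_on_compose:
  "frame (B :: 'e set) \<Longrightarrow> open S \<Longrightarrow> smooth_on T g \<Longrightarrow> smooth_on S f \<Longrightarrow> f ` S \<subseteq> T \<Longrightarrow> smooth_on S (\<lambda>x. g (f x))"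
  for f :: "_ \<Rightarrow> 'e::real_inner"
  unfolding smooth_on_def using Ck_on_compose by metis

lemma smooth_on_affine: "open S \<Longrightarrow> smooth_on S (\<lambda>t. a + t *\<^sub>R w)"
  by (intro smooth_on_add smooth_on_const smooth_on_linear[OF bounded_linear_scaleR_left] smooth_on_ident)

subsection \<open>Multilinear maps\<close>

text \<open>Arguments come as an infinite sequence, so dependence on the first q entries alone has
  to be part of the notion.\<close>

definition multilinear :: "nat \<Rightarrow> ((nat \<Rightarrow> 'e::real_vector) \<Rightarrow> 'b::real_vector) \<Rightarrow> bool" where
  "multilinear q F \<longleftrightarrow> (\<forall>v w. (\<forall>i<q. v i = w i) \<longrightarrow> F v = F w) \<and>
     (\<forall>v. \<forall>i<q. linear (\<lambda>a. F (v(i := a))))"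

definition alternating :: "nat \<Rightarrow> ((nat \<Rightarrow> 'e::real_vector) \<Rightarrow> 'b::real_vector) \<Rightarrow> bool" where
  "alternating q F \<longleftrightarrow> multilinear q F \<and>
     (\<forall>v. \<forall>i<q. \<forall>j<q. i \<noteq> j \<and> v i = v j \<longrightarrow> F v = 0)"

lemma multilinear_cong: "multilinear q F \<Longrightarrow> (\<And>i. i < q \<Longrightarrow> v i = w i) \<Longrightarrow> F v = F w"
  unfolding multilinear_def by blast

lemma multilinear_linear: "multilinear q F \<Longrightarrow> i < q \<Longrightarrow> linear (\<lambda>a. F (v(i := a)))"
  unfolding multilinear_def by blast

text \<open>The slots are released one at a time: expanding slot j in the frame leaves a sum of
  scalar multiples in which that slot is constant.\<close>

lemma smooth_on_multilinear:
  fixes f :: "'x::real_normed_vector \<Rightarrow> (nat \<Rightarrow> 'e::real_inner) \<Rightarrow> 'b::real_normed_vector"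
  assumes B: "frame (B :: 'e set)" and S: "open S" and ml: "\<And>x. x \<in> S \<Longrightarrow> multilinear q (f x)"
    and f: "\<And>v. smooth_on S (\<lambda>x. f x v)" and w: "\<And>i. i < q \<Longrightarrow> smooth_on S (w i)"
  shows "smooth_on S (\<lambda>x. f x (\<lambda>i. w i x))"
proof -
  have "smooth_on S (\<lambda>x. f x (\<lambda>i. if i < j then w i x else v i))" if "j \<le> q" for j v
    using that
  proof (induction j arbitrary: v)
    case 0
    then show ?case using f by simp
  next
    case (Suc j)
    have "smooth_on S (\<lambda>x. \<Sum>b\<in>B. (w j x \<bullet> b) *\<^sub>R f x (\<lambda>i. if i < j then w i x else (v(j := b)) i))"
      by (intro smooth_on_sum[OF S] smooth_on_bilinear[OF bounded_bilinear_scaleR S]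
          smooth_on_linear[OF bounded_linear_inner_left S] w Suc.IH) (use Suc.prems in auto)
    then show ?case
    proof (rule smooth_on_cong[OF S, rotated])
      fix x assume x: "x \<in> S"
      let ?v = "\<lambda>i. if i < j then w i x else v i"
      have e: "(\<lambda>i. if i < Suc j then w i x else v i) = ?v(j := w j x)"
        "(\<lambda>i. if i < j then w i x else (v(j := b)) i) = ?v(j := b)" for b
        by (auto simp: fun_eq_iff)
      show "(\<Sum>b\<in>B. (w j x \<bullet> b) *\<^sub>R f x (\<lambda>i. if i < j then w i x else (v(j := b)) i)) =
          f x (\<lambda>i. if i < Suc j then w i x else v i)"
        unfolding e using linear_frame[OF B multilinear_linear[OF ml[OF x], of j ?v], of "w j x"] Suc.prems
        by simp
    qed
  qed
  from this[OF order.refl, of "\<lambda>_. 0"] show ?thesis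
    by (rule smooth_on_cong[OF S, rotated]) (rule multilinear_cong[OF ml], auto)
qed

text \<open>The identities of multilinearity hold for all points near x, and derivatives are unique,
  so the identities pass to the derivative.\<close>

lemma multilinear_has_derivative:
  fixes f :: "'x::real_normed_vector \<Rightarrow> (nat \<Rightarrow> 'e::real_vector) \<Rightarrow> 'b::real_normed_vector"
  assumes S: "open S" "x \<in> S" and ml: "\<And>x. x \<in> S \<Longrightarrow> multilinear q (f x)"
    and f: "\<And>v. ((\<lambda>x. f x v) has_derivative f' v) (at x)"
  shows "multilinear q (\<lambda>v. f' v u)"
proof -
  have uniq: "f' v = D" if "((\<lambda>x. g x) has_derivative D) (at x)" "\<And>x. x \<in> S \<Longrightarrow> g x = f x v" for g D v
  proof -
    have "((\<lambda>x. f x v) has_derivative D) (at x)"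
      by (rule has_derivative_transform_within_open[OF that(1) S]) (use that(2) in auto)
    then show ?thesis using has_derivative_unique f by blast
  qed
  have "f' v u = f' w u" if "\<And>i. i < q \<Longrightarrow> v i = w i" for v w
  proof -
    have "f' v = f' w" by (rule uniq[OF f]) (rule multilinear_cong[OF ml], auto simp: that)
    then show ?thesis by simp
  qed
  moreover have "linear (\<lambda>a. f' (v(i := a)) u)" if i: "i < q" for v i
  proof (rule linearI)
    fix a b and r :: real
    have "f' (v(i := a + b)) = (\<lambda>u. f' (v(i := a)) u + f' (v(i := b)) u)"
      by (rule uniq[OF has_derivative_add[OF f f]])
        (rule linear_add[OF multilinear_linear[OF ml i, of _ v], symmetric])
    then show "f' (v(i := a + b)) u = f' (v(i := a)) u + f' (v(i := b)) u" by (rule fun_cong)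
    have "f' (v(i := r *\<^sub>R a)) = (\<lambda>u. r *\<^sub>R f' (v(i := a)) u)"
      by (rule uniq[OF has_derivative_scaleR_right[OF f]])
        (rule linear_cmul[OF multilinear_linear[OF ml i, of _ v], symmetric])
    then show "f' (v(i := r *\<^sub>R a)) u = r *\<^sub>R f' (v(i := a)) u" by (rule fun_cong)
  qed
  ultimately show ?thesis unfolding multilinear_def by blast
qed

text \<open>Product rule with q + 1 moving parts: the map and its q arguments. Frame expansion of
  one argument after another reduces it to the rule for a scalar times a vector.\<close>

lemma has_derivative_multilinear:
  fixes f :: "'x::real_normed_vector \<Rightarrow> (nat \<Rightarrow> 'e::real_inner) \<Rightarrow> 'b::real_normed_vector"
  assumes B: "frame (B :: 'e set)" and S: "open S" "x \<in> S"
    and ml: "\<And>x. x \<in> S \<Longrightarrow> multilinear q (f x)"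
    and f: "\<And>v. ((\<lambda>x. f x v) has_derivative f' v) (at x)"
    and w: "\<And>i. i < q \<Longrightarrow> (w i has_derivative w' i) (at x)"
  shows "((\<lambda>x. f x (\<lambda>i. w i x)) has_derivative
    (\<lambda>u. f' (\<lambda>i. w i x) u + (\<Sum>k<q. f x ((\<lambda>i. w i x)(k := w' k u))))) (at x)"
proof -
  \<comment> \<open>Slots below j carry the moving vectors, the others are still constant.\<close>
  let ?V = "\<lambda>j x v i. if i < j then w i x else v i"
  have ml': "multilinear q (\<lambda>v. f' v u)" for u by (rule multilinear_has_derivative[OF S ml f])
  have P: "((\<lambda>x. f x (?V j x v)) has_derivative
      (\<lambda>u. f' (?V j x v) u + (\<Sum>k<j. f x ((?V j x v)(k := w' k u))))) (at x)" if "j \<le> q" for j v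
    using that
  proof (induction j arbitrary: v)
    case 0
    then show ?case using f by simp
  next
    case (Suc j)
    then have j: "j < q" by simp
    have e: "?V (Suc j) y v = (?V j y v)(j := w j y)" for y by (auto simp: fun_eq_iff)
    have e2: "?V j y (v(j := b)) = (?V j y v)(j := b)" for b y by (auto simp: fun_eq_iff)
    let ?D = "\<lambda>b u. f' (?V j x (v(j := b))) u + (\<Sum>k<j. f x ((?V j x (v(j := b)))(k := w' k u)))"
    have "((\<lambda>y. \<Sum>b\<in>B. (w j y \<bullet> b) *\<^sub>R f y (?V j y (v(j := b)))) has_derivative
       (\<lambda>u. \<Sum>b\<in>B. (w j x \<bullet> b) *\<^sub>R ?D b u + (w' j u \<bullet> b) *\<^sub>R f x (?V j x (v(j := b))))) (at x)"
      by (intro has_derivative_sum has_derivative_scaleR has_derivative_inner_left w Suc.IH)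
        (use Suc.prems in auto)
    then have "((\<lambda>y. f y (?V (Suc j) y v)) has_derivative
       (\<lambda>u. \<Sum>b\<in>B. (w j x \<bullet> b) *\<^sub>R ?D b u + (w' j u \<bullet> b) *\<^sub>R f x (?V j x (v(j := b))))) (at x)"
    proof (rule has_derivative_transform_within_open[OF _ S])
      fix y assume y: "y \<in> S"
      show "(\<Sum>b\<in>B. (w j y \<bullet> b) *\<^sub>R f y (?V j y (v(j := b)))) = f y (?V (Suc j) y v)"
        unfolding e e2 using linear_frame[OF B multilinear_linear[OF ml[OF y] j, of "?V j y v"], of "w j y"] by simp
    qed
    \<comment> \<open>Three groups of terms arise: the derivative of the map, the derivatives of
      earlier slots, and that of slot j. Each is the frame expansion of a linear map in slot j and
      collapses.\<close>
    moreover have "(\<Sum>b\<in>B. (w j x \<bullet> b) *\<^sub>R ?D b u + (w' j u \<bullet> b) *\<^sub>R f x (?V j x (v(j := b)))) =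
        f' (?V (Suc j) x v) u + (\<Sum>k<Suc j. f x ((?V (Suc j) x v)(k := w' k u)))" for u
    proof -
      have 1: "(\<Sum>b\<in>B. (w j x \<bullet> b) *\<^sub>R f' (?V j x (v(j := b))) u) = f' (?V (Suc j) x v) u"
        unfolding e e2 using linear_frame[OF B multilinear_linear[OF ml' j, of "?V j x v"], of "w j x"] by simp
      have 2: "(\<Sum>b\<in>B. (w' j u \<bullet> b) *\<^sub>R f x (?V j x (v(j := b)))) = f x ((?V (Suc j) x v)(j := w' j u))"
        unfolding e e2 using linear_frame[OF B multilinear_linear[OF ml[OF S(2)] j, of "?V j x v"], of "w' j u"] by simp
      have 3: "(\<Sum>b\<in>B. (w j x \<bullet> b) *\<^sub>R f x ((?V j x (v(j := b)))(k := w' k u))) =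
          f x ((?V (Suc j) x v)(k := w' k u))" if "k < j" for k
      proof -
        have "((?V j x v)(j := b))(k := w' k u) = ((?V j x v)(k := w' k u))(j := b)" for b
          using that by (auto simp: fun_eq_iff)
        then show ?thesis unfolding e e2
          using linear_frame[OF B multilinear_linear[OF ml[OF S(2)] j, of "(?V j x v)(k := w' k u)"], of "w j x"] by simp
      qed
      have "(\<Sum>b\<in>B. (w j x \<bullet> b) *\<^sub>R ?D b u + (w' j u \<bullet> b) *\<^sub>R f x (?V j x (v(j := b)))) =
        (\<Sum>b\<in>B. (w j x \<bullet> b) *\<^sub>R f' (?V j x (v(j := b))) u) +
        (\<Sum>k<j. \<Sum>b\<in>B. (w j x \<bullet> b) *\<^sub>R f x ((?V j x (v(j := b)))(k := w' k u))) +
        (\<Sum>b\<in>B. (w' j u \<bullet> b) *\<^sub>R f x (?V j x (v(j := b))))"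
        by (subst sum.swap[where A = "{..<j}" and B = B]) (simp only: scaleR_add_right scaleR_sum_right sum.distrib)
      also have "\<dots> = f' (?V (Suc j) x v) u + (\<Sum>k<j. f x ((?V (Suc j) x v)(k := w' k u))) +
          f x ((?V (Suc j) x v)(j := w' j u))"
        unfolding 1 2 by (intro arg_cong2[where f = "(+)"] sum.cong refl 3) simp
      finally show ?thesis by (simp only: sum.lessThan_Suc add.assoc)
    qed
    ultimately show ?case by (simp only:)
  qed
  have e: "f y (?V q y (\<lambda>_. 0)) = f y (\<lambda>i. w i y)" if "y \<in> S" for y
    by (rule multilinear_cong[OF ml[OF that]]) auto
  have "((\<lambda>x. f x (\<lambda>i. w i x)) has_derivative
      (\<lambda>u. f' (?V q x (\<lambda>_. 0)) u + (\<Sum>k<q. f x ((?V q x (\<lambda>_. 0))(k := w' k u))))) (at x)"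
    by (rule has_derivative_transform_within_open[OF P[OF order.refl] S]) (rule e)
  moreover have "f' (?V q x (\<lambda>_. 0)) u = f' (\<lambda>i. w i x) u" for u
    by (rule multilinear_cong[OF ml']) auto
  moreover have "f x ((?V q x (\<lambda>_. 0))(k := w' k u)) = f x ((\<lambda>i. w i x)(k := w' k u))" for u k
    by (rule multilinear_cong[OF ml[OF S(2)]]) auto
  ultimately show ?thesis by (simp only:)
qed

text \<open>Polarisation: with \<open>a + b\<close> in both slots the value is 0, and of the four
  terms of its expansion only the mixed ones survive.\<close>

lemma alternating_swap:
  assumes F: "alternating q F" and ij: "i < q" "j < q" "i \<noteq> j"
  shows "F (v(i := a, j := b)) = - F (v(i := b, j := a))"
proof -
  have ml: "multilinear q F" and z: "\<And>v. v i = v j \<Longrightarrow> F v = 0"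
    using F ij unfolding alternating_def by blast+
  have add: "F (u(k := x + y)) = F (u(k := x)) + F (u(k := y))" if "k < q" for u k x y
    by (rule linear_add[OF multilinear_linear[OF ml that, of u]])
  have sw: "w(i := x, j := y) = w(j := y, i := x)" for w x y using ij(3) by (auto simp: fun_eq_iff)
  have "0 = F (v(i := a + b, j := a + b))" using z ij(3) by simp
  also have "\<dots> = F (v(i := a + b, j := a)) + F (v(i := a + b, j := b))" using add[OF ij(2)] .
  also have "\<dots> = F (v(j := a, i := a)) + F (v(j := a, i := b)) + (F (v(j := b, i := a)) + F (v(j := b, i := b)))"
    unfolding sw using add[OF ij(1)] by simp
  also have "\<dots> = F (v(j := a, i := b)) + F (v(j := b, i := a))" using z ij(3) by simp
  finally show ?thesis unfolding sw by (simp add: eq_neg_iff_add_eq_0 add.commute)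
qed

text \<open>Both sequences have the same entries; s has to pass the \<open>k - i - 1\<close> entries
  with indices strictly between i and k, each at the cost of a sign.\<close>

lemma alternating_shift:
  assumes F: "alternating q F" and "i < k" "k \<le> q"
  shows "F (omit i (v(k := s))) = (-1) ^ (k - Suc i) *\<^sub>R F (omit k (v(i := s)))"
  using assms(2,3)
proof (induction k arbitrary: v rule: less_induct)
  case (less k)
  show ?case
  proof (cases "k = Suc i")
    case True
    then have "omit i (v(k := s)) = omit k (v(i := s))" by (auto simp: omit_def fun_eq_iff)
    then have "F (omit i (v(k := s))) = F (omit k (v(i := s)))" by (rule arg_cong)
    then show ?thesis by (simp only: True diff_self_eq_0 power_0 scaleR_one)
  next
    case False
    then obtain l where k: "k = Suc l" and l: "i < l" using less.prems by (cases k) auto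
    \<comment> \<open>Copying \<open>v l\<close> to index k turns the statement for k into the one
      for l, up to a single swap of s with that entry.\<close>
    let ?v = "v(k := v l)"
    have 1: "omit k (v(i := s)) = omit l (?v(i := s))"
      using k l by (auto simp: omit_def fun_eq_iff le_less_Suc_eq)
    have 2: "F (omit i (?v(l := s))) = (-1) ^ (l - Suc i) *\<^sub>R F (omit l (?v(i := s)))"
      by (rule less.IH) (use k l less.prems in auto)
    let ?u = "omit i v"
    have 3: "omit i (?v(l := s)) = ?u(l - 1 := s, l := v l)" "omit i (v(k := s)) = ?u(l - 1 := v l, l := s)"
      using k l by (auto simp: omit_def fun_eq_iff)
    have "F (omit i (v(k := s))) = - F (omit i (?v(l := s)))"
      unfolding 3 by (rule alternating_swap[OF F]) (use k l less.prems in auto)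
    also have "\<dots> = (-1) ^ Suc (l - Suc i) *\<^sub>R F (omit k (v(i := s)))"
      unfolding 1 2 by (simp only: power_Suc mult_minus1 scaleR_minus_left)
    finally show ?thesis using k l by (simp only: Suc_diff_Suc diff_Suc_Suc)
  qed
qed

text \<open>The terms for \<open>(i, k)\<close> and \<open>(k, i)\<close> cancel: moving the
  inserted vector costs \<open>(-1) ^ (k - i - 1)\<close>, which turns \<open>(-1) ^ i\<close> into
  \<open>- (-1) ^ k\<close>. The family S will consist of mixed second derivatives.\<close>

lemma alternating_cancel:
  fixes F :: "(nat \<Rightarrow> 'e::real_vector) \<Rightarrow> 'b::real_vector"
  assumes F: "alternating q F" and sym: "\<And>i k. S i k = S k i"
  shows "(\<Sum>i\<le>q. (-1) ^ i *\<^sub>R (\<Sum>k\<in>{..q} - {i}. F (omit i (v(k := S i k))))) = 0"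
proof -
  let ?a = "\<lambda>i k. if k = i then 0 else (-1) ^ i *\<^sub>R F (omit i (v(k := S i k)))"
  have anti: "?a i k = - ?a k i" if "i < k" "k \<le> q" for i k
  proof -
    have "(-1::real) ^ i * (-1) ^ (k - Suc i) = - ((-1) ^ k)"
    proof -
      have "(-1::real) ^ k = (-1) ^ (i + (k - Suc i) + 1)" using that by simp
      then show ?thesis by (simp add: power_add)
    qed
    then show ?thesis using alternating_shift[OF F that, of v "S i k"] that sym[of i k] by simp
  qed
  have anti': "?a i k = - ?a k i" if "i \<le> q" "k \<le> q" for i k
    using anti[of i k] anti[of k i] that by (cases i k rule: linorder_cases) auto
  have "(\<Sum>k\<in>{..q} - {i}. F (omit i (v(k := S i k)))) = (\<Sum>k\<le>q. if k = i then 0 else F (omit i (v(k := S i k))))" for i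
    by (rule sum.mono_neutral_cong_left) auto
  then have e: "(\<Sum>i\<le>q. (-1) ^ i *\<^sub>R (\<Sum>k\<in>{..q} - {i}. F (omit i (v(k := S i k))))) = (\<Sum>i\<le>q. \<Sum>k\<le>q. ?a i k)"
    by (auto simp: scaleR_sum_right intro!: sum.cong)
  have "(\<Sum>i\<le>q. \<Sum>k\<le>q. ?a i k) = (\<Sum>k\<le>q. \<Sum>i\<le>q. ?a i k)" by (rule sum.swap)
  also have "\<dots> = (\<Sum>k\<le>q. \<Sum>i\<le>q. - ?a k i)" by (intro sum.cong refl anti') auto
  also have "\<dots> = - (\<Sum>k\<le>q. \<Sum>i\<le>q. ?a k i)" by (simp only: sum_negf)
  \<comment> \<open>The double sum equals its own negative.\<close>
  finally have "2 *\<^sub>R (\<Sum>i\<le>q. \<Sum>k\<le>q. ?a i k) = 0" by (simp only: scaleR_2 eq_neg_iff_add_eq_0)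
  then show ?thesis unfolding e by simp
qed

lemma sum_omit:
  fixes G :: "nat \<Rightarrow> 'b::comm_monoid_add"
  assumes "i \<le> q"
  shows "(\<Sum>j<q. G (if j < i then j else Suc j)) = (\<Sum>k\<in>{..q} - {i}. G k)"
proof (rule sum.reindex_bij_betw)
  show "bij_betw (\<lambda>j. if j < i then j else Suc j) {..<q} ({..q} - {i})"
    by (rule bij_betw_byWitness[where f' = "\<lambda>k. if k < i then k else k - 1"]) (use assms in auto)
qed

lemma omit_update: "(omit i v)(j := s) = omit i (v((if j < i then j else Suc j) := s))"
  by (auto simp: omit_def fun_eq_iff)

subsection \<open>Integrals depending on a parameter\<close>

lemma has_derivative_slice:
  assumes "(H has_derivative D) (at (t, x))"
  shows "((\<lambda>x. H (t, x)) has_derivative (\<lambda>u. D (0, u))) (at x)"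
  by (rule has_derivative_compose[where f = "\<lambda>x. (t, x)" and g = H, OF _ assms])
    (intro derivative_intros)

text \<open>P is left general so that one proof serves both scaling by the constant 1 and complex
  multiplication by a phase.\<close>

lemma has_derivative_integral_param:
  fixes H :: "real \<times> 'x::{real_inner,banach} \<Rightarrow> 'b::real_normed_vector"
    and P :: "'d::real_normed_vector \<Rightarrow> 'b \<Rightarrow> 'c::banach"
  assumes B: "frame (B :: 'x set)" and P: "bounded_bilinear P"
    and X: "open X" "x \<in> X" and S: "{0..1} \<times> X \<subseteq> S"
    and H: "Ck_on (Suc 0) S H" and c: "continuous_on {0..1} c"
  shows "((\<lambda>x. integral {0..1} (\<lambda>t. P (c t) (H (t, x)))) has_derivative
    (\<lambda>u. integral {0..1} (\<lambda>t. P (c t) (fd H (t, x) (0, u))))) (at x)"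
proof -
  obtain r where r: "r > 0" "ball x r \<subseteq> X" using X openE by blast
  \<comment> \<open>A ball, because the Leibniz rule works on a convex set of parameters.\<close>
  define U where "U = ball x r"
  have U: "open U" "convex U" "x \<in> U" "{0..1} \<times> U \<subseteq> S" using r S by (auto simp: U_def)
  \<comment> \<open>The derivative as a bounded operator. Written as a finite sum over the frame, it
    is continuous in operator norm as soon as each directional derivative is continuous.\<close>
  define fx where "fx = (\<lambda>y t. \<Sum>b\<in>B. blinfun_scaleR_left (P (c t) (fd H (t, y) (0, b))) o\<^sub>L blinfun_inner_left b)"
  have fd: "(H has_derivative fd H z) (at z)" if "z \<in> S" for z using Ck_on_SucD(1)[OF H that] .
  have fx: "blinfun_apply (fx y t) u = P (c t) (fd H (t, y) (0, u))" if "t \<in> {0..1}" "y \<in> U" for y t u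
  proof -
    have "(t, y) \<in> S" using that U(4) by auto
    then have l: "linear (fd H (t, y))" using fd has_derivative_linear by blast
    have "linear (\<lambda>u. (0::real, u::'x))" by (rule linearI) auto
    then have "linear (fd H (t, y) \<circ> (\<lambda>u. (0, u)))" using l by (rule linear_compose)
    then have "linear (P (c t) \<circ> (fd H (t, y) \<circ> (\<lambda>u. (0, u))))"
      by (rule linear_compose) (rule bounded_linear.linear[OF bounded_bilinear.bounded_linear_right[OF P]])
    then have "linear (\<lambda>u. P (c t) (fd H (t, y) (0, u)))" by (simp add: o_def)
    from linear_frame[OF B this, of u] show ?thesis
      unfolding fx_def by (simp add: blinfun.sum_left)
  qed
  have cfd: "continuous_on (U \<times> cbox 0 1) (\<lambda>z. fd H (snd z, fst z) (0, b))" for b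
    by (rule continuous_on_compose2[OF Ck_on_imp_continuous_on[OF Ck_on_SucD(2)[OF H]]])
      (use U(4) in \<open>auto intro!: continuous_intros\<close>)
  have cc: "continuous_on (U \<times> cbox 0 1) (\<lambda>z. c (snd z))"
    by (rule continuous_on_compose2[OF c]) (auto intro!: continuous_intros)
  have cP: "continuous_on (U \<times> cbox 0 1) (\<lambda>z. P (c (snd z)) (fd H (snd z, fst z) (0, b)))" for b
    by (rule bounded_bilinear.continuous_on[OF P cc cfd])
  have cH: "continuous_on (U \<times> cbox 0 1) (\<lambda>z. P (c (snd z)) (H (snd z, fst z)))"
    by (rule bounded_bilinear.continuous_on[OF P cc],
        rule continuous_on_compose2[OF Ck_on_imp_continuous_on[OF H]])
      (use U(4) in \<open>auto intro!: continuous_intros\<close>)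
  have cfx: "continuous_on (U \<times> cbox 0 1) (\<lambda>z. fx (fst z) (snd z))"
    unfolding fx_def
    by (intro continuous_on_sum bounded_bilinear.continuous_on[OF bounded_bilinear_blinfun_compose]
        bounded_linear.continuous_on[OF bounded_linear_blinfun_scaleR_left] cP continuous_on_const)
  have sl: "continuous_on (cbox 0 1) (\<lambda>t. g (y, t))" if "continuous_on (U \<times> cbox 0 1) g" "y \<in> U"
    for y :: 'x and g :: "'x \<times> real \<Rightarrow> 'z::topological_space"
    by (rule continuous_on_compose2[OF that(1)]) (use that(2) in \<open>auto intro!: continuous_intros\<close>)
  have "((\<lambda>x. integral (cbox 0 1) (\<lambda>t. P (c t) (H (t, x)))) has_derivative
      blinfun_apply (integral (cbox 0 1) (fx x))) (at x within U)"
  proof (rule leibniz_rule)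
    fix y t assume yt: "y \<in> U" "t \<in> cbox (0::real) 1"
    then have "(t, y) \<in> S" using U(4) by auto
    then have "((\<lambda>y. P (c t) (H (t, y))) has_derivative (\<lambda>u. P (c t) (fd H (t, y) (0, u)))) (at y)"
      by (intro bounded_linear.has_derivative[OF bounded_bilinear.bounded_linear_right[OF P]]
          has_derivative_slice fd)
    moreover have "blinfun_apply (fx y t) = (\<lambda>u. P (c t) (fd H (t, y) (0, u)))" using fx yt by auto
    ultimately show "((\<lambda>x. P (c t) (H (t, x))) has_derivative blinfun_apply (fx y t)) (at y within U)"
      by (simp add: has_derivative_at_withinI)
  next
    show "(\<lambda>t. P (c t) (H (t, y))) integrable_on cbox 0 1" if "y \<in> U" for y
      using sl[OF cH that] by (intro integrable_continuous) simp
  qed (use U cfx in \<open>simp_all add: split_def\<close>)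
  moreover have "blinfun_apply (integral (cbox 0 1) (fx x)) = (\<lambda>u. integral {0..1} (\<lambda>t. P (c t) (fd H (t, x) (0, u))))"
  proof
    fix u
    have "fx x integrable_on cbox 0 1" using sl[OF cfx U(3)] by (intro integrable_continuous) simp
    then have "integral (cbox 0 1) ((\<lambda>A. blinfun_apply A u) \<circ> fx x) = blinfun_apply (integral (cbox 0 1) (fx x)) u"
      by (rule integral_linear) (rule blinfun.bounded_linear_left)
    moreover have "integral (cbox 0 1) ((\<lambda>A. blinfun_apply A u) \<circ> fx x)
        = integral {0..1} (\<lambda>t. P (c t) (fd H (t, x) (0, u)))"
      unfolding cbox_interval by (rule integral_cong) (use fx U(3) in auto)
    ultimately show "blinfun_apply (integral (cbox 0 1) (fx x)) u =
        integral {0..1} (\<lambda>t. P (c t) (fd H (t, x) (0, u)))" by simp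
  qed
  ultimately show ?thesis by (simp only: at_within_open[OF U(3,1)] cbox_interval)
qed

text \<open>A derivative of such an integral is an integral of the same kind, with H replaced by its
  derivative in a direction \<open>(0, v)\<close>; the induction therefore runs over all H at
  once.\<close>

lemma smooth_on_integral_param:
  fixes H :: "real \<times> 'x::{real_inner,banach} \<Rightarrow> 'b::real_normed_vector"
    and P :: "'d::real_normed_vector \<Rightarrow> 'b \<Rightarrow> 'c::banach"
  assumes B: "frame (B :: 'x set)" and P: "bounded_bilinear P"
    and X: "open X" and S: "{0..1} \<times> X \<subseteq> S"
    and H: "smooth_on S H" and c: "continuous_on {0..1} c"
  shows "smooth_on X (\<lambda>x. integral {0..1} (\<lambda>t. P (c t) (H (t, x))))"
proof -
  have "Ck_on k X (\<lambda>x. integral {0..1} (\<lambda>t. P (c t) (H (t, x))))" if "Ck_on k S H" for k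
    using that
  proof (induction k arbitrary: H)
    case 0
    have "continuous_on (X \<times> cbox 0 1) (\<lambda>z. P (c (snd z)) (H (snd z, fst z)))"
      by (rule bounded_bilinear.continuous_on[OF P]; rule continuous_on_compose2[OF c]
          continuous_on_compose2[OF 0[unfolded Ck_on.simps]])
        (use S in \<open>auto intro!: continuous_intros\<close>)
    then show ?case
      using integral_continuous_on_param[of X 0 1 "\<lambda>x t. P (c t) (H (t, x))"] by (simp add: split_def)
  next
    case (Suc k)
    have "continuous_on S (\<lambda>x. fd H x v)" for v
      by (rule Ck_on_imp_continuous_on[OF Ck_on_SucD(2)[OF Suc.prems]])
    then have "Ck_on (Suc 0) S H" using Suc.prems by simp
    then show ?case
      by (intro Ck_on_SucI[OF X has_derivative_integral_param[OF B P X _ S _ c]] Suc.IH Ck_on_SucD(2)[OF Suc.prems])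
  qed
  then show ?thesis using H unfolding smooth_on_def by blast
qed

text \<open>
  For small \<open>w\<close>, \<open>f (y + w) - f y\<close> is the integral of \<open>D\<^sub>w f (y + t w)\<close> over \<open>0 \<le> t \<le> 1\<close>;
  differentiate this in \<open>y\<close> in direction \<open>u\<close>, put \<open>w = s v\<close>, and let \<open>s\<close> tend to \<open>0\<close>.
\<close>

lemma symmetric_second_derivative:
  fixes f :: "'x::{real_inner,banach} \<Rightarrow> 'b::banach"
  assumes B: "frame (B :: 'x set)" and S: "open S" "x \<in> S" and f: "smooth_on S f"
  shows "fd (\<lambda>y. fd f y u) x v = fd (\<lambda>y. fd f y v) x u"
proof -
  obtain d where d: "d > 0" "ball x d \<subseteq> S" using S openE by blast
  have f': "(f has_derivative fd f y) (at y)" if "y \<in> S" for y by (rule smooth_onD(1)[OF f that])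
  have incr: "fd f (x + w) u - fd f x u = integral {0..1} (\<lambda>t. fd (\<lambda>y. fd f y w) (x + t *\<^sub>R w) u)"
    if w: "norm w < d / 2" for w
  proof -
    define S' where "S' = {z. snd z + fst z *\<^sub>R w \<in> S}"
    have "S' = (\<lambda>z. snd z + fst z *\<^sub>R w) -` S" by (auto simp: S'_def)
    then have oS': "open S'"
      by (simp add: open_vimage[OF S(1)] continuous_intros)
    have sub: "{0..1} \<times> ball x (d / 2) \<subseteq> S'"
    proof clarify
      fix t :: real and y assume t: "t \<in> {0..1}" and y: "y \<in> ball x (d / 2)"
      have "norm (t *\<^sub>R w) \<le> norm w" using t by (simp add: mult_left_le_one_le)
      then have "dist x (y + t *\<^sub>R w) < d"
        using y w dist_triangle[of x "y + t *\<^sub>R w" y] by (simp add: dist_norm)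
      then show "(t, y) \<in> S'" using d by (auto simp: S'_def)
    qed
    have bs: "ball x (d / 2) \<subseteq> S" using d by auto
    let ?H = "\<lambda>z. fd f (snd z + fst z *\<^sub>R w) w"
    have H: "smooth_on S' ?H"
      by (rule smooth_on_compose[OF B oS' smooth_onD(2)[OF f]])
        (auto simp: S'_def intro!: smooth_on_add[OF oS'[unfolded S'_def]]
          smooth_on_linear[OF bounded_linear_snd oS'[unfolded S'_def]]
          smooth_on_linear[OF bounded_linear_compose[OF bounded_linear_scaleR_left bounded_linear_fst, unfolded o_def] oS'[unfolded S'_def]]
          smooth_on_ident[OF oS'[unfolded S'_def]])
    have ftc: "integral {0..1} (\<lambda>t. 1 *\<^sub>R ?H (t, y)) = f (y + w) - f y" if "y \<in> ball x (d / 2)" for y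
    proof -
      have "((\<lambda>t. f (y + t *\<^sub>R w)) has_vector_derivative fd f (y + t *\<^sub>R w) w) (at t within {0..1})"
        if "t \<in> {0..1}" for t
      proof -
        have "(t, y) \<in> S'" by (rule subsetD[OF sub]) (use that \<open>y \<in> ball x (d / 2)\<close> in auto)
        then have in_S: "y + t *\<^sub>R w \<in> S" by (simp add: S'_def)
        have "((\<lambda>t. y + t *\<^sub>R w) has_derivative (\<lambda>h. h *\<^sub>R w)) (at t)"
          by (auto intro!: derivative_eq_intros)
        from has_derivative_compose[OF this f'[OF in_S]] have
          "((\<lambda>t. f (y + t *\<^sub>R w)) has_derivative (\<lambda>h. h *\<^sub>R fd f (y + t *\<^sub>R w) w)) (at t)"
          by (simp only: linear_cmul[OF has_derivative_linear[OF f'[OF in_S]]])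
        then show ?thesis unfolding has_vector_derivative_def by (rule has_derivative_at_withinI)
      qed
      then have "((\<lambda>t. fd f (y + t *\<^sub>R w) w) has_integral (f (y + 1 *\<^sub>R w) - f (y + 0 *\<^sub>R w))) {0..1}"
        by (intro fundamental_theorem_of_calculus) auto
      then show ?thesis by (simp add: integral_unique)
    qed
    have "((\<lambda>y. integral {0..1} (\<lambda>t. (\<lambda>_. 1) t *\<^sub>R ?H (t, y))) has_derivative
        (\<lambda>u. integral {0..1} (\<lambda>t. (\<lambda>_. 1) t *\<^sub>R fd ?H (t, x) (0, u)))) (at x)"
      by (rule has_derivative_integral_param[OF B bounded_bilinear_scaleR _ _ sub])
        (use d H in \<open>auto simp: smooth_on_def simp del: Ck_on.simps\<close>)
    then have 1: "((\<lambda>y. f (y + w) - f y) has_derivative (\<lambda>u. integral {0..1} (\<lambda>t. fd ?H (t, x) (0, u)))) (at x)"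
      using ftc d by (auto elim!: has_derivative_transform_within_open[OF _ open_ball[of x "d / 2"]])
    have "x + w \<in> S" using d w by (auto simp: dist_norm intro!: subsetD[OF d(2)])
    then have "((\<lambda>y. f (y + w) - f y) has_derivative (\<lambda>u. fd f (x + w) u - fd f x u)) (at x)"
      by (intro has_derivative_diff has_derivative_compose[OF _ f', of "\<lambda>y. y + w", where f' = "\<lambda>u. u"] f' S)
        (auto intro!: derivative_eq_intros)
    from fun_cong[OF has_derivative_unique[OF this 1], of u]
    have "fd f (x + w) u - fd f x u = integral {0..1} (\<lambda>t. fd ?H (t, x) (0, u))" .
    also have "\<dots> = integral {0..1} (\<lambda>t. fd (\<lambda>y. fd f y w) (x + t *\<^sub>R w) u)"
    proof (rule integral_cong)
      fix t :: real assume "t \<in> {0..1}"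
      then have "(t, x) \<in> S'" using sub d by auto
      then have 1: "((\<lambda>y. ?H (t, y)) has_derivative (\<lambda>u. fd ?H (t, x) (0, u))) (at x)" "x + t *\<^sub>R w \<in> S"
        by (rule has_derivative_slice[OF smooth_onD(1)[OF H]]) (use \<open>(t, x) \<in> S'\<close> in \<open>auto simp: S'_def\<close>)
      have "((\<lambda>y. fd f (y + t *\<^sub>R w) w) has_derivative (\<lambda>u. fd (\<lambda>y. fd f y w) (x + t *\<^sub>R w) u)) (at x)"
        by (rule has_derivative_compose[where f = "\<lambda>y. y + t *\<^sub>R w" and f' = "\<lambda>u. u"
              and g = "\<lambda>y. fd f y w", OF _ smooth_onD(1)[OF smooth_onD(2)[OF f] 1(2)]])
          (auto intro!: derivative_eq_intros)
      from fun_cong[OF has_derivative_unique[OF this 1(1)[simplified]], of u]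
      show "fd ?H (t, x) (0, u) = fd (\<lambda>y. fd f y w) (x + t *\<^sub>R w) u" by simp
    qed
    finally show ?thesis .
  qed
  define M where "M = (\<lambda>y. fd (\<lambda>y. fd f y v) y u)"
  define \<phi> where "\<phi> = (\<lambda>s. integral {0..1} (\<lambda>t. M (x + t *\<^sub>R s *\<^sub>R v)))"
  \<comment> \<open>For \<open>\<bar>s\<bar> < e\<close> the vector \<open>s v\<close> stays within
    half the radius; the summand 1 covers \<open>v = 0\<close>.\<close>
  define e where "e = d / (2 * (norm v + 1))"
  have e: "e > 0" using d by (auto simp: e_def intro!: divide_pos_pos add_nonneg_pos)
  have sv: "norm (s *\<^sub>R v) < d / 2" if "\<bar>s\<bar> < e" for s
  proof -
    have "\<bar>s\<bar> * norm v \<le> \<bar>s\<bar> * (norm v + 1)" by (simp add: mult_left_mono)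
    also have "\<dots> < e * (norm v + 1)" using that by (intro mult_strict_right_mono) (auto intro: add_nonneg_pos)
    also have "\<dots> = d / 2"
    proof -
      have "d / (2 * k) * k = d / 2" if "k \<noteq> 0" for k :: real using that by simp
      moreover have "norm v + 1 \<noteq> 0" using norm_ge_zero[of v] by linarith
      ultimately show ?thesis unfolding e_def by blast
    qed
    finally show ?thesis by simp
  qed
  have in_S: "x + t *\<^sub>R s *\<^sub>R v \<in> S" if "\<bar>s\<bar> < e" "t \<in> {0..1}" for s t
  proof -
    have "norm (t *\<^sub>R s *\<^sub>R v) = t * norm (s *\<^sub>R v)" using that by (simp add: abs_mult)
    also have "\<dots> \<le> norm (s *\<^sub>R v)" by (rule mult_left_le_one_le) (use that in auto)
    finally have "norm (t *\<^sub>R s *\<^sub>R v) \<le> norm (s *\<^sub>R v)" .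
    then show ?thesis using sv[OF that(1)] d by (intro subsetD[OF d(2)]) (simp add: dist_norm)
  qed
  have eq: "fd f (x + s *\<^sub>R v) u = fd f x u + s *\<^sub>R \<phi> s" if s: "\<bar>s\<bar> < e" for s
  proof -
    have "fd (\<lambda>y. fd f y (s *\<^sub>R v)) z u = s *\<^sub>R M z" if "z \<in> S" for z
    proof -
      have "fd f y (s *\<^sub>R v) = s *\<^sub>R fd f y v" if "y \<in> S" for y
        by (rule linear_cmul[OF has_derivative_linear[OF f'[OF that]]])
      then have "fd (\<lambda>y. fd f y (s *\<^sub>R v)) z = fd (\<lambda>y. s *\<^sub>R fd f y v) z"
        by (intro fd_cong[OF S(1) that])
      also have "\<dots> = (\<lambda>u. s *\<^sub>R fd (\<lambda>y. fd f y v) z u)"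
        by (intro fd_eq has_derivative_scaleR_right smooth_onD(1)[OF smooth_onD(2)[OF f] that])
      finally show ?thesis by (simp add: M_def)
    qed
    then have "integral {0..1} (\<lambda>t. fd (\<lambda>y. fd f y (s *\<^sub>R v)) (x + t *\<^sub>R s *\<^sub>R v) u) =
        integral {0..1} (\<lambda>t. s *\<^sub>R M (x + t *\<^sub>R s *\<^sub>R v))"
      using in_S[OF s] by (intro integral_cong) auto
    then show ?thesis using incr[OF sv[OF s]] by (simp add: \<phi>_def algebra_simps)
  qed
  have Mc: "continuous_on S M" unfolding M_def by (intro smooth_onD(3) smooth_onD(2) f)
  have "continuous_on ({-e<..<e} \<times> cbox 0 1) (\<lambda>z. M (x + snd z *\<^sub>R fst z *\<^sub>R v))"
    by (rule continuous_on_compose2[OF Mc]) (use in_S in \<open>auto intro!: continuous_intros\<close>)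
  then have "continuous_on {-e<..<e} \<phi>" unfolding \<phi>_def
    using integral_continuous_on_param[of "{-e<..<e}" 0 1 "\<lambda>s t. M (x + t *\<^sub>R s *\<^sub>R v)"] by (simp add: split_def)
  then have "isCont \<phi> 0" using e by (simp add: continuous_on_eq_continuous_at)
  then have \<phi>0: "(\<phi> \<longlongrightarrow> \<phi> 0) (at 0)" by (simp add: isCont_def)
  have "((\<lambda>s. s *\<^sub>R \<phi> s) has_derivative (\<lambda>s. s *\<^sub>R \<phi> 0)) (at 0)"
    unfolding has_derivative_at
  proof (intro conjI bounded_linear_scaleR_left)
    have "((\<lambda>h. norm (\<phi> h - \<phi> 0)) \<longlongrightarrow> 0) (at 0)" using \<phi>0 tendsto_norm_zero Lim_null by blast
    then show "(\<lambda>h. norm ((0 + h) *\<^sub>R \<phi> (0 + h) - 0 *\<^sub>R \<phi> 0 - h *\<^sub>R \<phi> 0) / norm h) \<midarrow>0\<rightarrow> 0"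
      by (rule Lim_transform_eventually) (auto simp: eventually_at_filter scaleR_diff_right[symmetric])
  qed
  from has_derivative_add[OF has_derivative_const[of "fd f x u"] this]
  have "((\<lambda>s. fd f x u + s *\<^sub>R \<phi> s) has_derivative (\<lambda>s. s *\<^sub>R \<phi> 0)) (at 0)"
    by simp
  then have 1: "((\<lambda>s. fd f (x + s *\<^sub>R v) u) has_derivative (\<lambda>s. s *\<^sub>R \<phi> 0)) (at 0)"
    by (rule has_derivative_transform_within_open[of _ _ _ _ "{-e<..<e}"]) (use e eq in auto)
  have 2: "((\<lambda>s. fd f (x + s *\<^sub>R v) u) has_derivative (\<lambda>s. fd (\<lambda>y. fd f y u) x (s *\<^sub>R v))) (at 0)"
    by (rule has_derivative_compose[where f = "\<lambda>s. x + s *\<^sub>R v" and f' = "\<lambda>s. s *\<^sub>R v"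
          and g = "\<lambda>y. fd f y u"])
      (auto intro!: derivative_eq_intros smooth_onD(1)[OF smooth_onD(2)[OF f] S(2)])
  have "fd (\<lambda>y. fd f y u) x v = \<phi> 0"
    using fun_cong[OF has_derivative_unique[OF 1 2], of 1] by simp
  then show ?thesis by (simp add: \<phi>_def M_def)
qed

subsection \<open>The exterior derivative commutes with pullbacks\<close>

text \<open>The exterior derivative of a pullback against the pullback of the exterior derivative.
  The product rule adds terms with second derivatives of \<Phi>, symmetric in the two directions,
  and these cancel against the alternating signs.\<close>

lemma ext_deriv_natural:
  fixes F :: "'e::{real_inner,banach} \<Rightarrow> (nat \<Rightarrow> 'e) \<Rightarrow> 'b::real_normed_vector"
    and \<Phi> :: "'z::{real_inner,banach} \<Rightarrow> 'e"
  assumes B: "frame (B :: 'e set)" and C: "frame (C :: 'z set)" and Z: "open Z" "z \<in> Z"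
    and \<Phi>: "smooth_on Z \<Phi>" "\<Phi> ` Z \<subseteq> Y"
    and F: "\<And>v. smooth_on Y (\<lambda>y. F y v)" "\<And>y. y \<in> Y \<Longrightarrow> alternating q (F y)"
  shows "(\<Sum>i\<le>q. (-1) ^ i *\<^sub>R fd (\<lambda>z. F (\<Phi> z) (\<lambda>j. fd \<Phi> z (omit i v j))) z (v i)) =
    (\<Sum>i\<le>q. (-1) ^ i *\<^sub>R fd (\<lambda>y. F y (omit i (\<lambda>j. fd \<Phi> z (v j)))) (\<Phi> z) (fd \<Phi> z (v i)))"
proof -
  define V where "V = (\<lambda>j. fd \<Phi> z (v j))"
  define S where "S = (\<lambda>i k. fd (\<lambda>z. fd \<Phi> z (v k)) z (v i))"
  have sym: "S i k = S k i" for i k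
    unfolding S_def by (rule symmetric_second_derivative[OF C Z \<Phi>(1)])
  have ml: "multilinear q (F (\<Phi> y))" if "y \<in> Z" for y
    using F(2)[of "\<Phi> y"] that \<Phi>(2) unfolding alternating_def by blast
  have zY: "\<Phi> z \<in> Y" using \<Phi>(2) Z(2) by blast
  have "fd (\<lambda>z. F (\<Phi> z) (\<lambda>j. fd \<Phi> z (omit i v j))) z (v i) =
      fd (\<lambda>y. F y (omit i V)) (\<Phi> z) (V i) + (\<Sum>k\<in>{..q} - {i}. F (\<Phi> z) (omit i (V(k := S i k))))"
    if i: "i \<le> q" for i
  proof -
    have oV: "omit i V = (\<lambda>j. fd \<Phi> z (omit i v j))" by (simp add: V_def omit_def)
    have "((\<lambda>z. F (\<Phi> z) (\<lambda>j. fd \<Phi> z (omit i v j))) has_derivative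
      (\<lambda>u. fd (\<lambda>y. F y (\<lambda>j. fd \<Phi> z (omit i v j))) (\<Phi> z) (fd \<Phi> z u) +
        (\<Sum>k<q. F (\<Phi> z) ((\<lambda>j. fd \<Phi> z (omit i v j))(k := fd (\<lambda>z. fd \<Phi> z (omit i v k)) z u))))) (at z)"
    proof (rule has_derivative_multilinear[OF B Z ml, where w = "\<lambda>j z. fd \<Phi> z (omit i v j)"
          and f' = "\<lambda>v u. fd (\<lambda>y. F y v) (\<Phi> z) (fd \<Phi> z u)"])
      show "((\<lambda>x. F (\<Phi> x) v) has_derivative (\<lambda>u. fd (\<lambda>y. F y v) (\<Phi> z) (fd \<Phi> z u))) (at z)" for v
        by (rule has_derivative_compose[OF smooth_onD(1)[OF \<Phi>(1) Z(2)] smooth_onD(1)[OF F(1) zY]])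
      show "((\<lambda>z. fd \<Phi> z (omit i v j)) has_derivative fd (\<lambda>z. fd \<Phi> z (omit i v j)) z) (at z)" for j
        by (rule smooth_onD(1)[OF smooth_onD(2)[OF \<Phi>(1)] Z(2)])
    qed
    from fun_cong[OF fd_eq[OF this], of "v i"]
    have "fd (\<lambda>z. F (\<Phi> z) (\<lambda>j. fd \<Phi> z (omit i v j))) z (v i) =
       fd (\<lambda>y. F y (omit i V)) (\<Phi> z) (V i) +
        (\<Sum>k<q. F (\<Phi> z) ((omit i V)(k := fd (\<lambda>z. fd \<Phi> z (omit i v k)) z (v i))))"
      unfolding oV by (simp only: V_def)
    also have "(\<Sum>k<q. F (\<Phi> z) ((omit i V)(k := fd (\<lambda>z. fd \<Phi> z (omit i v k)) z (v i)))) =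
        (\<Sum>k<q. (\<lambda>k. F (\<Phi> z) (omit i (V(k := S i k)))) (if k < i then k else Suc k))"
      unfolding omit_update by (simp only: S_def omit_def)
    also have "\<dots> = (\<Sum>k\<in>{..q} - {i}. F (\<Phi> z) (omit i (V(k := S i k))))"
      by (rule sum_omit[OF i])
    finally show ?thesis .
  qed
  then have "(\<Sum>i\<le>q. (-1) ^ i *\<^sub>R fd (\<lambda>z. F (\<Phi> z) (\<lambda>j. fd \<Phi> z (omit i v j))) z (v i)) =
    (\<Sum>i\<le>q. (-1) ^ i *\<^sub>R fd (\<lambda>y. F y (omit i V)) (\<Phi> z) (V i)) +
    (\<Sum>i\<le>q. (-1) ^ i *\<^sub>R (\<Sum>k\<in>{..q} - {i}. F (\<Phi> z) (omit i (V(k := S i k)))))"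
    by (simp only: sum.distrib[symmetric] scaleR_add_right[symmetric])
      (intro sum.cong refl arg_cong2[where f = scaleR], simp)
  also have "(\<Sum>i\<le>q. (-1) ^ i *\<^sub>R (\<Sum>k\<in>{..q} - {i}. F (\<Phi> z) (omit i (V(k := S i k))))) = 0"
    by (rule alternating_cancel[OF F(2)[OF zY] sym])
  finally show ?thesis by (simp add: V_def)
qed

subsection \<open>Parametrised maps into a manifold and pullback of forms\<close>

lemma alternating_zero: "alternating q (\<lambda>v. 0)"
  by (simp add: alternating_def multilinear_def linear_iff)

lemma alternating_compose_linear:
  assumes F: "alternating q F" and L: "linear L"
  shows "alternating q (\<lambda>v. F (\<lambda>i. L (v i)))"
proof -
  have ml: "multilinear q F" and z: "\<And>v i j. i < q \<Longrightarrow> j < q \<Longrightarrow> i \<noteq> j \<Longrightarrow> v i = v j \<Longrightarrow> F v = 0"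
    using F unfolding alternating_def by blast+
  have "linear (\<lambda>a. F (\<lambda>k. L ((v(i := a)) k)))" if "i < q" for v i
  proof -
    have "(\<lambda>k. L ((v(i := a)) k)) = (\<lambda>k. L (v k))(i := L a)" for a by (auto simp: fun_eq_iff)
    then show ?thesis
      using linear_compose[OF L multilinear_linear[OF ml that, of "\<lambda>k. L (v k)"]] by (simp only: o_def)
  qed
  moreover have "F (\<lambda>i. L (v i)) = F (\<lambda>i. L (w i))" if "\<forall>i<q. v i = w i" for v w
    by (rule multilinear_cong[OF ml]) (simp add: that)
  ultimately show ?thesis unfolding alternating_def multilinear_def using z by simp
qed

lemma is_pullbackI:
  assumes "\<And>U \<phi> V \<psi> p v. (U, \<phi>) \<in> A \<Longrightarrow> (V, \<psi>) \<in> A \<Longrightarrow> p \<in> U \<Longrightarrow> F p \<in> V \<Longrightarrow>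
    \<omega> (U, \<phi>) p v = \<eta> (V, \<psi>) (F p) (\<lambda>i. fd (\<psi> \<circ> F \<circ> inv_into U \<phi>) (\<phi> p) (v i))"
  shows "is_pullback A F \<eta> \<omega>"
  unfolding is_pullback_def by clarify (rule assms)

lemma is_pullbackD:
  assumes "is_pullback A F \<eta> \<omega>" "(U, \<phi>) \<in> A" "(V, \<psi>) \<in> A" "p \<in> U" "F p \<in> V"
  shows "\<omega> (U, \<phi>) p v = \<eta> (V, \<psi>) (F p) (\<lambda>i. fd (\<psi> \<circ> F \<circ> inv_into U \<phi>) (\<phi> p) (v i))"
  using assms unfolding is_pullback_def by blast

locale framed_atlas =
  fixes A :: "('a::topological_space, 'e::{real_inner,banach}) chart set" and B :: "'e set"
  assumes charts: "smooth_atlas A" and frame: "frame B"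
begin

lemma chart_facts:
  assumes "(U, \<phi>) \<in> A"
  shows "open U" "open (\<phi> ` U)" "continuous_on U \<phi>" "continuous_on (\<phi> ` U) (inv_into U \<phi>)"
    "p \<in> U \<Longrightarrow> inv_into U \<phi> (\<phi> p) = p" "x \<in> \<phi> ` U \<Longrightarrow> \<phi> (inv_into U \<phi> x) = x"
    "x \<in> \<phi> ` U \<Longrightarrow> inv_into U \<phi> x \<in> U"
proof -
  have "open U \<and> open (\<phi> ` U) \<and> homeomorphism U (\<phi> ` U) \<phi> (inv_into U \<phi>)"
    using charts assms unfolding smooth_atlas_def by blast
  then show "open U" "open (\<phi> ` U)" "continuous_on U \<phi>" "continuous_on (\<phi> ` U) (inv_into U \<phi>)"
    "p \<in> U \<Longrightarrow> inv_into U \<phi> (\<phi> p) = p" "x \<in> \<phi> ` U \<Longrightarrow> \<phi> (inv_into U \<phi> x) = x"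
    "x \<in> \<phi> ` U \<Longrightarrow> inv_into U \<phi> x \<in> U"
    unfolding homeomorphism_def by (auto simp: inv_into_into)
qed

lemma chart_transition:
  assumes "(U, \<phi>) \<in> A" "(V, \<psi>) \<in> A"
  shows "smooth_on (\<phi> ` (U \<inter> V)) (\<psi> \<circ> inv_into U \<phi>)"
  using charts assms unfolding smooth_atlas_def by blast

definition chart_at :: "'a \<Rightarrow> ('a, 'e) chart" where
  "chart_at p = (SOME c. c \<in> A \<and> p \<in> fst c)"

lemma chart_at: "chart_at p \<in> A" "p \<in> fst (chart_at p)"
proof -
  have "(\<Union>(U, \<phi>)\<in>A. U) = UNIV" using charts unfolding smooth_atlas_def by (rule conjunct1)
  then have "p \<in> (\<Union>(U, \<phi>)\<in>A. U)" by (simp only: UNIV_I)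
  then obtain c where "c \<in> A" "p \<in> (case c of (U, \<phi>) \<Rightarrow> U)" by (rule UN_E)
  then have "\<exists>c. c \<in> A \<and> p \<in> fst c" by (intro exI[of _ c]) (simp add: split_def)
  then have "chart_at p \<in> A \<and> p \<in> fst (chart_at p)" unfolding chart_at_def by (rule someI_ex)
  then show "chart_at p \<in> A" "p \<in> fst (chart_at p)" by auto
qed

lemma obtain_chart:
  obtains U \<phi> where "(U, \<phi>) \<in> A" "p \<in> U" "chart_at p = (U, \<phi>)"
  using chart_at[of p] by (cases "chart_at p") auto

text \<open>Smooth maps from an open set of any normed space, so that one calculus covers inverse
  charts, curves, and maps of both time and space.\<close>

definition param :: "'z::real_normed_vector set \<Rightarrow> ('z \<Rightarrow> 'a) \<Rightarrow> bool" where
  "param S \<Psi> \<longleftrightarrow> open S \<and> continuous_on S \<Psi> \<and>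
     (\<forall>(V, \<psi>)\<in>A. smooth_on (S \<inter> \<Psi> -` V) (\<psi> \<circ> \<Psi>))"

lemma paramD:
  assumes "param S \<Psi>"
  shows "open S" "continuous_on S \<Psi>" "(V, \<psi>) \<in> A \<Longrightarrow> smooth_on (S \<inter> \<Psi> -` V) (\<psi> \<circ> \<Psi>)"
    "open V \<Longrightarrow> open (S \<inter> \<Psi> -` V)"
  using assms continuous_open_preimage[of S \<Psi> V] unfolding param_def by auto

lemma paramI:
  assumes "open S" "continuous_on S \<Psi>"
    and "\<And>V \<psi> z. (V, \<psi>) \<in> A \<Longrightarrow> z \<in> S \<Longrightarrow> \<Psi> z \<in> V \<Longrightarrow> \<exists>T. open T \<and> z \<in> T \<and> smooth_on T (\<psi> \<circ> \<Psi>)"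
  shows "param S \<Psi>"
proof -
  have "smooth_on (S \<inter> \<Psi> -` V) (\<psi> \<circ> \<Psi>)" if "(V, \<psi>) \<in> A" for V \<psi>
    by (rule smooth_on_local) (use assms(3)[OF that] in blast)
  then show ?thesis using assms(1,2) unfolding param_def by blast
qed

lemma param_has_derivative:
  assumes "param S \<Psi>" "z \<in> S" "(V, \<psi>) \<in> A" "\<Psi> z \<in> V"
  shows "((\<psi> \<circ> \<Psi>) has_derivative fd (\<psi> \<circ> \<Psi>) z) (at z)"
  by (rule smooth_onD(1)[OF paramD(3)[OF assms(1,3)]]) (use assms in auto)

text \<open>Pullback of forms along parametrised maps; by \<open>pb_chart\<close> below the chosen chart is immaterial.\<close>

definition pb :: "('a, 'e, 'b) form \<Rightarrow> ('z::real_normed_vector \<Rightarrow> 'a) \<Rightarrow> 'z \<Rightarrow> (nat \<Rightarrow> 'z) \<Rightarrow> 'b" where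
  "pb f \<Psi> z v = f (chart_at (\<Psi> z)) (\<Psi> z) (\<lambda>i. fd (snd (chart_at (\<Psi> z)) \<circ> \<Psi>) z (v i))"

lemma param_chart:
  assumes "(U, \<phi>) \<in> A"
  shows "param (\<phi> ` U) (inv_into U \<phi>)"
proof -
  have "smooth_on (\<phi> ` U \<inter> inv_into U \<phi> -` V) (\<psi> \<circ> inv_into U \<phi>)" if "(V, \<psi>) \<in> A" for V \<psi>
    by (rule smooth_on_subset[OF chart_transition[OF assms that]])
      (use chart_facts[OF assms] in \<open>auto intro!: image_eqI\<close>)
  then show ?thesis using chart_facts[OF assms] unfolding param_def by blast
qed

lemma param_chain:
  assumes \<Psi>: "param S \<Psi>" "z \<in> S" and U: "(U, \<phi>) \<in> A" "\<Psi> z \<in> U"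
    and D: "((\<lambda>x. g (inv_into U \<phi> x)) has_derivative D) (at (\<phi> (\<Psi> z)))"
  shows "((\<lambda>z. g (\<Psi> z)) has_derivative (\<lambda>u. D (fd (\<phi> \<circ> \<Psi>) z u))) (at z)"
proof -
  have d: "((\<lambda>z. \<phi> (\<Psi> z)) has_derivative fd (\<phi> \<circ> \<Psi>) z) (at z)"
    using param_has_derivative[OF \<Psi> U] by (simp add: o_def)
  have "((\<lambda>z. g (inv_into U \<phi> (\<phi> (\<Psi> z)))) has_derivative (\<lambda>u. D (fd (\<phi> \<circ> \<Psi>) z u))) (at z)"
    by (rule has_derivative_compose[where f = "\<lambda>z. \<phi> (\<Psi> z)" and g = "\<lambda>x. g (inv_into U \<phi> x)", OF d D])
  then show ?thesis
    by (rule has_derivative_transform_within_open[OF _ paramD(4)[OF \<Psi>(1) chart_facts(1)[OF U(1)]]])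
      (use \<Psi> U chart_facts(5)[OF U(1)] in auto)
qed

text \<open>Functoriality: pulling \<eta> back along F after \<Psi> is pulling \<omega> back along
  \<Psi>. With F the identity it gives independence of the chart, with F a left translation it gives
  invariance.\<close>

lemma pb_is_pullback:
  assumes pull: "is_pullback A F \<eta> \<omega>" and \<Psi>: "param S \<Psi>" "z \<in> S"
    and F: "\<And>U \<phi>. (U, \<phi>) \<in> A \<Longrightarrow> param (\<phi> ` U) (\<lambda>x. F (inv_into U \<phi> x))"
    and V: "(V, \<psi>) \<in> A" "F (\<Psi> z) \<in> V"
  shows "\<eta> (V, \<psi>) (F (\<Psi> z)) (\<lambda>i. fd (\<psi> \<circ> (\<lambda>z. F (\<Psi> z))) z (v i)) = pb \<omega> \<Psi> z v"
proof -
  obtain U \<phi> where U: "(U, \<phi>) \<in> A" "\<Psi> z \<in> U" "chart_at (\<Psi> z) = (U, \<phi>)" by (rule obtain_chart)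
  have mem: "\<phi> (\<Psi> z) \<in> \<phi> ` U" using U by auto
  have "((\<psi> \<circ> (\<lambda>x. F (inv_into U \<phi> x))) has_derivative fd (\<psi> \<circ> (\<lambda>x. F (inv_into U \<phi> x))) (\<phi> (\<Psi> z))) (at (\<phi> (\<Psi> z)))"
    by (rule param_has_derivative[OF F[OF U(1)] mem V(1)]) (use V(2) chart_facts(5)[OF U(1,2)] in simp)
  then have "((\<lambda>x. \<psi> (F (inv_into U \<phi> x))) has_derivative fd (\<psi> \<circ> F \<circ> inv_into U \<phi>) (\<phi> (\<Psi> z))) (at (\<phi> (\<Psi> z)))"
    by (simp add: o_def)
  from fd_eq[OF param_chain[where g = "\<lambda>p. \<psi> (F p)", OF \<Psi> U(1,2) this]]
  have "fd (\<psi> \<circ> (\<lambda>z. F (\<Psi> z))) z = (\<lambda>u. fd (\<psi> \<circ> F \<circ> inv_into U \<phi>) (\<phi> (\<Psi> z)) (fd (\<phi> \<circ> \<Psi>) z u))"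
    by (simp add: o_def)
  moreover have "\<omega> (U, \<phi>) (\<Psi> z) w = \<eta> (V, \<psi>) (F (\<Psi> z)) (\<lambda>i. fd (\<psi> \<circ> F \<circ> inv_into U \<phi>) (\<phi> (\<Psi> z)) (w i))" for w
    by (rule is_pullbackD[OF pull U(1) V(1) U(2) V(2)])
  ultimately show ?thesis unfolding pb_def U(3) by simp
qed

lemma pb_chart:
  assumes "is_pullback A id f f" "param S \<Psi>" "z \<in> S" "(V, \<psi>) \<in> A" "\<Psi> z \<in> V"
  shows "pb f \<Psi> z v = f (V, \<psi>) (\<Psi> z) (\<lambda>i. fd (\<psi> \<circ> \<Psi>) z (v i))"
  using pb_is_pullback[OF assms(1,2,3) _ assms(4), of v] param_chart assms(5) by simp

lemma pb_cong:
  assumes "open S" "z \<in> S" "\<And>y. y \<in> S \<Longrightarrow> \<Psi> y = \<Psi>' y"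
  shows "pb f \<Psi> z v = pb f \<Psi>' z v"
proof -
  have "fd (\<psi> \<circ> \<Psi>) z = fd (\<psi> \<circ> \<Psi>') z" for \<psi> :: "'a \<Rightarrow> 'e"
    by (rule fd_cong[OF assms(1,2)]) (simp add: assms(3))
  then show ?thesis by (simp add: pb_def assms(2,3))
qed

lemma pb_compose:
  assumes "param S \<Psi>" "h y \<in> S" "(h has_derivative h') (at y)"
  shows "pb f (\<lambda>y. \<Psi> (h y)) y v = pb f \<Psi> (h y) (\<lambda>i. h' (v i))"
proof -
  obtain U \<phi> where U: "(U, \<phi>) \<in> A" "\<Psi> (h y) \<in> U" "chart_at (\<Psi> (h y)) = (U, \<phi>)" by (rule obtain_chart)
  have "((\<lambda>y. (\<phi> \<circ> \<Psi>) (h y)) has_derivative (\<lambda>u. fd (\<phi> \<circ> \<Psi>) (h y) (h' u))) (at y)"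
    by (rule has_derivative_compose[OF assms(3) param_has_derivative[OF assms(1,2) U(1,2)]])
  from fd_eq[OF this] have "fd (\<phi> \<circ> (\<lambda>y. \<Psi> (h y))) y = (\<lambda>u. fd (\<phi> \<circ> \<Psi>) (h y) (h' u))"
    by (simp add: o_def)
  then show ?thesis by (simp add: pb_def U(3))
qed

lemma param_compose:
  fixes h :: "'y::real_normed_vector \<Rightarrow> 'z::real_inner"
  assumes C: "frame (C :: 'z set)" and \<Psi>: "param S \<Psi>" and T: "open T" and h: "smooth_on T h" "h ` T \<subseteq> S"
  shows "param T (\<lambda>y. \<Psi> (h y))"
proof (rule paramI[OF T])
  show cont: "continuous_on T (\<lambda>y. \<Psi> (h y))"
    by (rule continuous_on_compose2[OF paramD(2)[OF \<Psi>] smooth_onD(3)[OF h(1)] h(2)])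
  fix V \<psi> z assume V: "(V, \<psi>) \<in> A" "z \<in> T" "\<Psi> (h z) \<in> V"
  let ?T = "T \<inter> (\<lambda>y. \<Psi> (h y)) -` V"
  have o: "open ?T" by (rule continuous_open_preimage[OF cont T chart_facts(1)[OF V(1)]])
  have "smooth_on ?T (\<lambda>y. (\<psi> \<circ> \<Psi>) (h y))"
    by (rule smooth_on_compose[OF C o paramD(3)[OF \<Psi> V(1)] smooth_on_subset[OF h(1)]]) (use h(2) in auto)
  then show "\<exists>T. open T \<and> z \<in> T \<and> smooth_on T (\<psi> \<circ> (\<lambda>y. \<Psi> (h y)))"
    using o V by (intro exI[of _ ?T]) (auto simp: o_def)
qed

lemma param_const: "open S \<Longrightarrow> param S (\<lambda>_. g)"
  by (rule paramI) (auto intro!: exI[of _ S] smooth_on_const simp: o_def)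

lemma pb_chart_self:
  assumes f: "is_pullback A id f f" and U: "(U, \<phi>) \<in> A" "x \<in> \<phi> ` U"
  shows "pb f (inv_into U \<phi>) x v = f (U, \<phi>) (inv_into U \<phi> x) v"
proof -
  have "fd (\<phi> \<circ> inv_into U \<phi>) x = fd (\<lambda>x. x) x"
    by (rule fd_cong[OF chart_facts(2)[OF U(1)] U(2)]) (simp add: chart_facts(6)[OF U(1)])
  then show ?thesis
    using pb_chart[OF f param_chart[OF U(1)] U(2) U(1) chart_facts(7)[OF U]] by simp
qed

lemma smooth_formsD:
  assumes "f \<in> smooth_forms A q"
  shows "\<not> (c \<in> A \<and> p \<in> fst c) \<Longrightarrow> f c p v = 0" "alternating q (f c p)" "is_pullback A id f f"
    "(U, \<phi>) \<in> A \<Longrightarrow> smooth_on (\<phi> ` U) (\<lambda>x. f (U, \<phi>) (inv_into U \<phi> x) v)"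
proof -
  show "\<not> (c \<in> A \<and> p \<in> fst c) \<Longrightarrow> f c p v = 0" "is_pullback A id f f"
    "(U, \<phi>) \<in> A \<Longrightarrow> smooth_on (\<phi> ` U) (\<lambda>x. f (U, \<phi>) (inv_into U \<phi> x) v)"
    using assms unfolding smooth_forms_def by fast+
  note all = assms[unfolded smooth_forms_def mem_Collect_eq]
  have 1: "\<forall>c p v w. (\<forall>i<q. v i = w i) \<longrightarrow> f c p v = f c p w" using all by (elim conjE)
  have 2: "\<forall>c p v. \<forall>i<q. linear (\<lambda>a. f c p (v(i := a)))" using all by (elim conjE)
  have 3: "\<forall>c p v. \<forall>i<q. \<forall>j<q. i \<noteq> j \<and> v i = v j \<longrightarrow> f c p v = 0" using all by (elim conjE)
  show "alternating q (f c p)" unfolding alternating_def multilinear_def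
    using spec[OF spec[OF 1]] spec[OF spec[OF 2]] spec[OF spec[OF 3]] by (intro conjI)
qed

lemma smooth_formsI:
  assumes "\<And>c p v. \<not> (c \<in> A \<and> p \<in> fst c) \<Longrightarrow> f c p v = 0"
    and "\<And>c p. alternating q (f c p)" and "is_pullback A id f f"
    and "\<And>U \<phi> v. (U, \<phi>) \<in> A \<Longrightarrow> smooth_on (\<phi> ` U) (\<lambda>x. f (U, \<phi>) (inv_into U \<phi> x) v)"
  shows "f \<in> smooth_forms A q"
proof -
  have alt: "(\<forall>v w. (\<forall>i<q. v i = w i) \<longrightarrow> f c p v = f c p w) \<and> (\<forall>v. \<forall>i<q. linear (\<lambda>a. f c p (v(i := a)))) \<and>
      (\<forall>v. \<forall>i<q. \<forall>j<q. i \<noteq> j \<and> v i = v j \<longrightarrow> f c p v = 0)" for c p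
    using assms(2)[of c p] unfolding alternating_def multilinear_def by (simp only: conj_assoc)
  have 1: "\<forall>c p v. \<not> (c \<in> A \<and> p \<in> fst c) \<longrightarrow> f c p v = 0" using assms(1) by (intro allI impI)
  have 2: "\<forall>c p v w. (\<forall>i<q. v i = w i) \<longrightarrow> f c p v = f c p w"
    by (rule allI, rule allI, rule alt[THEN conjunct1])
  have 3: "\<forall>c p v. \<forall>i<q. linear (\<lambda>a. f c p (v(i := a)))"
    by (rule allI, rule allI, rule alt[THEN conjunct2, THEN conjunct1])
  have 4: "\<forall>c p v. \<forall>i<q. \<forall>j<q. i \<noteq> j \<and> v i = v j \<longrightarrow> f c p v = 0"
    by (rule allI, rule allI, rule alt[THEN conjunct2, THEN conjunct2])
  have 5: "\<forall>(U, \<phi>)\<in>A. \<forall>v. smooth_on (\<phi> ` U) (\<lambda>x. f (U, \<phi>) (inv_into U \<phi> x) v)"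
    using assms(4) by (auto split: prod.split)
  show ?thesis unfolding smooth_forms_def mem_Collect_eq
    using 1 2 3 4 assms(3) 5 by (intro conjI)
qed

lemma pb_alternating:
  assumes f: "f \<in> smooth_forms A q" and \<Psi>: "param S \<Psi>" "z \<in> S"
  shows "alternating q (pb f \<Psi> z)"
proof -
  obtain U \<phi> where U: "(U, \<phi>) \<in> A" "\<Psi> z \<in> U" "chart_at (\<Psi> z) = (U, \<phi>)" by (rule obtain_chart)
  show ?thesis unfolding pb_def[abs_def] U(3) snd_conv
    by (rule alternating_compose_linear[OF smooth_formsD(2)[OF f]
          has_derivative_linear[OF param_has_derivative[OF \<Psi> U(1,2)]]])
qed

text \<open>Puts the pullback in the shape of a coordinate expression with moving base point and
  moving arguments, to which the lemmas on multilinear families apply.\<close>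

lemma pb_local:
  assumes f: "f \<in> smooth_forms A q" and \<Psi>: "param S \<Psi>" and V: "(V, \<psi>) \<in> A" and z: "z \<in> S \<inter> \<Psi> -` V"
  shows "pb f \<Psi> z v = f (V, \<psi>) (inv_into V \<psi> ((\<psi> \<circ> \<Psi>) z)) (\<lambda>i. fd (\<psi> \<circ> \<Psi>) z (v i))"
  using pb_chart[OF smooth_formsD(3)[OF f] \<Psi> _ V] z chart_facts(5)[OF V] by simp

lemma pb_smooth:
  assumes f: "f \<in> smooth_forms A q" and \<Psi>: "param S \<Psi>"
  shows "smooth_on S (\<lambda>z. pb f \<Psi> z v)"
proof (rule smooth_on_local)
  fix z assume z: "z \<in> S"
  obtain V \<psi> where V: "(V, \<psi>) \<in> A" "\<Psi> z \<in> V" by (rule obtain_chart)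
  let ?T = "S \<inter> \<Psi> -` V"
  have T: "open ?T" by (rule paramD(4)[OF \<Psi> chart_facts(1)[OF V(1)]])
  have s: "smooth_on ?T (\<psi> \<circ> \<Psi>)" by (rule paramD(3)[OF \<Psi> V(1)])
  have "smooth_on ?T (\<lambda>z. f (V, \<psi>) (inv_into V \<psi> ((\<psi> \<circ> \<Psi>) z)) (\<lambda>i. fd (\<psi> \<circ> \<Psi>) z (v i)))"
  proof (rule smooth_on_multilinear[OF frame T])
    show "multilinear q (f (V, \<psi>) (inv_into V \<psi> ((\<psi> \<circ> \<Psi>) x)))" for x
      using smooth_formsD(2)[OF f] unfolding alternating_def by blast
    show "smooth_on ?T (\<lambda>x. f (V, \<psi>) (inv_into V \<psi> ((\<psi> \<circ> \<Psi>) x)) v)" for v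
      by (rule smooth_on_compose[OF frame T smooth_formsD(4)[OF f V(1)] s]) auto
    show "smooth_on ?T (\<lambda>z. fd (\<psi> \<circ> \<Psi>) z (v i))" for i by (rule smooth_onD(2)[OF s])
  qed
  then have "smooth_on ?T (\<lambda>z. pb f \<Psi> z v)"
    by (rule smooth_on_cong[OF T, rotated]) (simp only: pb_local[OF f \<Psi> V(1)])
  then show "\<exists>T. open T \<and> z \<in> T \<and> smooth_on T (\<lambda>z. pb f \<Psi> z v)" using T z V by blast
qed

text \<open>Allows d to be computed in the coordinates of a parameter space of any dimension, in
  particular in \<open>(t, x)\<close>.\<close>

lemma pb_ext_deriv:
  fixes \<Psi> :: "'z::{real_inner,banach} \<Rightarrow> 'a"
  assumes C: "frame (C :: 'z set)" and f: "f \<in> smooth_forms A q" and \<Psi>: "param S \<Psi>" "z \<in> S"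
    and V: "(V, \<psi>) \<in> A" "\<Psi> z \<in> V"
  shows "(\<Sum>i\<le>q. (-1) ^ i *\<^sub>R fd (\<lambda>z. pb f \<Psi> z (omit i v)) z (v i)) =
    ext_deriv A q f (V, \<psi>) (\<Psi> z) (\<lambda>i. fd (\<psi> \<circ> \<Psi>) z (v i))"
proof -
  let ?T = "S \<inter> \<Psi> -` V" and ?F = "\<lambda>y. f (V, \<psi>) (inv_into V \<psi> y)"
  have T: "open ?T" "z \<in> ?T" using paramD(4)[OF \<Psi>(1) chart_facts(1)[OF V(1)]] \<Psi> V by auto
  have "fd (\<lambda>z. pb f \<Psi> z w) z = fd (\<lambda>z. ?F ((\<psi> \<circ> \<Psi>) z) (\<lambda>j. fd (\<psi> \<circ> \<Psi>) z (w j))) z" for w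
    by (rule fd_cong[OF T]) (rule pb_local[OF f \<Psi>(1) V(1)])
  then have "(\<Sum>i\<le>q. (-1) ^ i *\<^sub>R fd (\<lambda>z. pb f \<Psi> z (omit i v)) z (v i)) =
      (\<Sum>i\<le>q. (-1) ^ i *\<^sub>R fd (\<lambda>z. ?F ((\<psi> \<circ> \<Psi>) z) (\<lambda>j. fd (\<psi> \<circ> \<Psi>) z (omit i v j))) z (v i))"
    by simp
  also have "\<dots> = (\<Sum>i\<le>q. (-1) ^ i *\<^sub>R fd (\<lambda>y. ?F y (omit i (\<lambda>j. fd (\<psi> \<circ> \<Psi>) z (v j)))) ((\<psi> \<circ> \<Psi>) z) (fd (\<psi> \<circ> \<Psi>) z (v i)))"
    by (rule ext_deriv_natural[OF frame C T paramD(3)[OF \<Psi>(1) V(1)] _ smooth_formsD(4)[OF f V(1)] smooth_formsD(2)[OF f]])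
      auto
  finally show ?thesis using V by (simp add: ext_deriv_def)
qed

text \<open>Here \<open>h c\<close> takes coordinates in the chart \<open>c\<close>, whereas a form takes points of the manifold.\<close>

definition mkform :: "(('a, 'e) chart \<Rightarrow> 'e \<Rightarrow> (nat \<Rightarrow> 'e) \<Rightarrow> 'b::real_normed_vector) \<Rightarrow> ('a, 'e, 'b) form" where
  "mkform h = (\<lambda>c p v. if c \<in> A \<and> p \<in> fst c then h c (snd c p) v else 0)"

lemma mkform_smooth:
  assumes alt: "\<And>U \<phi> x. (U, \<phi>) \<in> A \<Longrightarrow> x \<in> \<phi> ` U \<Longrightarrow> alternating q (h (U, \<phi>) x)"
    and smooth: "\<And>U \<phi> v. (U, \<phi>) \<in> A \<Longrightarrow> smooth_on (\<phi> ` U) (\<lambda>x. h (U, \<phi>) x v)"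
    and change: "\<And>U \<phi> V \<psi> p v. (U, \<phi>) \<in> A \<Longrightarrow> (V, \<psi>) \<in> A \<Longrightarrow> p \<in> U \<Longrightarrow> p \<in> V \<Longrightarrow>
      h (U, \<phi>) (\<phi> p) v = h (V, \<psi>) (\<psi> p) (\<lambda>i. fd (\<psi> \<circ> inv_into U \<phi>) (\<phi> p) (v i))"
  shows "mkform h \<in> smooth_forms A q"
proof (rule smooth_formsI)
  show "alternating q (mkform h c p)" for c p
  proof (cases "c \<in> A \<and> p \<in> fst c")
    case True
    then show ?thesis using alt[of "fst c" "snd c" "snd c p"] by (simp add: mkform_def[abs_def])
  next
    case False
    then have "mkform h c p = (\<lambda>v. 0)" by (auto simp: mkform_def)
    then show ?thesis by (simp add: alternating_zero)
  qed
  show "is_pullback A id (mkform h) (mkform h)"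
  proof (rule is_pullbackI)
    fix U \<phi> V \<psi> p v assume h: "(U, \<phi>) \<in> A" "(V, \<psi>) \<in> A" "p \<in> U" "id p \<in> V"
    then show "mkform h (U, \<phi>) p v =
        mkform h (V, \<psi>) (id p) (\<lambda>i. fd (\<psi> \<circ> id \<circ> inv_into U \<phi>) (\<phi> p) (v i))"
      using change[OF h(1-3), of v] by (simp add: mkform_def)
  qed
  show "smooth_on (\<phi> ` U) (\<lambda>x. mkform h (U, \<phi>) (inv_into U \<phi> x) v)" if "(U, \<phi>) \<in> A" for U \<phi> v
    by (rule smooth_on_cong[OF chart_facts(2)[OF that] _ smooth[OF that, of v]])
      (use that chart_facts(6,7)[OF that] in \<open>simp add: mkform_def\<close>)
qed (auto simp: mkform_def)

lemma smooth_forms_linear: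
  fixes L :: "'b::real_normed_vector \<Rightarrow> 'c::real_normed_vector"
  assumes f: "f \<in> smooth_forms A q" and L: "bounded_linear L"
  shows "(\<lambda>c p v. L (f c p v)) \<in> smooth_forms A q"
    "ext_deriv A q (\<lambda>c p v. L (f c p v)) = (\<lambda>c p v. L (ext_deriv A q f c p v))"
proof -
  have L0: "L 0 = 0" and lin: "linear L" using L by (simp_all add: linear_simps bounded_linear.linear)
  show "(\<lambda>c p v. L (f c p v)) \<in> smooth_forms A q"
  proof (rule smooth_formsI)
    show "alternating q (\<lambda>v. L (f c p v))" for c p
    proof -
      have F: "multilinear q (f c p)" "\<forall>v. \<forall>i<q. \<forall>j<q. i \<noteq> j \<and> v i = v j \<longrightarrow> f c p v = 0"
        using smooth_formsD(2)[OF f] unfolding alternating_def by blast+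
      have "linear (\<lambda>a. L (f c p (v(i := a))))" if "i < q" for v i
        using linear_compose[OF multilinear_linear[OF F(1) that] lin] by (simp add: o_def)
      then show ?thesis using F multilinear_cong[OF F(1)] L0
        unfolding alternating_def multilinear_def by metis
    qed
    show "is_pullback A id (\<lambda>c p v. L (f c p v)) (\<lambda>c p v. L (f c p v))"
      by (rule is_pullbackI) (rule arg_cong[of _ _ L], rule is_pullbackD[OF smooth_formsD(3)[OF f]])
    show "smooth_on (\<phi> ` U) (\<lambda>x. L (f (U, \<phi>) (inv_into U \<phi> x) v))" if "(U, \<phi>) \<in> A" for U \<phi> v
      by (rule smooth_on_linear[OF L chart_facts(2)[OF that] smooth_formsD(4)[OF f that]])
  qed (simp add: smooth_formsD(1)[OF f] L0)
  have "fd (\<lambda>x. L (f (U, \<phi>) (inv_into U \<phi> x) w)) (\<phi> p) u = L (fd (\<lambda>x. f (U, \<phi>) (inv_into U \<phi> x) w) (\<phi> p) u)"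
    if "(U, \<phi>) \<in> A" "p \<in> U" for U \<phi> p w u
    using fd_eq[OF bounded_linear.has_derivative[OF L smooth_onD(1)[OF smooth_formsD(4)[OF f that(1)]]]] that by simp
  then show "ext_deriv A q (\<lambda>c p v. L (f c p v)) = (\<lambda>c p v. L (ext_deriv A q f c p v))"
    by (auto simp: ext_deriv_def fun_eq_iff L0 linear_sum[OF lin] linear_cmul[OF lin])
qed

lemma smooth_forms_add:
  assumes f: "f \<in> smooth_forms A q" and g: "g \<in> smooth_forms A q"
  shows "(\<lambda>c p v. f c p v + g c p v) \<in> smooth_forms A q"
    "ext_deriv A q (\<lambda>c p v. f c p v + g c p v) = (\<lambda>c p v. ext_deriv A q f c p v + ext_deriv A q g c p v)"
proof -
  show "(\<lambda>c p v. f c p v + g c p v) \<in> smooth_forms A q"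
  proof (rule smooth_formsI)
    show "alternating q (\<lambda>v. f c p v + g c p v)" for c p
    proof -
      have F: "multilinear q (f c p)" "\<forall>v. \<forall>i<q. \<forall>j<q. i \<noteq> j \<and> v i = v j \<longrightarrow> f c p v = 0"
        and G: "multilinear q (g c p)" "\<forall>v. \<forall>i<q. \<forall>j<q. i \<noteq> j \<and> v i = v j \<longrightarrow> g c p v = 0"
        using smooth_formsD(2)[OF f] smooth_formsD(2)[OF g] unfolding alternating_def by blast+
      have "linear (\<lambda>a. f c p (v(i := a)) + g c p (v(i := a)))" if "i < q" for v i
        by (rule linear_compose_add[OF multilinear_linear[OF F(1) that] multilinear_linear[OF G(1) that]])
      moreover have "f c p v + g c p v = f c p w + g c p w" if "\<forall>i<q. v i = w i" for v w
        using multilinear_cong[OF F(1), of v w] multilinear_cong[OF G(1), of v w] that by simp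
      ultimately show ?thesis using F(2) G(2) unfolding alternating_def multilinear_def by simp
    qed
    show "is_pullback A id (\<lambda>c p v. f c p v + g c p v) (\<lambda>c p v. f c p v + g c p v)"
      by (rule is_pullbackI) (rule arg_cong2[of _ _ _ _ "(+)"],
          rule is_pullbackD[OF smooth_formsD(3)[OF f]], assumption+,
          rule is_pullbackD[OF smooth_formsD(3)[OF g]], assumption+)
    show "smooth_on (\<phi> ` U) (\<lambda>x. f (U, \<phi>) (inv_into U \<phi> x) v + g (U, \<phi>) (inv_into U \<phi> x) v)"
      if "(U, \<phi>) \<in> A" for U \<phi> v
      by (rule smooth_on_add[OF chart_facts(2)[OF that] smooth_formsD(4)[OF f that] smooth_formsD(4)[OF g that]])
  qed (simp add: smooth_formsD(1)[OF f] smooth_formsD(1)[OF g])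
  have "fd (\<lambda>x. f (U, \<phi>) (inv_into U \<phi> x) w + g (U, \<phi>) (inv_into U \<phi> x) w) (\<phi> p) u =
      fd (\<lambda>x. f (U, \<phi>) (inv_into U \<phi> x) w) (\<phi> p) u + fd (\<lambda>x. g (U, \<phi>) (inv_into U \<phi> x) w) (\<phi> p) u"
    if "(U, \<phi>) \<in> A" "p \<in> U" for U \<phi> p w u
    using fd_eq[OF has_derivative_add[OF smooth_onD(1)[OF smooth_formsD(4)[OF f that(1)]]
        smooth_onD(1)[OF smooth_formsD(4)[OF g that(1)]]]] that by simp
  then show "ext_deriv A q (\<lambda>c p v. f c p v + g c p v) = (\<lambda>c p v. ext_deriv A q f c p v + ext_deriv A q g c p v)"
    by (auto simp: ext_deriv_def fun_eq_iff sum.distrib scaleR_add_right)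
qed

lemma smooth_forms_zero: "(\<lambda>c p v. 0) \<in> smooth_forms A q"
  "ext_deriv A q (\<lambda>c p v. 0) = (\<lambda>c p v. 0)"
  by (auto intro!: smooth_formsI smooth_on_const
      alternating_zero simp: is_pullback_def ext_deriv_def fun_eq_iff)

end

section \<open>Products of parametrised maps and left translation of forms\<close>

locale framed_lie_group = lie_group gmul one iv A n + framed_atlas A B
  for gmul :: "'a::{t2_space, second_countable_topology} \<Rightarrow> 'a \<Rightarrow> 'a" and one :: 'a and iv :: "'a \<Rightarrow> 'a"
    and A :: "('a, 'e::{real_inner, banach, heine_borel}) chart set" and n :: nat and B :: "'e set"
begin

lemma param_mult:
  assumes \<Psi>: "param S \<Psi>" and X: "param S X"
  shows "param S (\<lambda>z. gmul (\<Psi> z) (X z))"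
proof (rule paramI[OF paramD(1)[OF \<Psi>]])
  have cm: "continuous_on UNIV (\<lambda>(x, y). gmul x y)" using smooth_mult unfolding smooth_map_def by blast
  have "continuous_on S (\<lambda>z. (\<lambda>(x, y). gmul x y) (\<Psi> z, X z))"
    by (rule continuous_on_compose2[OF cm]) (auto intro!: continuous_intros paramD(2)[OF \<Psi>] paramD(2)[OF X])
  then show cont: "continuous_on S (\<lambda>z. gmul (\<Psi> z) (X z))" by simp
  fix W \<kappa> z assume W: "(W, \<kappa>) \<in> A" "z \<in> S" "gmul (\<Psi> z) (X z) \<in> W"
  obtain U \<phi> where U: "(U, \<phi>) \<in> A" "\<Psi> z \<in> U" by (rule obtain_chart)
  obtain V \<psi> where V: "(V, \<psi>) \<in> A" "X z \<in> V" by (rule obtain_chart)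
  let ?m = "\<lambda>(x, y). gmul x y" and ?c = "map_prod \<phi> \<psi>"
  let ?T = "(S \<inter> \<Psi> -` U) \<inter> (S \<inter> X -` V) \<inter> (S \<inter> (\<lambda>z. gmul (\<Psi> z) (X z)) -` W)"
  have T: "open ?T"
    by (intro open_Int paramD(4)[OF \<Psi>] paramD(4)[OF X] chart_facts(1)[OF U(1)] chart_facts(1)[OF V(1)]
        continuous_open_preimage[OF cont paramD(1)[OF \<Psi>] chart_facts(1)[OF W(1)]])
  \<comment> \<open>Injectivity is what makes the abstract inverse of the product chart return the
    pair \<open>(\<Psi> z, X z)\<close>.\<close>
  have inj: "inj_on ?c (U \<times> V)"
    by (rule inj_on_inverseI[where g = "map_prod (inv_into U \<phi>) (inv_into V \<psi>)"])
      (use chart_facts(5)[OF U(1)] chart_facts(5)[OF V(1)] in auto)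
  have "(U \<times> V, ?c) \<in> prod_atlas A A" using U V unfolding prod_atlas_def by blast
  then have "smooth_on (?c ` ((U \<times> V) \<inter> ?m -` W)) (\<kappa> \<circ> ?m \<circ> inv_into (U \<times> V) ?c)"
    using smooth_mult W(1) unfolding smooth_map_def by blast
  then have "smooth_on ?T (\<lambda>z. (\<kappa> \<circ> ?m \<circ> inv_into (U \<times> V) ?c) ((\<phi> \<circ> \<Psi>) z, (\<psi> \<circ> X) z))"
  proof (rule smooth_on_compose[OF frame_Pair[OF frame frame] T])
    show "smooth_on ?T (\<lambda>z. ((\<phi> \<circ> \<Psi>) z, (\<psi> \<circ> X) z))"
      by (intro smooth_on_Pair[OF T] smooth_on_subset[OF paramD(3)[OF \<Psi> U(1)]]
          smooth_on_subset[OF paramD(3)[OF X V(1)]]) auto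
    show "(\<lambda>z. ((\<phi> \<circ> \<Psi>) z, (\<psi> \<circ> X) z)) ` ?T \<subseteq> ?c ` ((U \<times> V) \<inter> ?m -` W)"
    proof (rule image_subsetI)
      fix z assume "z \<in> ?T"
      then show "((\<phi> \<circ> \<Psi>) z, (\<psi> \<circ> X) z) \<in> ?c ` ((U \<times> V) \<inter> ?m -` W)"
        by (intro image_eqI[of _ _ "(\<Psi> z, X z)"]) auto
    qed
  qed
  then have "smooth_on ?T (\<kappa> \<circ> (\<lambda>z. gmul (\<Psi> z) (X z)))"
  proof (rule smooth_on_cong[OF T, rotated])
    fix z assume "z \<in> ?T"
    then have "inv_into (U \<times> V) ?c (?c (\<Psi> z, X z)) = (\<Psi> z, X z)" by (intro inv_into_f_f[OF inj]) auto
    then show "(\<kappa> \<circ> ?m \<circ> inv_into (U \<times> V) ?c) ((\<phi> \<circ> \<Psi>) z, (\<psi> \<circ> X) z) = (\<kappa> \<circ> (\<lambda>z. gmul (\<Psi> z) (X z))) z"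
      by simp
  qed
  then show "\<exists>T. open T \<and> z \<in> T \<and> smooth_on T (\<kappa> \<circ> (\<lambda>z. gmul (\<Psi> z) (X z)))"
    using T U V W by (intro exI[of _ ?T]) auto
qed

lemma param_translate: "param S \<Psi> \<Longrightarrow> param S (\<lambda>z. gmul g (\<Psi> z))"
  by (rule param_mult[OF param_const]) (auto dest: paramD(1))

lemma pb_left_invariant:
  assumes "left_invariant gmul A \<theta>" "param S \<Psi>" "z \<in> S"
  shows "pb \<theta> (\<lambda>z. gmul g (\<Psi> z)) z v = pb \<theta> \<Psi> z v"
proof -
  obtain V \<psi> where V: "(V, \<psi>) \<in> A" "gmul g (\<Psi> z) \<in> V" "chart_at (gmul g (\<Psi> z)) = (V, \<psi>)"
    by (rule obtain_chart)
  have "is_pullback A (gmul g) \<theta> \<theta>" using assms(1) unfolding left_invariant_def by blast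
  from pb_is_pullback[OF this assms(2,3) param_translate[OF param_chart] V(1,2), of v]
  show ?thesis unfolding pb_def[of \<theta> "\<lambda>z. gmul g (\<Psi> z)"] V(3) by simp
qed

text \<open>The pullback along left multiplication by g. In the chart c its coordinate expression is
  the pullback of f along the translated inverse chart.\<close>

definition translate :: "'a \<Rightarrow> ('a, 'e, 'b::real_normed_vector) form \<Rightarrow> ('a, 'e, 'b) form" where
  "translate g f = mkform (\<lambda>c. pb f (\<lambda>x. gmul g (inv_into (fst c) (snd c) x)))"

lemma translate_smooth:
  assumes f: "f \<in> smooth_forms A q"
  shows "translate g f \<in> smooth_forms A q"
  unfolding translate_def
proof (rule mkform_smooth; unfold fst_conv snd_conv)
  fix U \<phi> assume U: "(U, \<phi>) \<in> A"
  note p = param_translate[OF param_chart[OF U], of g]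
  show "alternating q (pb f (\<lambda>x. gmul g (inv_into U \<phi> x)) x)" if "x \<in> \<phi> ` U" for x
    by (rule pb_alternating[OF f p that])
  show "smooth_on (\<phi> ` U) (\<lambda>x. pb f (\<lambda>x. gmul g (inv_into U \<phi> x)) x v)" for v
    by (rule pb_smooth[OF f p])
  fix V \<psi> p v assume V: "(V, \<psi>) \<in> A" and p: "p \<in> U" "p \<in> V"
  let ?S = "\<phi> ` U \<inter> inv_into U \<phi> -` V"
  have S: "open ?S" by (rule paramD(4)[OF param_chart[OF U] chart_facts(1)[OF V]])
  have pS: "\<phi> p \<in> ?S" using p chart_facts(5)[OF U] by auto
  have "pb f (\<lambda>x. gmul g (inv_into U \<phi> x)) (\<phi> p) v =
      pb f (\<lambda>x. gmul g (inv_into V \<psi> ((\<psi> \<circ> inv_into U \<phi>) x))) (\<phi> p) v"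
    by (rule pb_cong[OF S pS]) (simp add: chart_facts(5)[OF V])
  also have "\<dots> = pb f (\<lambda>x. gmul g (inv_into V \<psi> x)) ((\<psi> \<circ> inv_into U \<phi>) (\<phi> p))
      (\<lambda>i. fd (\<psi> \<circ> inv_into U \<phi>) (\<phi> p) (v i))"
    by (rule pb_compose[OF param_translate[OF param_chart[OF V]] _ param_has_derivative[OF param_chart[OF U] _ V]])
      (use p chart_facts(5)[OF U] in auto)
  finally show "pb f (\<lambda>x. gmul g (inv_into U \<phi> x)) (\<phi> p) v = pb f (\<lambda>x. gmul g (inv_into V \<psi> x)) (\<psi> p)
      (\<lambda>i. fd (\<psi> \<circ> inv_into U \<phi>) (\<phi> p) (v i))"
    using p chart_facts(5)[OF U] by simp
qed

lemma pb_translate: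
  assumes \<Psi>: "param S \<Psi>" "z \<in> S"
  shows "pb (translate g f) \<Psi> z v = pb f (\<lambda>z. gmul g (\<Psi> z)) z v"
proof -
  obtain U \<phi> where U: "(U, \<phi>) \<in> A" "\<Psi> z \<in> U" "chart_at (\<Psi> z) = (U, \<phi>)" by (rule obtain_chart)
  have "pb (translate g f) \<Psi> z v = pb f (\<lambda>x. gmul g (inv_into U \<phi> x)) ((\<phi> \<circ> \<Psi>) z) (\<lambda>i. fd (\<phi> \<circ> \<Psi>) z (v i))"
    using U unfolding pb_def[of "translate g f"] U(3) by (simp add: translate_def mkform_def)
  also have "\<dots> = pb f (\<lambda>z. gmul g (inv_into U \<phi> ((\<phi> \<circ> \<Psi>) z))) z v"
    by (rule pb_compose[OF param_translate[OF param_chart[OF U(1)]] _ param_has_derivative[OF \<Psi> U(1,2)], symmetric])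
      (use U in auto)
  also have "\<dots> = pb f (\<lambda>z. gmul g (\<Psi> z)) z v"
    by (rule pb_cong[OF paramD(4)[OF \<Psi>(1) chart_facts(1)[OF U(1)]]]) (use \<Psi> U chart_facts(5)[OF U(1)] in auto)
  finally show ?thesis .
qed

text \<open>Pullback reverses the order of composition, hence \<open>gmul h g\<close>.\<close>

lemma translate_translate: "translate g (translate h f) = translate (gmul h g) f"
proof -
  have "translate g (translate h f) c p v = translate (gmul h g) f c p v" for c p v
  proof (cases "c \<in> A \<and> p \<in> fst c")
    case True
    then obtain U \<phi> where c: "c = (U, \<phi>)" "(U, \<phi>) \<in> A" "p \<in> U" by (cases c) auto
    then show ?thesis unfolding translate_def[of g] translate_def[of "gmul h g"]
      by (simp add: mkform_def pb_translate[OF param_translate[OF param_chart]] assoc)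
  qed (auto simp: translate_def mkform_def)
  then show ?thesis by (simp add: fun_eq_iff)
qed

lemma translate_one:
  assumes "f \<in> smooth_forms A q"
  shows "translate one f = f"
proof -
  have "translate one f c p v = f c p v" for c p v
  proof (cases "c \<in> A \<and> p \<in> fst c")
    case True
    then obtain U \<phi> where c: "c = (U, \<phi>)" "(U, \<phi>) \<in> A" "p \<in> U" by (cases c) auto
    then show ?thesis unfolding translate_def
      using pb_chart_self[OF smooth_formsD(3)[OF assms] c(2), of "\<phi> p" v] chart_facts(5)[OF c(2)]
      by (simp add: mkform_def)
  qed (auto simp: translate_def mkform_def smooth_formsD(1)[OF assms])
  then show ?thesis by (simp add: fun_eq_iff)
qed

end

subsection \<open>Translations act trivially up to homotopy and a phase\<close>

text \<open>Contraction with the vector a in slot 0, combined with a linear change of the other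
  arguments; the homotopy operator has this shape with a = \<partial>t.\<close>

lemma alternating_case_nat:
  assumes F: "alternating (Suc q) F" and L: "linear L"
  shows "alternating q (\<lambda>v. F (case_nat a (\<lambda>j. L (v j))))"
proof -
  have ml: "multilinear (Suc q) F" and z: "\<And>v i j. i < Suc q \<Longrightarrow> j < Suc q \<Longrightarrow> i \<noteq> j \<Longrightarrow> v i = v j \<Longrightarrow> F v = 0"
    using F unfolding alternating_def by blast+
  have "alternating q (\<lambda>v. F (case_nat a v))"
  proof -
    have "linear (\<lambda>b. F (case_nat a (v(i := b))))" if "i < q" for v i
    proof -
      have "case_nat a (v(i := b)) = (case_nat a v)(Suc i := b)" for b
        by (auto simp: fun_eq_iff split: nat.split)
      then show ?thesis using multilinear_linear[OF ml, of "Suc i" "case_nat a v"] that by simp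
    qed
    moreover have "F (case_nat a v) = F (case_nat a w)" if "\<forall>i<q. v i = w i" for v w
      by (rule multilinear_cong[OF ml]) (use that in \<open>auto split: nat.split\<close>)
    moreover have "F (case_nat a v) = 0" if "i < q" "j < q" "i \<noteq> j \<and> v i = v j" for v i j
      using z[of "Suc i" "Suc j" "case_nat a v"] that by simp
    ultimately show ?thesis unfolding alternating_def multilinear_def by blast
  qed
  from alternating_compose_linear[OF this L] show ?thesis .
qed

lemma alternating_integral:
  fixes F :: "real \<Rightarrow> (nat \<Rightarrow> 'e::real_vector) \<Rightarrow> complex"
  assumes F: "\<And>t. t \<in> I \<Longrightarrow> alternating q (F t)" and int: "\<And>v. (\<lambda>t. c t * F t v) integrable_on I"
  shows "alternating q (\<lambda>v. integral I (\<lambda>t. c t * F t v))"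
proof -
  have ml: "multilinear q (F t)" and z: "\<And>v i j. i < q \<Longrightarrow> j < q \<Longrightarrow> i \<noteq> j \<Longrightarrow> v i = v j \<Longrightarrow> F t v = 0"
    if "t \<in> I" for t using F[OF that] unfolding alternating_def by blast+
  have "linear (\<lambda>a. integral I (\<lambda>t. c t * F t (v(i := a))))" if i: "i < q" for v i
  proof (rule linearI)
    fix a b and r :: real
    have "integral I (\<lambda>t. c t * F t (v(i := a + b))) =
        integral I (\<lambda>t. c t * F t (v(i := a)) + c t * F t (v(i := b)))"
      by (rule integral_cong) (simp add: linear_add[OF multilinear_linear[OF ml i, of _ v]] distrib_left)
    also have "\<dots> = integral I (\<lambda>t. c t * F t (v(i := a))) + integral I (\<lambda>t. c t * F t (v(i := b)))"
      by (rule integral_add[OF int int])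
    finally show "integral I (\<lambda>t. c t * F t (v(i := a + b))) =
      integral I (\<lambda>t. c t * F t (v(i := a))) + integral I (\<lambda>t. c t * F t (v(i := b)))" .
    have "integral I (\<lambda>t. c t * F t (v(i := r *\<^sub>R a))) = integral I (\<lambda>t. r *\<^sub>R (c t * F t (v(i := a))))"
      by (rule integral_cong) (simp add: linear_cmul[OF multilinear_linear[OF ml i, of _ v]])
    then show "integral I (\<lambda>t. c t * F t (v(i := r *\<^sub>R a))) = r *\<^sub>R integral I (\<lambda>t. c t * F t (v(i := a)))"
      by (simp only: integral_cmul)
  qed
  moreover have "integral I (\<lambda>t. c t * F t v) = integral I (\<lambda>t. c t * F t w)" if "\<forall>i<q. v i = w i" for v w
    by (rule integral_cong) (use that multilinear_cong[OF ml] in metis)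
  moreover have "integral I (\<lambda>t. c t * F t v) = 0" if "i < q" "j < q" "i \<noteq> j \<and> v i = v j" for v i j
    using integral_cong[of I "\<lambda>t. c t * F t v" "\<lambda>t. 0"] z that by simp
  ultimately show ?thesis unfolding alternating_def multilinear_def by blast
qed

locale twisted_lie_group = framed_lie_group gmul one iv A n B
  for gmul :: "'a::{t2_space, second_countable_topology} \<Rightarrow> 'a \<Rightarrow> 'a" and one :: 'a and iv :: "'a \<Rightarrow> 'a"
    and A :: "('a, 'e::{real_inner, banach, heine_borel}) chart set" and n :: nat and B :: "'e set" +
  fixes \<theta> :: "('a, 'e, real) form"
  assumes connected: "connected (UNIV :: 'a set)"
    and \<theta>_smooth: "\<theta> \<in> smooth_forms A 1" and \<theta>_closed: "ext_deriv A 1 \<theta> = (\<lambda>c p v. 0)"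
    and \<theta>_invariant: "left_invariant gmul A \<theta>"
begin

definition tw :: "nat \<Rightarrow> ('a, 'e, complex) form \<Rightarrow> ('a, 'e, complex) form" where
  "tw q f = (\<lambda>c p v. ext_deriv A q f c p v + \<i> * wedge_one q \<theta> f c p v)"

definition cocycles :: "nat \<Rightarrow> ('a, 'e, complex) form set" where
  "cocycles q = {f \<in> smooth_forms A q. tw q f = (\<lambda>c p v. 0)}"

definition coboundaries :: "nat \<Rightarrow> ('a, 'e, complex) form set" where
  "coboundaries q = (if q = 0 then {\<lambda>c p v. 0} else tw (q - 1) ` smooth_forms A (q - 1))"

text \<open>Naturality of the twisted derivative: the wedge term is pointwise, and the derivative
  term is \<open>pb_ext_deriv\<close>.\<close>

lemma pb_tw:
  fixes \<Psi> :: "'z::{real_inner,banach} \<Rightarrow> 'a"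
  assumes C: "frame (C :: 'z set)" and f: "f \<in> smooth_forms A q" and \<Psi>: "param S \<Psi>" "z \<in> S"
    and V: "(V, \<psi>) \<in> A" "\<Psi> z \<in> V"
  shows "(\<Sum>i\<le>q. (-1) ^ i *\<^sub>R (fd (\<lambda>z. pb f \<Psi> z (omit i v)) z (v i) +
      \<i> * of_real (pb \<theta> \<Psi> z (\<lambda>_. v i)) * pb f \<Psi> z (omit i v))) =
    tw q f (V, \<psi>) (\<Psi> z) (\<lambda>i. fd (\<psi> \<circ> \<Psi>) z (v i))"
proof -
  let ?v = "\<lambda>i. fd (\<psi> \<circ> \<Psi>) z (v i)"
  have "wedge_one q \<theta> f (V, \<psi>) (\<Psi> z) ?v =
      (\<Sum>i\<le>q. (-1) ^ i *\<^sub>R (of_real (pb \<theta> \<Psi> z (\<lambda>_. v i)) * pb f \<Psi> z (omit i v)))"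
    unfolding wedge_one_def pb_chart[OF smooth_formsD(3)[OF f] \<Psi> V] pb_chart[OF smooth_formsD(3)[OF \<theta>_smooth] \<Psi> V]
    by (simp add: omit_def scaleR_conv_of_real mult.assoc)
  then show ?thesis
    unfolding tw_def pb_ext_deriv[OF C f \<Psi> V, symmetric]
    by (simp add: scaleR_add_right sum.distrib sum_distrib_left mult.assoc)
qed

lemma tw_chart:
  assumes f: "f \<in> smooth_forms A q" and U: "(U, \<phi>) \<in> A" "p \<in> U"
  shows "tw q f (U, \<phi>) p v = (\<Sum>i\<le>q. (-1) ^ i *\<^sub>R (fd (\<lambda>x. pb f (inv_into U \<phi>) x (omit i v)) (\<phi> p) (v i) +
      \<i> * of_real (pb \<theta> (inv_into U \<phi>) (\<phi> p) (\<lambda>_. v i)) * pb f (inv_into U \<phi>) (\<phi> p) (omit i v)))"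
proof -
  have p: "inv_into U \<phi> (\<phi> p) = p" "\<phi> p \<in> \<phi> ` U" using U chart_facts(5)[OF U(1)] by auto
  have "fd (\<phi> \<circ> inv_into U \<phi>) (\<phi> p) = fd (\<lambda>x. x) (\<phi> p)"
    by (rule fd_cong[OF chart_facts(2)[OF U(1)] p(2)]) (simp add: chart_facts(6)[OF U(1)])
  then show ?thesis
    using pb_tw[OF frame f param_chart[OF U(1)] p(2) U(1), of v] U(2) unfolding p(1) by simp
qed

lemma tw_outside:
  assumes "f \<in> smooth_forms A q" "\<not> (c \<in> A \<and> p \<in> fst c)"
  shows "tw q f c p v = 0"
  using assms smooth_formsD(1)[OF assms(1)] by (cases c) (auto simp: tw_def ext_deriv_def wedge_one_def)

text \<open>By invariance \<theta> has the same pullback along the inverse chart and along its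
  translate, so the twisted derivative of the translate is that of f, read along the translated
  chart.\<close>

lemma translate_cocycle:
  assumes f: "f \<in> cocycles q"
  shows "translate g f \<in> cocycles q"
proof -
  have fs: "f \<in> smooth_forms A q" and f0: "tw q f = (\<lambda>c p v. 0)" using f by (auto simp: cocycles_def)
  note ts = translate_smooth[OF fs, of g]
  have "tw q (translate g f) c p v = 0" for c p v
  proof (cases "c \<in> A \<and> p \<in> fst c")
    case True
    then obtain U \<phi> where c: "c = (U, \<phi>)" and U: "(U, \<phi>) \<in> A" "p \<in> U" by (cases c) auto
    let ?\<Psi> = "\<lambda>x. gmul g (inv_into U \<phi> x)"
    have p: "\<phi> p \<in> \<phi> ` U" using U by auto
    obtain V \<psi> where V: "(V, \<psi>) \<in> A" "?\<Psi> (\<phi> p) \<in> V" by (rule obtain_chart)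
    have "fd (\<lambda>x. pb (translate g f) (inv_into U \<phi>) x w) (\<phi> p) = fd (\<lambda>x. pb f ?\<Psi> x w) (\<phi> p)" for w
      by (rule fd_cong[OF chart_facts(2)[OF U(1)] p]) (rule pb_translate[OF param_chart[OF U(1)]])
    then have "tw q (translate g f) (U, \<phi>) p v = (\<Sum>i\<le>q. (-1) ^ i *\<^sub>R (fd (\<lambda>x. pb f ?\<Psi> x (omit i v)) (\<phi> p) (v i) +
      \<i> * of_real (pb \<theta> ?\<Psi> (\<phi> p) (\<lambda>_. v i)) * pb f ?\<Psi> (\<phi> p) (omit i v)))"
      unfolding tw_chart[OF ts U] pb_left_invariant[OF \<theta>_invariant param_chart[OF U(1)] p]
      by (simp only: pb_translate[OF param_chart[OF U(1)] p])
    also have "\<dots> = 0"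
      unfolding pb_tw[OF frame fs param_translate[OF param_chart[OF U(1)]] p V] f0 ..
    finally show ?thesis unfolding c .
  qed (rule tw_outside[OF ts])
  then show ?thesis using ts unfolding cocycles_def by (simp add: fun_eq_iff)
qed

section \<open>Pullback to time and space along a moving translation, and Cartan's formula\<close>

definition tube :: "(real \<Rightarrow> 'a) \<Rightarrow> ('a, 'e) chart \<Rightarrow> real \<times> 'e \<Rightarrow> 'a" where
  "tube \<gamma> c z = gmul (\<gamma> (fst z)) (inv_into (fst c) (snd c) (snd z))"

lemma param_tube:
  assumes \<gamma>: "param T \<gamma>" and U: "(U, \<phi>) \<in> A"
  shows "param (T \<times> \<phi> ` U) (tube \<gamma> (U, \<phi>))"
proof -
  have o: "open (T \<times> \<phi> ` U)" by (rule open_Times[OF paramD(1)[OF \<gamma>] chart_facts(2)[OF U]])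
  have "param (T \<times> \<phi> ` U) (\<lambda>z. gmul (\<gamma> (fst z)) (inv_into U \<phi> (snd z)))"
    by (rule param_mult[OF param_compose[OF frame_real \<gamma> o] param_compose[OF frame param_chart[OF U] o]])
      (auto intro: smooth_on_linear[OF bounded_linear_fst o] smooth_on_linear[OF bounded_linear_snd o] smooth_on_ident[OF o])
  then show ?thesis by (simp add: tube_def[abs_def])
qed

lemma pb_tube_space:
  assumes \<gamma>: "param T \<gamma>" "t \<in> T" and U: "(U, \<phi>) \<in> A" "x \<in> \<phi> ` U"
  shows "pb f (tube \<gamma> (U, \<phi>)) (t, x) (\<lambda>i. (0, v i)) = pb f (\<lambda>x. gmul (\<gamma> t) (inv_into U \<phi> x)) x v"
proof -
  have d: "((\<lambda>x. (t, x)) has_derivative (\<lambda>u. (0, u))) (at x)" by (auto intro!: derivative_eq_intros)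
  have "pb f (\<lambda>x. tube \<gamma> (U, \<phi>) (t, x)) x v = pb f (tube \<gamma> (U, \<phi>)) (t, x) (\<lambda>i. (0, v i))"
    by (rule pb_compose[OF param_tube[OF \<gamma>(1) U(1)] _ d]) (use \<gamma> U in simp)
  then show ?thesis by (simp add: tube_def)
qed

lemma pb_tube_time:
  assumes \<gamma>: "param T \<gamma>" "t \<in> T" and U: "(U, \<phi>) \<in> A" "x \<in> \<phi> ` U"
  shows "pb f (tube \<gamma> (U, \<phi>)) (t, x) (\<lambda>i. (v i, 0)) = pb f (\<lambda>s. gmul (\<gamma> s) (inv_into U \<phi> x)) t v"
proof -
  have d: "((\<lambda>s. (s, x)) has_derivative (\<lambda>u. (u, 0))) (at t)" by (auto intro!: derivative_eq_intros)
  have "pb f (\<lambda>s. tube \<gamma> (U, \<phi>) (s, x)) t v = pb f (tube \<gamma> (U, \<phi>)) (t, x) (\<lambda>i. (v i, 0))"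
    by (rule pb_compose[OF param_tube[OF \<gamma>(1) U(1)] _ d]) (use \<gamma> U in simp)
  then show ?thesis by (simp add: tube_def)
qed

lemma \<theta>_tube_space:
  assumes \<gamma>: "param T \<gamma>" "t \<in> T" and U: "(U, \<phi>) \<in> A" "x \<in> \<phi> ` U"
  shows "pb \<theta> (tube \<gamma> (U, \<phi>)) (t, x) (\<lambda>i. (0, v i)) = pb \<theta> (inv_into U \<phi>) x v"
  unfolding pb_tube_space[OF assms] by (rule pb_left_invariant[OF \<theta>_invariant param_chart[OF U(1)] U(2)])

text \<open>
  For a curve \<open>\<gamma>\<close> the function \<open>p \<mapsto> \<theta> (\<partial>\<^sub>t (\<gamma>(t) p))\<close> is constant: by left invariance
  the \<open>p\<close>-part of the pullback of \<open>\<theta>\<close> along \<open>(t, p) \<mapsto> \<gamma>(t) p\<close> does not depend on \<open>t\<close>,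
  and the pullback is closed.
\<close>

lemma \<theta>_tube_time:
  assumes \<gamma>: "param T \<gamma>" "t \<in> T" and U: "(U, \<phi>) \<in> A" "x \<in> \<phi> ` U"
  shows "pb \<theta> (tube \<gamma> (U, \<phi>)) (t, x) (\<lambda>_. (1, 0)) = pb \<theta> \<gamma> t (\<lambda>_. 1)"
proof -
  define \<Lambda> where "\<Lambda> = (\<lambda>p. pb \<theta> (\<lambda>s. gmul (\<gamma> s) p) t (\<lambda>_. 1))"
  have \<Lambda>: "pb \<theta> (tube \<gamma> (U, \<phi>)) (t, x) (\<lambda>_. (1, 0)) = \<Lambda> (inv_into U \<phi> x)"
    if "(U, \<phi>) \<in> A" "x \<in> \<phi> ` U" for U \<phi> x
    unfolding \<Lambda>_def by (rule pb_tube_time[OF \<gamma> that])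
  have loc: "\<exists>S. open S \<and> p \<in> S \<and> (\<forall>b\<in>S. \<Lambda> p = \<Lambda> b)" for p
  proof -
    obtain U \<phi> where U: "(U, \<phi>) \<in> A" "p \<in> U" by (rule obtain_chart)
    let ?\<Psi> = "tube \<gamma> (U, \<phi>)" and ?S = "T \<times> \<phi> ` U"
    note P = param_tube[OF \<gamma>(1) U(1)]
    have d0: "((\<lambda>x. \<Lambda> (inv_into U \<phi> x)) has_derivative (\<lambda>u. 0)) (at x)" if x: "x \<in> \<phi> ` U" for x
    proof -
      let ?z = "(t, x)"
      have z: "?z \<in> ?S" using x \<gamma> by simp
      have 0: "fd (\<lambda>z. pb \<theta> ?\<Psi> z (\<lambda>_. (1, 0))) ?z (0, u) = 0" for u
      proof -
        \<comment> \<open>Closedness is tested on \<partial>t and u. It equates the t-derivative of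
          \<theta>(u) with the u-derivative of \<theta>(\<partial>t), and the former is 0 because
          \<theta>(u) does not depend on t.\<close>
        define v where "v = (\<lambda>i::nat. if i = 0 then (1::real, 0::'e) else (0, u))"
        obtain V \<psi> where V: "(V, \<psi>) \<in> A" "?\<Psi> ?z \<in> V" by (rule obtain_chart)
        have "(\<Sum>i\<le>1. (-1) ^ i *\<^sub>R fd (\<lambda>z. pb \<theta> ?\<Psi> z (omit i v)) ?z (v i)) = 0"
          unfolding pb_ext_deriv[OF frame_Pair[OF frame_real frame] \<theta>_smooth P z V] \<theta>_closed ..
        then have sum: "fd (\<lambda>z. pb \<theta> ?\<Psi> z (omit 0 v)) ?z (1, 0) = fd (\<lambda>z. pb \<theta> ?\<Psi> z (omit 1 v)) ?z (0, u)"
          by (simp add: v_def)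
        have "fd (\<lambda>z. pb \<theta> ?\<Psi> z (omit 0 v)) ?z = fd (\<lambda>z. pb \<theta> (inv_into U \<phi>) (snd z) (\<lambda>_. u)) ?z"
        proof (rule fd_cong[OF paramD(1)[OF P] z])
          fix y assume y: "y \<in> ?S"
          have "omit 0 v = (\<lambda>_. (0, u))" by (auto simp: omit_def v_def)
          then show "pb \<theta> ?\<Psi> y (omit 0 v) = pb \<theta> (inv_into U \<phi>) (snd y) (\<lambda>_. u)"
            using \<theta>_tube_space[OF \<gamma>(1) _ U(1), of "fst y" "snd y" "\<lambda>_. u"] y by auto
        qed
        also have "\<dots> = (\<lambda>h. fd (\<lambda>x. pb \<theta> (inv_into U \<phi>) x (\<lambda>_. u)) x (snd h))"
          by (rule fd_eq, rule has_derivative_compose[where f = snd and f' = snd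
                and g = "\<lambda>x. pb \<theta> (inv_into U \<phi>) x (\<lambda>_. u)"])
            (use smooth_onD(1)[OF pb_smooth[OF \<theta>_smooth param_chart[OF U(1)]] x] in
              \<open>auto intro!: bounded_linear_imp_has_derivative bounded_linear_snd\<close>)
        finally have "fd (\<lambda>z. pb \<theta> ?\<Psi> z (omit 0 v)) ?z (1, 0) = fd (\<lambda>x. pb \<theta> (inv_into U \<phi>) x (\<lambda>_. u)) x 0"
          by simp
        also have "\<dots> = 0"
          by (rule linear_0[OF has_derivative_linear[OF smooth_onD(1)[OF pb_smooth[OF \<theta>_smooth param_chart[OF U(1)]] x]]])
        finally have l0: "fd (\<lambda>z. pb \<theta> ?\<Psi> z (omit 0 v)) ?z (1, 0) = 0" .
        have "fd (\<lambda>z. pb \<theta> ?\<Psi> z (omit 1 v)) ?z = fd (\<lambda>z. pb \<theta> ?\<Psi> z (\<lambda>_. (1, 0))) ?z"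
        proof (rule fd_cong[OF paramD(1)[OF P] z])
          fix y assume "y \<in> ?S"
          then have "multilinear 1 (pb \<theta> ?\<Psi> y)"
            using pb_alternating[OF \<theta>_smooth P] unfolding alternating_def by blast
          then show "pb \<theta> ?\<Psi> y (omit 1 v) = pb \<theta> ?\<Psi> y (\<lambda>_. (1, 0))"
            by (rule multilinear_cong) (simp add: omit_def v_def)
        qed
        then show ?thesis using sum l0 by simp
      qed
      have "((\<lambda>x. pb \<theta> ?\<Psi> (t, x) (\<lambda>_. (1, 0))) has_derivative (\<lambda>u. fd (\<lambda>z. pb \<theta> ?\<Psi> z (\<lambda>_. (1, 0))) ?z (0, u))) (at x)"
        by (rule has_derivative_slice[OF smooth_onD(1)[OF pb_smooth[OF \<theta>_smooth P] z]])
      then show ?thesis unfolding 0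
        by (rule has_derivative_transform_within_open[OF _ chart_facts(2)[OF U(1)] x]) (rule \<Lambda>[OF U(1)])
    qed
    obtain r where r: "r > 0" "ball (\<phi> p) r \<subseteq> \<phi> ` U"
      using openE[OF chart_facts(2)[OF U(1)], of "\<phi> p"] U(2) by blast
    obtain k where k: "\<And>x. x \<in> ball (\<phi> p) r \<Longrightarrow> \<Lambda> (inv_into U \<phi> x) = k"
      using has_derivative_zero_constant[OF convex_ball[of "\<phi> p" r], of "\<lambda>x. \<Lambda> (inv_into U \<phi> x)"]
        has_derivative_at_withinI[OF d0] r(2) by blast
    let ?N = "U \<inter> \<phi> -` ball (\<phi> p) r"
    have "open ?N" by (rule continuous_open_preimage[OF chart_facts(3,1)[OF U(1)] open_ball])
    moreover have "\<Lambda> b = k" if "b \<in> ?N" for b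
      using k[of "\<phi> b"] that chart_facts(5)[OF U(1), of b] by simp
    ultimately show ?thesis using U(2) r(1) by (intro exI[of _ ?N]) auto
  qed
  \<comment> \<open>At the unit the translated curve is \<gamma> itself, which identifies the
    constant.\<close>
  have "\<Lambda> (inv_into U \<phi> x) = \<Lambda> one"
  proof (rule connected_local_const[OF connected])
    show "\<forall>a\<in>UNIV. eventually (\<lambda>b. \<Lambda> a = \<Lambda> b) (at a within UNIV)"
    proof
      fix a
      obtain S where "open S" "a \<in> S" "\<forall>b\<in>S. \<Lambda> a = \<Lambda> b" using loc by blast
      then show "eventually (\<lambda>b. \<Lambda> a = \<Lambda> b) (at a within UNIV)"
        unfolding eventually_at_topological by (intro exI[of _ S]) simp
    qed
  qed auto
  then show ?thesis using \<Lambda>[OF U] by (simp add: \<Lambda>_def)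
qed

text \<open>The vectors \<open>\<partial>\<^sub>t, v\<^sub>0, v\<^sub>1, \<dots>\<close>, for contraction with \<open>\<partial>\<^sub>t\<close>.\<close>

definition lift :: "(nat \<Rightarrow> 'e) \<Rightarrow> nat \<Rightarrow> real \<times> 'e" where
  "lift v = case_nat (1, 0) (\<lambda>j. (0, v j))"

text \<open>The cocycle equation evaluated on \<partial>t, \<open>v 0\<close>, ...,
  \<open>v (q - 1)\<close>. Omitting \<partial>t gives the left side; the other terms carry the sign
  \<open>(-1) ^ (i + 1)\<close> and move to the right. This is Cartan's formula for the time
  derivative.\<close>

lemma cocycle_time_derivative:
  assumes f: "f \<in> cocycles q" and \<gamma>: "param T \<gamma>" "t \<in> T" and U: "(U, \<phi>) \<in> A" "x \<in> \<phi> ` U"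
  shows "fd (\<lambda>z. pb f (tube \<gamma> (U, \<phi>)) z (\<lambda>i. (0, v i))) (t, x) (1, 0) +
      \<i> * of_real (pb \<theta> \<gamma> t (\<lambda>_. 1)) * pb f (tube \<gamma> (U, \<phi>)) (t, x) (\<lambda>i. (0, v i)) =
    (\<Sum>i<q. (-1) ^ i *\<^sub>R (fd (\<lambda>z. pb f (tube \<gamma> (U, \<phi>)) z (lift (omit i v))) (t, x) (0, v i) +
      \<i> * of_real (pb \<theta> (inv_into U \<phi>) x (\<lambda>_. v i)) * pb f (tube \<gamma> (U, \<phi>)) (t, x) (lift (omit i v))))"
proof -
  let ?\<Psi> = "tube \<gamma> (U, \<phi>)"
  have fs: "f \<in> smooth_forms A q" and f0: "tw q f = (\<lambda>c p v. 0)" using f by (auto simp: cocycles_def)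
  have z: "(t, x) \<in> T \<times> \<phi> ` U" using \<gamma> U by simp
  obtain V \<psi> where V: "(V, \<psi>) \<in> A" "?\<Psi> (t, x) \<in> V" by (rule obtain_chart)
  have o: "omit 0 (lift v) = (\<lambda>i. (0, v i))" "omit (Suc i) (lift v) = lift (omit i v)" for i
    by (auto simp: omit_def lift_def fun_eq_iff split: nat.split)
  have l: "lift v 0 = (1, 0)" "lift v (Suc i) = (0, v i)" for i by (simp_all add: lift_def)
  have "0 = (\<Sum>i\<le>q. (-1) ^ i *\<^sub>R (fd (\<lambda>z. pb f ?\<Psi> z (omit i (lift v))) (t, x) (lift v i) +
      \<i> * of_real (pb \<theta> ?\<Psi> (t, x) (\<lambda>_. lift v i)) * pb f ?\<Psi> (t, x) (omit i (lift v))))"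
    unfolding pb_tw[OF frame_Pair[OF frame_real frame] fs param_tube[OF \<gamma>(1) U(1)] z V] f0 ..
  then show ?thesis
    unfolding sum.atMost_shift o l \<theta>_tube_space[OF \<gamma> U] \<theta>_tube_time[OF \<gamma> U]
    by (simp add: sum_negf add_eq_0_iff2)
qed

definition phase :: "(real \<Rightarrow> 'a) \<Rightarrow> real \<Rightarrow> complex" where
  "phase \<gamma> t = exp (\<i> * of_real (integral {0..t} (\<lambda>s. pb \<theta> \<gamma> s (\<lambda>_. 1))))"

text \<open>Taken within \<open>{0..1}\<close>: for negative t the interval \<open>{0..t}\<close> is
  empty and the phase is 1, so a two-sided derivative at 0 can fail.\<close>

lemma phase_derivative:
  assumes \<gamma>: "param T \<gamma>" and T: "{0..1} \<subseteq> T" and t: "t \<in> {0..1}"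
  shows "(phase \<gamma> has_vector_derivative (\<i> * of_real (pb \<theta> \<gamma> t (\<lambda>_. 1)) * phase \<gamma> t)) (at t within {0..1})"
proof -
  have "continuous_on {0..1} (\<lambda>s. pb \<theta> \<gamma> s (\<lambda>_. 1))"
    by (rule continuous_on_subset[OF smooth_onD(3)[OF pb_smooth[OF \<theta>_smooth \<gamma>]] T])
  from integral_has_vector_derivative[OF this t]
  have "((\<lambda>u. integral {0..u} (\<lambda>s. pb \<theta> \<gamma> s (\<lambda>_. 1))) has_vector_derivative pb \<theta> \<gamma> t (\<lambda>_. 1)) (at t within {0..1})" .
  then have "((\<lambda>u. \<i> * complex_of_real (integral {0..u} (\<lambda>s. pb \<theta> \<gamma> s (\<lambda>_. 1)))) has_vector_derivative
      \<i> * of_real (pb \<theta> \<gamma> t (\<lambda>_. 1))) (at t within {0..1})"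
    by (intro bounded_linear.has_vector_derivative[OF bounded_linear_mult_right]
        bounded_linear.has_vector_derivative[OF bounded_linear_of_real])
  from field_vector_diff_chain_within[OF this has_field_derivative_at_within[OF DERIV_exp]]
  show ?thesis unfolding phase_def[abs_def] o_def .
qed

lemma phase_continuous:
  assumes "param T \<gamma>" "{0..1} \<subseteq> T"
  shows "continuous_on {0..1} (phase \<gamma>)"
  unfolding continuous_on_eq_continuous_within
  by (intro ballI has_vector_derivative_continuous[OF phase_derivative[OF assms]])

text \<open>The primitive in the homotopy formula: contraction with \<partial>t, weighted by the
  phase and integrated over time. It lowers the degree by one.\<close>

definition homotopy :: "(real \<Rightarrow> 'a) \<Rightarrow> ('a, 'e, complex) form \<Rightarrow> ('a, 'e, complex) form" where
  "homotopy \<gamma> f = mkform (\<lambda>c x v. integral {0..1} (\<lambda>t. phase \<gamma> t * pb f (tube \<gamma> c) (t, x) (lift v)))"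

lemma homotopy_smooth:
  assumes f: "f \<in> smooth_forms A (Suc q)" and \<gamma>: "param T \<gamma>" and T: "{0..1} \<subseteq> T"
  shows "homotopy \<gamma> f \<in> smooth_forms A q"
  unfolding homotopy_def
proof (rule mkform_smooth)
  fix U \<phi> assume U: "(U, \<phi>) \<in> A"
  note P = param_tube[OF \<gamma> U]
  have cont: "continuous_on {0..1} (\<lambda>t. phase \<gamma> t * pb f (tube \<gamma> (U, \<phi>)) (t, x) w)" if "x \<in> \<phi> ` U" for x w
    by (intro continuous_on_mult phase_continuous[OF \<gamma> T]
        continuous_on_compose2[OF smooth_onD(3)[OF pb_smooth[OF f P]]])
      (use T that in \<open>auto intro!: continuous_intros\<close>)
  show "alternating q (\<lambda>v. integral {0..1} (\<lambda>t. phase \<gamma> t * pb f (tube \<gamma> (U, \<phi>)) (t, x) (lift v)))"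
    if x: "x \<in> \<phi> ` U" for x
  proof (rule alternating_integral)
    show "alternating q (\<lambda>v. pb f (tube \<gamma> (U, \<phi>)) (t, x) (lift v))" if "t \<in> {0..1}" for t
      unfolding lift_def
      by (rule alternating_case_nat[OF pb_alternating[OF f P]]) (use T that x in \<open>auto intro!: linearI\<close>)
    show "(\<lambda>t. phase \<gamma> t * pb f (tube \<gamma> (U, \<phi>)) (t, x) (lift v)) integrable_on {0..1}" for v
      by (rule integrable_continuous_real[OF cont[OF x]])
  qed
  show "smooth_on (\<phi> ` U) (\<lambda>x. integral {0..1} (\<lambda>t. phase \<gamma> t * pb f (tube \<gamma> (U, \<phi>)) (t, x) (lift v)))" for v
    by (rule smooth_on_integral_param[OF frame bounded_bilinear_mult chart_facts(2)[OF U] _ pb_smooth[OF f P]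
          phase_continuous[OF \<gamma> T]]) (use T in auto)
  fix V \<psi> p v assume V: "(V, \<psi>) \<in> A" and p: "p \<in> U" "p \<in> V"
  let ?W = "\<phi> ` U \<inter> inv_into U \<phi> -` V" and ?D = "fd (\<psi> \<circ> inv_into U \<phi>) (\<phi> p)"
  have pW: "\<phi> p \<in> ?W" "\<phi> p \<in> \<phi> ` U" "inv_into U \<phi> (\<phi> p) = p" "inv_into U \<phi> (\<phi> p) \<in> V"
    using p chart_facts(5)[OF U] by auto
  have W: "open ?W" by (rule paramD(4)[OF param_chart[OF U] chart_facts(1)[OF V]])
  note D = param_has_derivative[OF param_chart[OF U] pW(2) V pW(4)]
  have "pb f (tube \<gamma> (U, \<phi>)) (t, \<phi> p) (lift v) = pb f (tube \<gamma> (V, \<psi>)) (t, \<psi> p) (lift (\<lambda>i. ?D (v i)))"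
    if t: "t \<in> T" for t
  proof -
    \<comment> \<open>The change of chart on the tube: time is kept, only the space coordinate
      changes.\<close>
    let ?h = "\<lambda>z. (fst z, (\<psi> \<circ> inv_into U \<phi>) (snd z))"
    have "pb f (tube \<gamma> (U, \<phi>)) (t, \<phi> p) (lift v) = pb f (\<lambda>z. tube \<gamma> (V, \<psi>) (?h z)) (t, \<phi> p) (lift v)"
      by (rule pb_cong[OF open_Times[OF paramD(1)[OF \<gamma>] W]])
        (use t pW in \<open>auto simp: tube_def chart_facts(5)[OF V]\<close>)
    also have "\<dots> = pb f (tube \<gamma> (V, \<psi>)) (?h (t, \<phi> p)) (\<lambda>i. (\<lambda>u. (fst u, ?D (snd u))) (lift v i))"
    proof (rule pb_compose[OF param_tube[OF \<gamma> V]])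
      show "?h (t, \<phi> p) \<in> T \<times> \<psi> ` V" using t p pW by auto
      have "((\<lambda>z. (\<psi> \<circ> inv_into U \<phi>) (snd z)) has_derivative (\<lambda>u. ?D (snd u))) (at (t, \<phi> p))"
        by (rule has_derivative_compose[where f = snd and f' = snd and g = "\<psi> \<circ> inv_into U \<phi>",
              OF bounded_linear_imp_has_derivative[OF bounded_linear_snd]])
          (simp only: snd_conv D)
      then show "(?h has_derivative (\<lambda>u. (fst u, ?D (snd u)))) (at (t, \<phi> p))"
        by (intro has_derivative_Pair bounded_linear_imp_has_derivative bounded_linear_fst)
    qed
    \<comment> \<open>As \<open>?D\<close> maps 0 to 0, \<partial>t is carried to itself and the
      change of coordinates passes through \<open>lift\<close>.\<close>
    also have "(\<lambda>i. (\<lambda>u. (fst u, ?D (snd u))) (lift v i)) = lift (\<lambda>i. ?D (v i))"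
      using linear_0[OF has_derivative_linear[OF D]] by (auto simp: lift_def fun_eq_iff split: nat.split)
    finally show ?thesis using pW(3) by simp
  qed
  then show "integral {0..1} (\<lambda>t. phase \<gamma> t * pb f (tube \<gamma> (U, \<phi>)) (t, \<phi> p) (lift v)) =
      integral {0..1} (\<lambda>t. phase \<gamma> t * pb f (tube \<gamma> (V, \<psi>)) (t, \<psi> p) (lift (\<lambda>i. ?D (v i))))"
    by (intro integral_cong) (use T in auto)
qed

text \<open>The time derivative of the phase times the pullback of f is integrated over
  \<open>{0..1}\<close> in two ways. The right side is written out in K rather than as a twisted
  derivative, so that degree 0, with an empty sum, is included.\<close>

lemma translate_difference:
  assumes f: "f \<in> cocycles q" and \<gamma>: "param T \<gamma>" and T: "{0..1} \<subseteq> T" and U: "(U, \<phi>) \<in> A" "p \<in> U"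
  defines "K \<equiv> \<lambda>x v. integral {0..1} (\<lambda>t. phase \<gamma> t * pb f (tube \<gamma> (U, \<phi>)) (t, x) (lift v))"
  shows "phase \<gamma> 1 * translate (\<gamma> 1) f (U, \<phi>) p v - translate (\<gamma> 0) f (U, \<phi>) p v =
    (\<Sum>i<q. (-1) ^ i *\<^sub>R (fd (\<lambda>x. K x (omit i v)) (\<phi> p) (v i) +
      \<i> * of_real (pb \<theta> (inv_into U \<phi>) (\<phi> p) (\<lambda>_. v i)) * K (\<phi> p) (omit i v)))"
proof -
  let ?x = "\<phi> p" and ?\<Psi> = "tube \<gamma> (U, \<phi>)"
  let ?th = "\<lambda>i. \<i> * of_real (pb \<theta> (inv_into U \<phi>) ?x (\<lambda>_. v i))"
  let ?g = "\<lambda>i t. fd (\<lambda>z. pb f ?\<Psi> z (lift (omit i v))) (t, ?x) (0, v i)"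
  let ?k = "\<lambda>i t. pb f ?\<Psi> (t, ?x) (lift (omit i v))"
  let ?F = "\<lambda>t. pb f ?\<Psi> (t, ?x) (\<lambda>i. (0, v i))"
  have fs: "f \<in> smooth_forms A q" using f by (simp add: cocycles_def)
  have x: "?x \<in> \<phi> ` U" using U by simp
  have in_S: "(t, ?x) \<in> T \<times> \<phi> ` U" if "t \<in> {0..1}" for t using that T x by auto
  note P = param_tube[OF \<gamma> U(1)]
  note sm = pb_smooth[OF fs P]
  have slice: "continuous_on {0..1} (\<lambda>t. H (t, ?x))" if "continuous_on (T \<times> \<phi> ` U) H" for H :: "real \<times> 'e \<Rightarrow> complex"
    by (rule continuous_on_compose2[OF that]) (use in_S in \<open>auto intro!: continuous_intros\<close>)
  have ph: "continuous_on {0..1} (phase \<gamma>)" by (rule phase_continuous[OF \<gamma> T])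
  have "(\<lambda>t. phase \<gamma> t * ?g i t) integrable_on {0..1}" "(\<lambda>t. phase \<gamma> t * ?k i t) integrable_on {0..1}" for i
    by (intro integrable_continuous_real continuous_on_mult ph slice smooth_onD(3) smooth_onD(2) sm)+
  then have "((\<lambda>t. \<Sum>i<q. (-1) ^ i *\<^sub>R (phase \<gamma> t * ?g i t + ?th i * (phase \<gamma> t * ?k i t))) has_integral
      (\<Sum>i<q. (-1) ^ i *\<^sub>R (integral {0..1} (\<lambda>t. phase \<gamma> t * ?g i t) + ?th i * integral {0..1} (\<lambda>t. phase \<gamma> t * ?k i t)))) {0..1}"
    by (intro has_integral_sum has_integral_cmul has_integral_add has_integral_mult_right integrable_integral) auto
  \<comment> \<open>The same integrand as a time derivative: differentiating the phase produces
    exactly the \<theta> term on the left of \<open>cocycle_time_derivative\<close>.\<close>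
  moreover have "((\<lambda>t. \<Sum>i<q. (-1) ^ i *\<^sub>R (phase \<gamma> t * ?g i t + ?th i * (phase \<gamma> t * ?k i t))) has_integral
      (phase \<gamma> 1 * ?F 1 - phase \<gamma> 0 * ?F 0)) {0..1}"
  proof (rule fundamental_theorem_of_calculus)
    fix t :: real assume t: "t \<in> {0..1}"
    have tT: "t \<in> T" using t T by auto
    have "((\<lambda>s. (s, ?x)) has_derivative (\<lambda>h. (h, 0))) (at t)" by (auto intro!: derivative_eq_intros)
    from has_derivative_compose[where g = "\<lambda>z. pb f ?\<Psi> z (\<lambda>i. (0, v i))", OF this smooth_onD(1)[OF sm in_S[OF t]]]
    have d: "(?F has_derivative (\<lambda>h. fd (\<lambda>z. pb f ?\<Psi> z (\<lambda>i. (0, v i))) (t, ?x) (h, 0))) (at t)" .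
    have e: "(\<lambda>h. fd (\<lambda>z. pb f ?\<Psi> z (\<lambda>i. (0, v i))) (t, ?x) (h, 0)) =
        (\<lambda>h. h *\<^sub>R fd (\<lambda>z. pb f ?\<Psi> z (\<lambda>i. (0, v i))) (t, ?x) (1, 0))"
    proof
      fix h
      show "fd (\<lambda>z. pb f ?\<Psi> z (\<lambda>i. (0, v i))) (t, ?x) (h, 0) =
          h *\<^sub>R fd (\<lambda>z. pb f ?\<Psi> z (\<lambda>i. (0, v i))) (t, ?x) (1, 0)"
        using linear_cmul[OF has_derivative_linear[OF smooth_onD(1)[OF sm in_S[OF t]]], of "\<lambda>i. (0, v i)" h "(1, 0)"]
        by simp
    qed
    from d have "(?F has_derivative (\<lambda>h. h *\<^sub>R fd (\<lambda>z. pb f ?\<Psi> z (\<lambda>i. (0, v i))) (t, ?x) (1, 0))) (at t)"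
      unfolding e .
    then have "(?F has_vector_derivative fd (\<lambda>z. pb f ?\<Psi> z (\<lambda>i. (0, v i))) (t, ?x) (1, 0)) (at t within {0..1})"
      unfolding has_vector_derivative_def by (rule has_derivative_at_withinI)
    from has_vector_derivative_mult[OF phase_derivative[OF \<gamma> T t] this]
    have "((\<lambda>t. phase \<gamma> t * ?F t) has_vector_derivative
        phase \<gamma> t * (fd (\<lambda>z. pb f ?\<Psi> z (\<lambda>i. (0, v i))) (t, ?x) (1, 0) + \<i> * of_real (pb \<theta> \<gamma> t (\<lambda>_. 1)) * ?F t))
        (at t within {0..1})"
      by (simp add: algebra_simps)
    then show "((\<lambda>t. phase \<gamma> t * ?F t) has_vector_derivative
        (\<Sum>i<q. (-1) ^ i *\<^sub>R (phase \<gamma> t * ?g i t + ?th i * (phase \<gamma> t * ?k i t)))) (at t within {0..1})"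
      unfolding cocycle_time_derivative[OF f \<gamma> tT U(1) x]
      by (simp add: sum_distrib_left distrib_left mult.left_commute)
  qed simp
  ultimately have main: "phase \<gamma> 1 * ?F 1 - phase \<gamma> 0 * ?F 0 =
      (\<Sum>i<q. (-1) ^ i *\<^sub>R (integral {0..1} (\<lambda>t. phase \<gamma> t * ?g i t) + ?th i * integral {0..1} (\<lambda>t. phase \<gamma> t * ?k i t)))"
    by (rule has_integral_unique[rotated])
  \<comment> \<open>Differentiation under the integral turns the integrated space derivatives into
    derivatives of K.\<close>
  have "fd (\<lambda>x. K x (omit i v)) ?x (v i) = integral {0..1} (\<lambda>t. phase \<gamma> t * ?g i t)" for i
  proof -
    have "Ck_on (Suc 0) (T \<times> \<phi> ` U) (\<lambda>z. pb f ?\<Psi> z (lift (omit i v)))"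
      using sm unfolding smooth_on_def by blast
    note d = fd_eq[OF has_derivative_integral_param[OF frame bounded_bilinear_mult chart_facts(2)[OF U(1)] x _ this ph]]
    show ?thesis unfolding K_def by (subst d) (use T in auto)
  qed
  moreover have "translate (\<gamma> t) f (U, \<phi>) p v = ?F t" if "t \<in> T" for t
    using U pb_tube_space[OF \<gamma> that U(1) x, of f v] by (simp add: translate_def mkform_def)
  ultimately show ?thesis using main T by (simp add: K_def phase_def subset_iff)
qed

lemma homotopy_formula:
  assumes f: "f \<in> cocycles q" and \<gamma>: "param T \<gamma>" and T: "{0..1} \<subseteq> T"
  shows "(\<lambda>c p v. phase \<gamma> 1 * translate (\<gamma> 1) f c p v - translate (\<gamma> 0) f c p v) \<in> coboundaries q"
proof -
  have fs: "f \<in> smooth_forms A q" using f by (simp add: cocycles_def)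
  have out: "translate g f c p v = 0" if "\<not> (c \<in> A \<and> p \<in> fst c)" for g c p v
    using smooth_formsD(1)[OF translate_smooth[OF fs] that] .
  let ?d = "\<lambda>c p v. phase \<gamma> 1 * translate (\<gamma> 1) f c p v - translate (\<gamma> 0) f c p v"
  show ?thesis
  proof (cases q)
    \<comment> \<open>In degree 0 only the zero form is a coboundary; the empty sum makes the
      difference vanish outright.\<close>
    case 0
    have "?d c p v = 0" for c p v
    proof (cases "c \<in> A \<and> p \<in> fst c")
      case True
      then show ?thesis using translate_difference[OF f \<gamma> T, of "fst c" "snd c" p v] 0 by simp
    qed (simp add: out)
    then show ?thesis using 0 by (simp add: coboundaries_def fun_eq_iff)
  next
    case (Suc r)
    note hs = homotopy_smooth[OF fs[unfolded Suc] \<gamma> T]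
    have "?d c p v = tw r (homotopy \<gamma> f) c p v" for c p v
    proof (cases "c \<in> A \<and> p \<in> fst c")
      case True
      then obtain U \<phi> where c: "c = (U, \<phi>)" and U: "(U, \<phi>) \<in> A" "p \<in> U" by (cases c) auto
      let ?K = "\<lambda>x v. integral {0..1} (\<lambda>t. phase \<gamma> t * pb f (tube \<gamma> (U, \<phi>)) (t, x) (lift v))"
      have K: "pb (homotopy \<gamma> f) (inv_into U \<phi>) x w = ?K x w" if "x \<in> \<phi> ` U" for x w
        using pb_chart_self[OF smooth_formsD(3)[OF hs] U(1) that] chart_facts(6,7)[OF U(1) that] U(1)
        by (simp add: homotopy_def mkform_def)
      have p: "\<phi> p \<in> \<phi> ` U" using U by simp
      have "fd (\<lambda>x. pb (homotopy \<gamma> f) (inv_into U \<phi>) x w) (\<phi> p) = fd (\<lambda>x. ?K x w) (\<phi> p)" for w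
        by (rule fd_cong[OF chart_facts(2)[OF U(1)] p K])
      then show ?thesis
        unfolding c translate_difference[OF f \<gamma> T U] tw_chart[OF hs U] K[OF p] Suc
        by (simp only: lessThan_Suc_atMost)
    qed (simp add: out tw_outside[OF hs])
    then have "?d = tw r (homotopy \<gamma> f)" by (simp add: fun_eq_iff)
    then show ?thesis unfolding coboundaries_def Suc using hs by simp
  qed
qed

end

subsection \<open>The phase as a function on the group\<close>

context twisted_lie_group
begin

lemma tw_linear:
  assumes "f \<in> smooth_forms A q" "g \<in> smooth_forms A q"
  shows "(\<lambda>c p v. a * f c p v + b * g c p v) \<in> smooth_forms A q"
    "tw q (\<lambda>c p v. a * f c p v + b * g c p v) = (\<lambda>c p v. a * tw q f c p v + b * tw q g c p v)"
proof -
  note f = smooth_forms_linear[OF assms(1) bounded_linear_mult_right[of a]]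
  note g = smooth_forms_linear[OF assms(2) bounded_linear_mult_right[of b]]
  show "(\<lambda>c p v. a * f c p v + b * g c p v) \<in> smooth_forms A q"
    by (rule smooth_forms_add(1)[OF f(1) g(1)])
  have "wedge_one q \<theta> (\<lambda>c p v. a * f c p v + b * g c p v) c p v =
      a * wedge_one q \<theta> f c p v + b * wedge_one q \<theta> g c p v" for c p v
    unfolding wedge_one_def by (simp add: scaleR_add_right sum.distrib sum_distrib_left)
  then show "tw q (\<lambda>c p v. a * f c p v + b * g c p v) = (\<lambda>c p v. a * tw q f c p v + b * tw q g c p v)"
    unfolding tw_def smooth_forms_add(2)[OF f(1) g(1)] f(2) g(2) by (simp add: fun_eq_iff algebra_simps)
qed

lemma cocycles_linear:
  "f \<in> cocycles q \<Longrightarrow> g \<in> cocycles q \<Longrightarrow> (\<lambda>c p v. a * f c p v + b * g c p v) \<in> cocycles q"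
  unfolding cocycles_def using tw_linear[of f q g a b] by simp

lemma coboundaries_linear:
  assumes "f \<in> coboundaries q" "g \<in> coboundaries q"
  shows "(\<lambda>c p v. a * f c p v + b * g c p v) \<in> coboundaries q"
proof (cases "q = 0")
  case True
  then show ?thesis using assms by (simp add: coboundaries_def)
next
  case False
  then obtain h k where "h \<in> smooth_forms A (q - 1)" "k \<in> smooth_forms A (q - 1)" "f = tw (q - 1) h" "g = tw (q - 1) k"
    using assms by (auto simp: coboundaries_def)
  then show ?thesis using tw_linear[of h "q - 1" k a b] False unfolding coboundaries_def
    by (auto intro!: image_eqI[of _ _ "\<lambda>c p v. a * h c p v + b * k c p v"])
qed

lemma zero_cocycle: "(\<lambda>c p v. 0) \<in> cocycles q"
  unfolding cocycles_def by (simp add: smooth_forms_zero tw_def wedge_one_def)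

text \<open>A relation between g and its phase c, because c is determined by g only when some
  cocycle is not a coboundary.\<close>

definition acts_trivially :: "nat \<Rightarrow> 'a \<Rightarrow> complex \<Rightarrow> bool" where
  "acts_trivially q g c \<longleftrightarrow>
    (\<forall>f\<in>cocycles q. (\<lambda>ch p v. c * translate g f ch p v - f ch p v) \<in> coboundaries q)"

lemma acts_trivially_one: "acts_trivially q one 1"
  unfolding acts_trivially_def
proof
  fix f assume "f \<in> cocycles q"
  then have "translate one f = f" using translate_one by (auto simp: cocycles_def)
  moreover have "(\<lambda>c p v. 0) \<in> coboundaries q"
  proof (cases "q = 0")
    case False
    have "tw (q - 1) (\<lambda>c p v. 0) = (\<lambda>c p v. 0)" using zero_cocycle[of "q - 1"] by (simp add: cocycles_def)
    then show ?thesis using False smooth_forms_zero(1) unfolding coboundaries_def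
      by (auto intro!: image_eqI[of _ _ "\<lambda>c p v. 0"])
  qed (simp add: coboundaries_def)
  ultimately show "(\<lambda>ch p v. 1 * translate one f ch p v - f ch p v) \<in> coboundaries q" by simp
qed

text \<open>Telescoping: c times the homotopy formula along \<gamma>, plus the hypothesis at
  \<open>\<gamma> 0\<close>; the terms with \<open>translate (\<gamma> 0) f\<close> cancel.\<close>

lemma acts_trivially_curve:
  assumes \<gamma>: "param T \<gamma>" "{0..1} \<subseteq> T" and "acts_trivially q (\<gamma> 0) c"
  shows "acts_trivially q (\<gamma> 1) (c * phase \<gamma> 1)"
  unfolding acts_trivially_def
proof
  fix f assume f: "f \<in> cocycles q"
  have "(\<lambda>ch p v. c * (phase \<gamma> 1 * translate (\<gamma> 1) f ch p v - translate (\<gamma> 0) f ch p v) +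
      1 * (c * translate (\<gamma> 0) f ch p v - f ch p v)) \<in> coboundaries q"
    by (rule coboundaries_linear[OF homotopy_formula[OF f \<gamma>]]) (use assms(3) f in \<open>simp add: acts_trivially_def\<close>)
  then show "(\<lambda>ch p v. c * phase \<gamma> 1 * translate (\<gamma> 1) f ch p v - f ch p v) \<in> coboundaries q"
    by (simp add: algebra_simps)
qed

lemma acts_trivially_unique:
  assumes "acts_trivially q g c" "acts_trivially q g c'" "c \<noteq> c'"
  shows "cocycles q \<subseteq> coboundaries q"
proof
  fix f assume f: "f \<in> cocycles q"
  \<comment> \<open>As f is the translate of \<open>?h\<close> by g, the two phases make
    \<open>c f - ?h\<close> and \<open>c' f - ?h\<close> coboundaries, and their difference is
    \<open>(c - c') f\<close>.\<close>
  let ?h = "translate (iv g) f"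
  have h: "?h \<in> cocycles q" by (rule translate_cocycle[OF f])
  have "translate g ?h = f"
    unfolding translate_translate using translate_one f by (auto simp: cocycles_def)
  then have "(\<lambda>ch p v. c * f ch p v - ?h ch p v) \<in> coboundaries q" "(\<lambda>ch p v. c' * f ch p v - ?h ch p v) \<in> coboundaries q"
    using assms(1,2) h unfolding acts_trivially_def by force+
  from coboundaries_linear[OF this, of "1 / (c - c')" "- 1 / (c - c')"]
  have "(\<lambda>ch p v. 1 / (c - c') * (c * f ch p v - ?h ch p v) + - 1 / (c - c') * (c' * f ch p v - ?h ch p v)) \<in> coboundaries q" .
  moreover have "1 / (c - c') * (c * x - y) + - 1 / (c - c') * (c' * x - y) = x" for x y
  proof -
    have "1 / (c - c') * (c * x - y) + - 1 / (c - c') * (c' * x - y) = (c * x - y - (c' * x - y)) / (c - c')"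
      by (simp add: diff_divide_distrib)
    also have "c * x - y - (c' * x - y) = (c - c') * x" by (simp add: algebra_simps)
    finally show ?thesis using assms(3) by simp
  qed
  ultimately show "f \<in> coboundaries q" by simp
qed

section \<open>Line integrals of \<theta> over straight segments in a chart\<close>

definition segment_integral :: "('a, 'e) chart \<Rightarrow> 'e \<Rightarrow> 'e \<Rightarrow> real" where
  "segment_integral c a b = integral {0..1} (\<lambda>t. pb \<theta> (inv_into (fst c) (snd c)) (a + t *\<^sub>R (b - a)) (\<lambda>_. b - a))"

lemma acts_trivially_segment:
  assumes U: "(U, \<phi>) \<in> A" and S: "S \<subseteq> \<phi> ` U" "convex S" "a \<in> S" "b \<in> S"
    and "acts_trivially q (inv_into U \<phi> a) c"
  shows "acts_trivially q (inv_into U \<phi> b) (c * exp (\<i> * of_real (segment_integral (U, \<phi>) a b)))"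
proof -
  let ?l = "\<lambda>t. a + t *\<^sub>R (b - a)"
  \<comment> \<open>A parametrisation needs an open domain, so the segment is prolonged to all times
    at which the line is still in the chart.\<close>
  let ?T = "?l -` (\<phi> ` U)" and ?\<gamma> = "\<lambda>t. inv_into U \<phi> (?l t)"
  have oT: "open ?T" by (rule open_vimage[OF chart_facts(2)[OF U]]) (intro continuous_intros)
  have \<gamma>: "param ?T ?\<gamma>"
    by (rule param_compose[OF frame param_chart[OF U] oT smooth_on_affine[OF oT]]) auto
  have lS: "?l t \<in> S" if "t \<in> {0..1}" for t
  proof -
    have "?l t = (1 - t) *\<^sub>R a + t *\<^sub>R b" by (simp add: algebra_simps)
    then show ?thesis using convexD_alt[OF S(2,3,4)] that by simp
  qed
  have T: "{0..1} \<subseteq> ?T" by (intro subsetI vimageI2 subsetD[OF S(1)] lS)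
  have "pb \<theta> ?\<gamma> t (\<lambda>_. 1) = pb \<theta> (inv_into U \<phi>) (?l t) (\<lambda>_. b - a)" if "t \<in> ?T" for t
  proof -
    have "(?l has_derivative (\<lambda>h. h *\<^sub>R (b - a))) (at t)" by (auto intro!: derivative_eq_intros)
    from pb_compose[OF param_chart[OF U] _ this, of \<theta> "\<lambda>_. 1"] show ?thesis using that by simp
  qed
  then have "phase ?\<gamma> 1 = exp (\<i> * of_real (segment_integral (U, \<phi>) a b))"
    unfolding phase_def segment_integral_def using T by (intro arg_cong[where f = exp] arg_cong2[where f = "(*)"] refl
        arg_cong[where f = of_real] integral_cong) auto
  then show ?thesis using acts_trivially_curve[OF \<gamma> T, of q c] assms(6) by simp
qed

lemma ball_neighbourhood:
  assumes U: "(U, \<phi>) \<in> A" "p \<in> U"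
  obtains r where "r > 0" "ball (\<phi> p) r \<subseteq> \<phi> ` U" "open (U \<inter> \<phi> -` ball (\<phi> p) r)"
proof -
  obtain r where r: "r > 0" "ball (\<phi> p) r \<subseteq> \<phi> ` U"
    using openE[OF chart_facts(2)[OF U(1)], of "\<phi> p"] U(2) by blast
  show ?thesis
    by (rule that[OF r continuous_open_preimage[OF chart_facts(3,1)[OF U(1)] open_ball]])
qed

text \<open>Instead of joining the unit to g by a smooth path, connectedness is used directly:
  having a nonzero phase is a locally constant property, and the unit has phase 1.\<close>

lemma acts_trivially_exists: "\<exists>c. c \<noteq> 0 \<and> acts_trivially q g c"
proof -
  define P where "P = (\<lambda>g. \<exists>c. c \<noteq> 0 \<and> acts_trivially q g c)"
  have "P g = P one"
  proof (rule connected_local_const[OF connected])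
    show "\<forall>p\<in>UNIV. eventually (\<lambda>b. P p = P b) (at p within UNIV)"
    proof
      fix p
      obtain U \<phi> where U: "(U, \<phi>) \<in> A" "p \<in> U" by (rule obtain_chart)
      obtain r where r: "r > 0" "ball (\<phi> p) r \<subseteq> \<phi> ` U" "open (U \<inter> \<phi> -` ball (\<phi> p) r)"
        by (rule ball_neighbourhood[OF U])
      have tr: "P (inv_into U \<phi> b)" if ab: "a \<in> ball (\<phi> p) r" "b \<in> ball (\<phi> p) r" "P (inv_into U \<phi> a)" for a b
      proof -
        obtain c where "c \<noteq> 0" "acts_trivially q (inv_into U \<phi> a) c" using ab(3) unfolding P_def by blast
        then show ?thesis using acts_trivially_segment[OF U(1) r(2) convex_ball ab(1,2)] unfolding P_def
          by (intro exI[of _ "c * exp (\<i> * of_real (segment_integral (U, \<phi>) a b))"]) simp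
      qed
      \<comment> \<open>Segments are used in both directions, as local constancy needs an
        equivalence.\<close>
      have "P p = P b" if "b \<in> U \<inter> \<phi> -` ball (\<phi> p) r" for b
        using tr[of "\<phi> p" "\<phi> b"] tr[of "\<phi> b" "\<phi> p"] that r(1) chart_facts(5)[OF U(1)] U(2) by auto
      then show "eventually (\<lambda>b. P p = P b) (at p within UNIV)"
        unfolding eventually_at_topological using r U(2) by (intro exI[of _ "U \<inter> \<phi> -` ball (\<phi> p) r"]) simp
    qed
  qed auto
  moreover have "P one" unfolding P_def using acts_trivially_one by (intro exI[of _ 1]) simp
  ultimately show ?thesis unfolding P_def by simp
qed

text \<open>The derivative is taken at the starting point of the segments. There the integrand
  differs from \<open>\<tau> a (b - a)\<close> by at most \<mu> on the segment times
  \<open>norm (b - a)\<close>, and \<mu> tends to 0.\<close>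

lemma segment_integral_derivative:
  assumes U: "(U, \<phi>) \<in> A" and a: "a \<in> \<phi> ` U"
  shows "(segment_integral (U, \<phi>) a has_derivative (\<lambda>h. pb \<theta> (inv_into U \<phi>) a (\<lambda>_. h))) (at a)"
proof -
  define \<tau> where "\<tau> = (\<lambda>x h. pb \<theta> (inv_into U \<phi>) x (\<lambda>_. h))"
  have lin: "linear (\<tau> x)" if x: "x \<in> \<phi> ` U" for x
  proof -
    have ml: "multilinear 1 (pb \<theta> (inv_into U \<phi>) x)"
      using pb_alternating[OF \<theta>_smooth param_chart[OF U] x] unfolding alternating_def by blast
    have "linear (\<lambda>h. pb \<theta> (inv_into U \<phi>) x ((\<lambda>_. 0)(0 := h)))" by (rule multilinear_linear[OF ml]) simp
    moreover have "pb \<theta> (inv_into U \<phi>) x ((\<lambda>_. 0)(0 := h)) = \<tau> x h" for h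
      unfolding \<tau>_def by (rule multilinear_cong[OF ml]) simp
    ultimately show ?thesis by simp
  qed
  have cont: "continuous_on (\<phi> ` U) (\<lambda>x. \<tau> x h)" for h
    unfolding \<tau>_def by (rule smooth_onD(3)[OF pb_smooth[OF \<theta>_smooth param_chart[OF U]]])
  \<comment> \<open>A bound for the operator norm of \<open>\<tau> x - \<tau> a\<close>, from the
    frame and Cauchy-Schwarz; a finite sum, so its continuity is evident.\<close>
  define \<mu> where "\<mu> = (\<lambda>x. \<Sum>b\<in>B. norm b * \<bar>\<tau> x b - \<tau> a b\<bar>)"
  have \<mu>: "\<bar>\<tau> x h - \<tau> a h\<bar> \<le> \<mu> x * norm h" if x: "x \<in> \<phi> ` U" for x h
  proof -
    have "\<tau> x h - \<tau> a h = (\<Sum>b\<in>B. (h \<bullet> b) * (\<tau> x b - \<tau> a b))"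
      using linear_frame[OF frame lin[OF x], of h] linear_frame[OF frame lin[OF a], of h]
      by (simp add: right_diff_distrib sum_subtractf)
    also have "\<bar>\<dots>\<bar> \<le> (\<Sum>b\<in>B. \<bar>(h \<bullet> b) * (\<tau> x b - \<tau> a b)\<bar>)" by (rule sum_abs)
    also have "\<dots> \<le> (\<Sum>b\<in>B. norm b * \<bar>\<tau> x b - \<tau> a b\<bar> * norm h)"
    proof (rule sum_mono)
      fix b
      have "\<bar>h \<bullet> b\<bar> * \<bar>\<tau> x b - \<tau> a b\<bar> \<le> (norm h * norm b) * \<bar>\<tau> x b - \<tau> a b\<bar>"
        by (rule mult_right_mono[OF Cauchy_Schwarz_ineq2]) simp
      then show "\<bar>(h \<bullet> b) * (\<tau> x b - \<tau> a b)\<bar> \<le> norm b * \<bar>\<tau> x b - \<tau> a b\<bar> * norm h"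
        by (simp add: abs_mult mult_ac)
    qed
    finally show ?thesis by (simp add: \<mu>_def sum_distrib_right)
  qed
  have "continuous_on (\<phi> ` U) \<mu>" unfolding \<mu>_def by (intro continuous_intros cont)
  then have \<mu>0: "isCont \<mu> a" using a unfolding continuous_on_eq_continuous_at[OF chart_facts(2)[OF U]] by (rule bspec)
  have segment_integral: "segment_integral (U, \<phi>) a b = integral {0..1} (\<lambda>t. \<tau> (a + t *\<^sub>R (b - a)) (b - a))" for b
    by (simp add: segment_integral_def \<tau>_def)
  have "segment_integral (U, \<phi>) a a = 0" using linear_0[OF lin[OF a]] by (simp add: segment_integral)
  moreover have "\<exists>d>0. \<forall>b. norm (b - a) < d \<longrightarrow> norm (segment_integral (U, \<phi>) a b - \<tau> a (b - a)) \<le> e * norm (b - a)"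
    if e: "e > 0" for e
  proof -
    obtain d1 where d1: "d1 > 0" "\<And>x. dist x a < d1 \<Longrightarrow> dist (\<mu> x) (\<mu> a) < e"
      using \<mu>0 e unfolding continuous_at_eps_delta by blast
    obtain d2 where d2: "d2 > 0" "ball a d2 \<subseteq> \<phi> ` U" using openE[OF chart_facts(2)[OF U] a] by blast
    \<comment> \<open>Since \<open>\<mu> a = 0\<close>, being close to \<open>\<mu> a\<close> means
      being small.\<close>
    have \<mu>e: "\<mu> x < e" if "dist x a < d1" for x
      using d1(2)[OF that] by (simp add: dist_real_def) (simp add: \<mu>_def)
    have "norm (segment_integral (U, \<phi>) a b - \<tau> a (b - a)) \<le> e * norm (b - a)" if b: "norm (b - a) < min d1 d2" for b
    proof -
      let ?l = "\<lambda>t. a + t *\<^sub>R (b - a)"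
      have l: "dist (?l t) a < min d1 d2" if "t \<in> {0..1}" for t
      proof -
        have "t * norm (b - a) \<le> norm (b - a)" by (rule mult_left_le_one_le) (use that in auto)
        then show ?thesis using b that by (simp add: dist_norm)
      qed
      have lU: "?l t \<in> \<phi> ` U" if "t \<in> {0..1}" for t
        using l[OF that] by (intro subsetD[OF d2(2)]) (simp add: dist_commute)
      have c1: "continuous_on {0..1} (\<lambda>t. \<tau> (?l t) (b - a))"
        by (rule continuous_on_compose2[OF cont]) (use lU in \<open>auto intro!: continuous_intros\<close>)
      have "segment_integral (U, \<phi>) a b - \<tau> a (b - a) = integral {0..1} (\<lambda>t. \<tau> (?l t) (b - a) - \<tau> a (b - a))"
        unfolding segment_integral by (subst integral_diff) (use integrable_continuous_real[OF c1] in auto)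
      also have "norm \<dots> \<le> (e * norm (b - a)) * (1 - 0)"
      proof (rule integral_bound)
        show "continuous_on {0..1} (\<lambda>t. \<tau> (?l t) (b - a) - \<tau> a (b - a))"
          by (intro continuous_on_diff c1 continuous_on_const)
        fix t :: real assume t: "t \<in> {0..1}"
        have "\<bar>\<tau> (?l t) (b - a) - \<tau> a (b - a)\<bar> \<le> \<mu> (?l t) * norm (b - a)" by (rule \<mu>[OF lU[OF t]])
        also have "\<dots> \<le> e * norm (b - a)" using \<mu>e[of "?l t"] l[OF t] by (intro mult_right_mono) auto
        finally show "norm (\<tau> (?l t) (b - a) - \<tau> a (b - a)) \<le> e * norm (b - a)" by simp
      qed simp
      finally show ?thesis by simp
    qed
    then show ?thesis using d1(1) d2(1) by (intro exI[of _ "min d1 d2"]) simp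
  qed
  ultimately have "(segment_integral (U, \<phi>) a has_derivative \<tau> a) (at a)"
    unfolding has_derivative_within_alt using bounded_linear_frame[OF frame lin[OF a]] by simp
  then show ?thesis by (simp add: \<tau>_def)
qed

text \<open>
  If some cocycle is not a coboundary, then the phase \<open>c\<close> is a function of \<open>g\<close>, and
  its inverse is a nowhere vanishing section annihilated by the twisted derivative.
\<close>

lemma nonvanishing_section:
  assumes "\<not> cocycles q \<subseteq> coboundaries q"
  shows "\<exists>f. smooth_map A {(UNIV, id)} f \<and> (\<forall>x. f x \<noteq> 0) \<and> tw 0 (zero_form A f) = (\<lambda>c p v. 0)"
proof -
  have "\<forall>g. \<exists>c. c \<noteq> 0 \<and> acts_trivially q g c" using acts_trivially_exists by blast
  then obtain k where k: "\<And>g. k g \<noteq> 0" "\<And>g. acts_trivially q g (k g)" by metis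
  define f where "f = (\<lambda>g. inverse (k g))"
  \<comment> \<open>The function k was only chosen pointwise. Uniqueness of the phase forces it to
    agree with the value transported along the segment.\<close>
  have f_seg: "f (inv_into U \<phi> b) = f (inv_into U \<phi> a) * exp (- \<i> * of_real (segment_integral (U, \<phi>) a b))"
    if U: "(U, \<phi>) \<in> A" "S \<subseteq> \<phi> ` U" "convex S" "a \<in> S" "b \<in> S" for U \<phi> S a b
  proof -
    have "k (inv_into U \<phi> b) = k (inv_into U \<phi> a) * exp (\<i> * of_real (segment_integral (U, \<phi>) a b))"
      using acts_trivially_unique acts_trivially_segment[OF U k(2)] k(2) assms by blast
    then show ?thesis by (simp add: f_def exp_minus)
  qed
  \<comment> \<open>For each a the segments starting at a are used, so the derivative of the line
    integral at its base point is enough. The minus sign comes from passing to the inverse of the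
    phase.\<close>
  have f_deriv: "((\<lambda>x. f (inv_into U \<phi> x)) has_derivative
      (\<lambda>h. - \<i> * of_real (pb \<theta> (inv_into U \<phi>) a (\<lambda>_. h)) * f (inv_into U \<phi> a))) (at a)"
    if U: "(U, \<phi>) \<in> A" and a: "a \<in> \<phi> ` U" for U \<phi> a
  proof -
    obtain r where r: "r > 0" "ball a r \<subseteq> \<phi> ` U" using openE[OF chart_facts(2)[OF U] a] by blast
    have s0: "segment_integral (U, \<phi>) a a = 0"
    proof -
      have ml: "multilinear 1 (pb \<theta> (inv_into U \<phi>) a)"
        using pb_alternating[OF \<theta>_smooth param_chart[OF U] a] unfolding alternating_def by blast
      have "pb \<theta> (inv_into U \<phi>) a ((\<lambda>_. 0)(0 := 0)) = 0"
        using linear_0[OF multilinear_linear[OF ml, of 0 "\<lambda>_. 0"]] by simp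
      then show ?thesis by (simp add: segment_integral_def fun_upd_idem)
    qed
    have "((\<lambda>x. - \<i> * complex_of_real (segment_integral (U, \<phi>) a x)) has_derivative
        (\<lambda>h. - \<i> * of_real (pb \<theta> (inv_into U \<phi>) a (\<lambda>_. h)))) (at a)"
      by (intro bounded_linear.has_derivative[OF bounded_linear_mult_right]
          bounded_linear.has_derivative[OF bounded_linear_of_real] segment_integral_derivative[OF U a])
    from has_derivative_compose[OF this DERIV_exp[unfolded has_field_derivative_def]]
    have "((\<lambda>x. f (inv_into U \<phi> a) * exp (- \<i> * complex_of_real (segment_integral (U, \<phi>) a x))) has_derivative
        (\<lambda>h. f (inv_into U \<phi> a) * (exp (- \<i> * complex_of_real (segment_integral (U, \<phi>) a a)) *
          (- \<i> * of_real (pb \<theta> (inv_into U \<phi>) a (\<lambda>_. h)))))) (at a)"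
      by (rule has_derivative_mult_right)
    then have "((\<lambda>x. f (inv_into U \<phi> a) * exp (- \<i> * complex_of_real (segment_integral (U, \<phi>) a x))) has_derivative
        (\<lambda>h. - \<i> * of_real (pb \<theta> (inv_into U \<phi>) a (\<lambda>_. h)) * f (inv_into U \<phi> a))) (at a)"
      by (simp add: s0 mult_ac)
    then show ?thesis
    proof (rule has_derivative_transform_within_open[OF _ open_ball[of a r]])
      show "f (inv_into U \<phi> a) * exp (- \<i> * complex_of_real (segment_integral (U, \<phi>) a x)) = f (inv_into U \<phi> x)"
        if "x \<in> ball a r" for x
        by (rule f_seg[OF U r(2) convex_ball, symmetric]) (use r that in auto)
    qed (use r in simp)
  qed
  \<comment> \<open>Bootstrapping: the derivative of f is a smooth coefficient of \<theta> times f,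
    so order k for f gives order k + 1.\<close>
  have f_smooth: "smooth_on (\<phi> ` U) (\<lambda>x. f (inv_into U \<phi> x))" if U: "(U, \<phi>) \<in> A" for U \<phi>
    unfolding smooth_on_def
  proof
    fix k
    show "Ck_on k (\<phi> ` U) (\<lambda>x. f (inv_into U \<phi> x))"
    proof (induction k)
      case 0
      have "isCont (\<lambda>x. f (inv_into U \<phi> x)) a" if "a \<in> \<phi> ` U" for a
        by (rule has_derivative_continuous[OF f_deriv[OF U that]])
      then show ?case by (simp add: continuous_at_imp_continuous_on)
    next
      case (Suc k)
      have t: "Ck_on k (\<phi> ` U) (\<lambda>x. pb \<theta> (inv_into U \<phi>) x w)" for w
        using pb_smooth[OF \<theta>_smooth param_chart[OF U]] unfolding smooth_on_def by blast
      show ?case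
        by (intro Ck_on_SucI[OF chart_facts(2)[OF U] f_deriv[OF U]] Ck_on_bilinear[OF bounded_bilinear_mult]
            chart_facts(2)[OF U] Suc.IH Ck_on_const Ck_on_linear[OF bounded_linear_of_real] t)
    qed
  qed
  have "continuous_on UNIV f"
  proof (rule continuous_at_imp_continuous_on, rule)
    fix p
    obtain U \<phi> where U: "(U, \<phi>) \<in> A" "p \<in> U" by (rule obtain_chart)
    have "continuous_on U (\<lambda>p. f (inv_into U \<phi> (\<phi> p)))"
      by (rule continuous_on_compose2[OF smooth_onD(3)[OF f_smooth[OF U(1)]] chart_facts(3)[OF U(1)]]) simp
    then have "continuous_on U f"
      by (rule continuous_on_eq) (simp add: chart_facts(5)[OF U(1)])
    then show "isCont f p" using U(2) chart_facts(1)[OF U(1)] by (simp add: continuous_on_eq_continuous_at)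
  qed
  then have "smooth_map A {(UNIV, id)} f"
    unfolding smooth_map_def using f_smooth by (auto simp: o_def)
  \<comment> \<open>The derivative contributes \<open>- i \<theta> f\<close>, the wedge term
    \<open>i \<theta> f\<close>.\<close>
  moreover have "tw 0 (zero_form A f) c p v = 0" for c p v
  proof (cases "c \<in> A \<and> p \<in> fst c")
    case True
    then obtain U \<phi> where c: "c = (U, \<phi>)" and U: "(U, \<phi>) \<in> A" "p \<in> U" by (cases c) auto
    have p: "\<phi> p \<in> \<phi> ` U" "inv_into U \<phi> (\<phi> p) = p" using U chart_facts(5)[OF U(1)] by auto
    have "fd (\<lambda>x. zero_form A f (U, \<phi>) (inv_into U \<phi> x) w) (\<phi> p) = fd (\<lambda>x. f (inv_into U \<phi> x)) (\<phi> p)" for w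
      by (rule fd_cong[OF chart_facts(2)[OF U(1)] p(1)])
        (use U(1) chart_facts(7)[OF U(1)] in \<open>simp add: zero_form_def\<close>)
    also have "\<dots> = (\<lambda>h. - \<i> * of_real (\<theta> (U, \<phi>) p (\<lambda>_. h)) * f p)"
      using fd_eq[OF f_deriv[OF U(1) p(1)]] pb_chart_self[OF smooth_formsD(3)[OF \<theta>_smooth] U(1) p(1)]
      unfolding p(2) by simp
    finally show ?thesis
      using U by (simp add: c tw_def ext_deriv_def wedge_one_def zero_form_def scaleR_conv_of_real)
  qed (cases c; auto simp: tw_def ext_deriv_def wedge_one_def zero_form_def)
  moreover have "\<forall>x. f x \<noteq> 0" using k(1) by (simp add: f_def)
  ultimately show ?thesis by (intro exI[of _ f]) (simp add: fun_eq_iff)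
qed

end

section \<open>Passage from the forms \<omega> and the vector \<xi> to the single form
  \<theta>\<close>

theorem theorem7p4:
  fixes gmul :: "'a::{t2_space, second_countable_topology} \<Rightarrow> 'a \<Rightarrow> 'a"
    and one :: 'a and iv :: "'a \<Rightarrow> 'a"
    and A :: "('a, 'e::{real_inner, banach, heine_borel}) chart set"
    and n m :: nat
    and \<omega> :: "nat \<Rightarrow> ('a, 'e, real) form"
  assumes "lie_group gmul one iv A n"
    and "compact (UNIV :: 'a set)"
    and "connected (UNIV :: 'a set)"
    and "\<forall>k\<in>{1..m}. \<omega> k \<in> smooth_forms A 1"
    and "\<forall>k\<in>{1..m}. closed_form A 1 (\<omega> k)"
    and "\<forall>k\<in>{1..m}. left_invariant gmul A (\<omega> k)"
  shows "\<forall>q\<in>{0..n}. \<forall>\<xi>\<in>({1..m} \<rightarrow>\<^sub>E UNIV) - Gamma_group A m \<omega>.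
           twisted_cohomology A m \<omega> \<xi> q = {cohomology_class A m \<omega> \<xi> q 0}"
proof (intro ballI)
  fix q \<xi> assume \<xi>: "\<xi> \<in> ({1..m} \<rightarrow>\<^sub>E UNIV) - Gamma_group A m \<omega>"
  interpret L: lie_group gmul one iv A n by (rule assms(1))
  \<comment> \<open>The spanning set provided by the model space need not be orthonormal, so it is
    replaced by a frame.\<close>
  obtain B0 :: "'e set" where "finite B0" "span B0 = UNIV" using L.model_dim by blast
  then obtain B :: "'e set" where B: "frame B" using frame_exists by blast
  interpret F: framed_lie_group gmul one iv A n B
    by unfold_locales (rule L.atlas, rule B)
  define \<theta> :: "('a, 'e, real) form" where "\<theta> = (\<lambda>c p v. \<Sum>k=1..m. of_int (\<xi> k) * \<omega> k c p v)"
  \<comment> \<open>Stated for every subset K, to add the forms one at a time.\<close>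
  have sum: "(\<lambda>c p v. \<Sum>k\<in>K. of_int (\<xi> k) * \<omega> k c p v) \<in> smooth_forms A 1 \<and>
      ext_deriv A 1 (\<lambda>c p v. \<Sum>k\<in>K. of_int (\<xi> k) * \<omega> k c p v) = (\<lambda>c p v. 0)"
    if "finite K" "K \<subseteq> {1..m}" for K
    using that
  proof (induction K)
    case empty
    then show ?case by (simp add: F.smooth_forms_zero)
  next
    case (insert j K)
    then have j: "\<omega> j \<in> smooth_forms A 1" "ext_deriv A 1 (\<omega> j) = (\<lambda>c p v. 0)"
      using assms(4,5) by (auto simp: closed_form_def zero_fun_def)
    note s = F.smooth_forms_linear[OF j(1) bounded_linear_mult_right[of "of_int (\<xi> j)"]]
    show ?case
      using F.smooth_forms_add[OF s(1), of "\<lambda>c p v. \<Sum>k\<in>K. of_int (\<xi> k) * \<omega> k c p v"] insert j(2) s(2) by simp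
  qed
  have "is_pullback A (gmul g) \<theta> \<theta>" for g
  proof (rule is_pullbackI)
    fix U \<phi> V \<psi> p v assume h: "(U, \<phi>) \<in> A" "(V, \<psi>) \<in> A" "p \<in> U" "gmul g p \<in> V"
    show "\<theta> (U, \<phi>) p v = \<theta> (V, \<psi>) (gmul g p) (\<lambda>i. fd (\<psi> \<circ> gmul g \<circ> inv_into U \<phi>) (\<phi> p) (v i))"
      unfolding \<theta>_def
    proof (rule sum.cong[OF refl])
      fix k assume "k \<in> {1..m}"
      then have "is_pullback A (gmul g) (\<omega> k) (\<omega> k)" using assms(6) unfolding left_invariant_def by blast
      from is_pullbackD[OF this h, of v]
      show "of_int (\<xi> k) * \<omega> k (U, \<phi>) p v =
          of_int (\<xi> k) * \<omega> k (V, \<psi>) (gmul g p) (\<lambda>i. fd (\<psi> \<circ> gmul g \<circ> inv_into U \<phi>) (\<phi> p) (v i))" by simp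
    qed
  qed
  then have inv: "left_invariant gmul A \<theta>" by (simp add: left_invariant_def)
  interpret twisted_lie_group gmul one iv A n B \<theta>
    by unfold_locales (use assms(3) sum[of "{1..m}"] inv in \<open>auto simp: \<theta>_def\<close>)
  have tw: "twisted_d A m \<omega> \<xi> r f = tw r f" for r f
  proof -
    have "(\<Sum>k=1..m. of_int (\<xi> k) * wedge_one r (\<omega> k) f c p v) = wedge_one r \<theta> f c p v" for c p v
    proof -
      have "(\<Sum>k=1..m. of_int (\<xi> k) * wedge_one r (\<omega> k) f c p v) =
          (\<Sum>i\<le>r. \<Sum>k=1..m. of_int (\<xi> k) * (((-1) ^ i * \<omega> k c p (\<lambda>_. v i)) *\<^sub>R f c p (omit i v)))"
        unfolding wedge_one_def sum_distrib_left by (rule sum.swap)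
      also have "\<dots> = wedge_one r \<theta> f c p v"
        unfolding wedge_one_def \<theta>_def
        by (intro sum.cong refl)
          (simp add: scaleR_conv_of_real sum_distrib_left sum_distrib_right mult_ac)
      finally show ?thesis .
    qed
    then show ?thesis by (simp add: twisted_d_def tw_def)
  qed
  have Z: "twisted_cocycles A m \<omega> \<xi> q = cocycles q"
    by (simp add: twisted_cocycles_def cocycles_def tw zero_fun_def)
  have "twisted_coboundaries A m \<omega> \<xi> q = coboundaries q"
    by (simp add: twisted_coboundaries_def coboundaries_def tw[abs_def] zero_fun_def)
  moreover have sub: "cocycles q \<subseteq> coboundaries q"
  proof (rule ccontr)
    assume "\<not> cocycles q \<subseteq> coboundaries q"
    from nonvanishing_section[OF this] have "\<xi> \<in> Gamma_group A m \<omega>"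
      using \<xi> by (auto simp: Gamma_group_def tw zero_fun_def)
    then show False using \<xi> by blast
  qed
  moreover have "f - g \<in> cocycles q" if "f \<in> cocycles q" "g \<in> cocycles q" for f g
  proof -
    have "f - g = (\<lambda>c p v. 1 * f c p v + (-1) * g c p v)" by (simp add: fun_eq_iff)
    then show ?thesis using cocycles_linear[OF that, of 1 "-1"] by simp
  qed
  \<comment> \<open>Every difference of cocycles is a cocycle, hence a coboundary, so the relation
    is total. The set of cocycles contains 0, and the quotient is exactly its class.\<close>
  ultimately have "cohomologous A m \<omega> \<xi> q = cocycles q \<times> cocycles q"
    unfolding cohomologous_def Z by auto
  moreover have "0 \<in> cocycles q" using zero_cocycle by (simp add: zero_fun_def)
  ultimately show "twisted_cohomology A m \<omega> \<xi> q = {cohomology_class A m \<omega> \<xi> q 0}"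
    unfolding twisted_cohomology_def cohomology_class_def Z quotient_def by auto
qed

end
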